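(* Let $q\in(2,3]$ and let $\{\xi_{j,n}:1\le j\le n\}$ be a centered triangular array as in the context with $\lim_{n\to\infty}\sigma_n=\infty$. Assume that $\sup_n\max_{j\le n}\|\xi_{j,n}\|_{L^\infty}<\infty$ and that $\phi(m_0)<\frac12$ for some $m_0\in\mathbb N$. Let $\Phi$ be the standard normal distribution function. Then: (i) If $\alpha_n(j)\le Bj^{-a}$ (for all $n$ and $1\le j\le n$) for some constants $B,a>1$, then $$\sup_{t\in\mathbb R}|\mathbb P(S_n/\sigma_n\le t)-\Phi(t)|=O(\sigma_n^{-(1-2\gamma)}),\qquad \gamma=\frac{q-1}{a(q-2)(2q)^{-1}+2(q-1)}.$$ (ii) If there exist constants $\kappa>0$ and $B>1$ such that $\alpha_n(j)\le Be^{-\kappa j}$ (for all $n$ and $1\le j\le n$), then $$\sup_{t\in\mathbb R}|\mathbb P(S_n/\sigma_n\le t)-\Phi(t)|=O(\sigma_n^{-1}\ln^3(\sigma_n)).$$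
   Context: Setting. For each $n$, $\zeta_{1,n},\dots,\zeta_{n,n}$ are random variables on a probability space $(\Omega,\mathcal F,\mathbb P)$ with values in measurable spaces; $\xi_{j,n}=g_{j,n}(\zeta_{j,n})$ with $g_{j,n}$ real-valued measurable and $\mathbb E[\xi_{j,n}]=0$; $S_n=\sum_{j=1}^n\xi_{j,n}$, $\sigma_n=\sqrt{\mathrm{Var}(S_n)}$. Mixing. $\alpha(\mathcal G,\mathcal H)=\sup\{|\mathbb P(A\cap B)-\mathbb P(A)\mathbb P(B)|:A\in\mathcal G,B\in\mathcal H\}$, $\phi(\mathcal G,\mathcal H)=\sup\{|\mathbb P(B|A)-\mathbb P(B)|:A\in\mathcal G,B\in\mathcal H,\mathbb P(A)>0\}$. For $k\le n$, $\alpha_n(k)$ (resp. $\phi_n(k)$) is the supremum over $s\le n-k$ of $\alpha$ (resp. $\phi$) of the pair $\sigma\{\zeta_{j,n}:j\le s\}$, $\sigma\{\zeta_{j,n}:s+k\le j\le n\}$; $\phi(k)=\sup_n\phi_n(k)$. *)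

theory Defs
  imports "HOL-Probability.Probability" "HOL-Library.Landau_Symbols"
begin

text \<open>
  A triangular array is a function of the column index j and the row number n, applied in this
  order as in \<open>\<zeta> j n\<close>; only the entries with \<open>1 \<le> j \<le> n\<close> are relevant. The entry \<open>\<zeta> j n\<close> takes
  values in the measurable space \<open>N j n\<close>. The spaces may differ arbitrarily from entry to entry,
  except that their elements share one HOL type.
\<close>

definition alpha_coeff :: "'w measure \<Rightarrow> 'w set set \<Rightarrow> 'w set set \<Rightarrow> real" where
  "alpha_coeff M \<G> \<H> =
     Sup {\<bar>measure M (A \<inter> B) - measure M A * measure M B\<bar> | A B. A \<in> \<G> \<and> B \<in> \<H>}"

definition phi_coeff :: "'w measure \<Rightarrow> 'w set set \<Rightarrow> 'w set set \<Rightarrow> real" where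
  "phi_coeff M \<G> \<H> =
     Sup {\<bar>\<P>(\<omega> in M. \<omega> \<in> B \<bar> \<omega> \<in> A) - measure M B\<bar> | A B.
            A \<in> \<G> \<and> B \<in> \<H> \<and> measure M A > 0}"

definition row_sigma ::
  "'w measure \<Rightarrow> (nat \<Rightarrow> nat \<Rightarrow> 'b measure) \<Rightarrow> (nat \<Rightarrow> nat \<Rightarrow> 'w \<Rightarrow> 'b) \<Rightarrow> nat \<Rightarrow> nat set \<Rightarrow> 'w set set"
where
  "row_sigma M N \<zeta> n J =
     sigma_sets (space M) (\<Union>j\<in>J. {\<zeta> j n -` A \<inter> space M | A. A \<in> sets (N j n)})"

text \<open>
  The row coefficients are meaningful for \<open>k \<le> n\<close> only: for \<open>k > n\<close> they are suprema over the
  empty set. The value \<open>s = 0\<close> gives a trivial first sigma-algebra and contributes 0.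
\<close>

definition alpha_row ::
  "'w measure \<Rightarrow> (nat \<Rightarrow> nat \<Rightarrow> 'b measure) \<Rightarrow> (nat \<Rightarrow> nat \<Rightarrow> 'w \<Rightarrow> 'b) \<Rightarrow> nat \<Rightarrow> nat \<Rightarrow> real"
where
  "alpha_row M N \<zeta> n k =
     (SUP s\<in>{s. s + k \<le> n}. alpha_coeff M (row_sigma M N \<zeta> n {j. 1 \<le> j \<and> j \<le> s})
                                          (row_sigma M N \<zeta> n {j. 1 \<le> j \<and> s + k \<le> j \<and> j \<le> n}))"

definition phi_row ::
  "'w measure \<Rightarrow> (nat \<Rightarrow> nat \<Rightarrow> 'b measure) \<Rightarrow> (nat \<Rightarrow> nat \<Rightarrow> 'w \<Rightarrow> 'b) \<Rightarrow> nat \<Rightarrow> nat \<Rightarrow> real"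
where
  "phi_row M N \<zeta> n k =
     (SUP s\<in>{s. s + k \<le> n}. phi_coeff M (row_sigma M N \<zeta> n {j. 1 \<le> j \<and> j \<le> s})
                                        (row_sigma M N \<zeta> n {j. 1 \<le> j \<and> s + k \<le> j \<and> j \<le> n}))"

definition phi_mix ::
  "'w measure \<Rightarrow> (nat \<Rightarrow> nat \<Rightarrow> 'b measure) \<Rightarrow> (nat \<Rightarrow> nat \<Rightarrow> 'w \<Rightarrow> 'b) \<Rightarrow> nat \<Rightarrow> real"
where
  "phi_mix M N \<zeta> k = (SUP n\<in>{n. 1 \<le> n \<and> k \<le> n}. phi_row M N \<zeta> n k)"

definition Linf_norm :: "'w measure \<Rightarrow> ('w \<Rightarrow> real) \<Rightarrow> ereal" where
  "Linf_norm M f = esssup M (\<lambda>\<omega>. ereal \<bar>f \<omega>\<bar>)"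

definition row_sum :: "(nat \<Rightarrow> nat \<Rightarrow> 'w \<Rightarrow> real) \<Rightarrow> nat \<Rightarrow> 'w \<Rightarrow> real" where
  "row_sum \<xi> n \<omega> = (\<Sum>j=1..n. \<xi> j n \<omega>)"

definition row_sd :: "'w measure \<Rightarrow> (nat \<Rightarrow> nat \<Rightarrow> 'w \<Rightarrow> real) \<Rightarrow> nat \<Rightarrow> real" where
  "row_sd M \<xi> n = sqrt (prob_space.variance M (row_sum \<xi> n))"

definition kolmogorov_distance :: "'w measure \<Rightarrow> (nat \<Rightarrow> nat \<Rightarrow> 'w \<Rightarrow> real) \<Rightarrow> nat \<Rightarrow> real" where
  "kolmogorov_distance M \<xi> n =
     (SUP t::real. \<bar>\<P>(\<omega> in M. row_sum \<xi> n \<omega> / row_sd M \<xi> n \<le> t)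
                     - cdf std_normal_distribution t\<bar>)"

end

theory Submission
  imports Defs "HOL-Real_Asymp.Real_Asymp"
begin

text \<open>
  Cut a row into consecutive blocks whose variances are all of order \<open>V\<close>, where \<open>V\<close> grows slowly
  with \<open>\<sigma>\<close>: \<open>V = \<sigma> powr (40 / (a + 24))\<close> in case (i) and \<open>V = C * ln \<sigma>\<close> in case (ii). A block has at least
  \<open>const * V\<close> terms, so blocks that are not adjacent are almost independent. Since
  \<open>\<phi>(m\<^sub>0) < 1/2\<close>, maximal inequalities of Ottaviani and Hoffmann-Joergensen type show that all moments
  of a block are of the order given by its variance.

  With \<open>Z\<^sub>j = exp (i t y\<^sub>j) - 1\<close> for the normalised block sums \<open>y\<^sub>j\<close>, the characteristic functions \<open>F\<^sub>i\<close>
  of the partial sums satisfy, up to the mixing error, the linear recursion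
  \<open>F\<^sub>i = F\<^sub>i\<^sub>-\<^sub>1 + \<Sum>\<^sub>r c\<^sub>i\<^sub>r F\<^sub>i\<^sub>-\<^sub>r\<^sub>-\<^sub>1\<close> with \<open>c\<^sub>i\<^sub>r = E (Z\<^sub>i\<^sub>-\<^sub>r\<^sub>+\<^sub>1 \<dots> Z\<^sub>i)\<close>. Gaussian functions satisfy it up to a third
  order error and the recursion is contracting, so \<open>F\<close> is close to a Gaussian for all
  \<open>\<bar>t\<bar> \<le> const * \<sigma> / sqrt V\<close>. Smoothing with a Gaussian of standard deviation \<open>sqrt (ln \<sigma>) * sqrt V / \<sigma>\<close>
  turns this into a bound for the Kolmogorov distance. It is of order
  \<open>sqrt (ln \<sigma>) * sqrt V / \<sigma>\<close> up to terms controlled by the mixing error. In case (i) this gives the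
  exponent \<open>a / (a + 24)\<close>, which is \<open>1 - 2 \<gamma>\<close> for \<open>q = 3\<close> and at least that for smaller \<open>q\<close>.
\<close>

section \<open>Gaussian smoothing\<close>

text \<open>A moment of order \<open>m\<close> turns a mixing coefficient into its power
  \<open>1 - 2 / m\<close>, and summing covariances over blocks requires
  \<open>a * (1 - 2 / m) > 1\<close>. For \<open>a\<close> near 1 this forces \<open>m\<close> to be
  large, which is why geometric tails, hence moments of every order, are extracted from the
  condition on \<phi>. The blocks fill the row without gaps, so neighbours are dependent and the
  characteristic function does not factor. Expanding \<open>e = 1 + Z\<close> deletes one block
  before each factorisation; the coefficients \<open>c\<close> are the price. Neighbouring blocks
  are still almost uncorrelated: detaching a fixed number of terms costs order \<open>sqrt V\<close>
  and leaves a fixed distance. Hence every block carries a positive share of the variance, and this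
  makes the recursion contract by \<open>1 - const * u^2\<close>, with \<open>u\<close> the size of
  \<open>t\<close> times a block. Errors of order \<open>u^3\<close> per block then add up to order
  \<open>u\<close> only, however many blocks there are. The expansion is cut after \<nu> factors,
  with \<nu> about \<open>ln \<sigma> / 2\<close>: the mixing error grows like
  \<open>2^\<nu>\<close>, while the truncation error decays like a tiny constant to the power
  \<open>\<nu> / 2\<close>.\<close>

lemma std_normal_cdf_diff:
  assumes "a \<le> b"
  shows "cdf std_normal_distribution b - cdf std_normal_distribution a
    = (LINT y:{a<..b}|lborel. exp (- y\<^sup>2 / 2)) / sqrt (2 * pi)"
proof -
  interpret real_distribution std_normal_distribution by (rule real_dist_normal_dist)
  have "cdf std_normal_distribution b - cdf std_normal_distribution a
      = measure std_normal_distribution {a<..b}"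
    using assms by (cases "a = b") (auto intro: cdf_diff_eq)
  also have "\<dots> = (LINT y:{a<..b}|lborel. std_normal_density y)"
  proof -
    have "measure std_normal_distribution {a<..b} = (LINT y|std_normal_distribution. indicator {a<..b} y)"
      by simp
    also have "\<dots> = (LINT y|lborel. std_normal_density y *\<^sub>R indicator {a<..b} y)"
      by (rule integral_density) auto
    finally show ?thesis by (simp add: set_lebesgue_integral_def mult.commute)
  qed
  also have "\<dots> = (LINT y:{a<..b}|lborel. (1 / sqrt (2 * pi)) * exp (- y\<^sup>2 / 2))"
    by (simp add: std_normal_density_def)
  finally show ?thesis by simp
qed

lemma std_normal_cdf_lipschitz:
  assumes "a \<le> b"
  shows "cdf std_normal_distribution b - cdf std_normal_distribution a \<le> (b - a) / 2"
proof -
  have i1: "set_integrable lborel {a<..b} (\<lambda>y. exp (- y\<^sup>2 / 2) :: real)"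
  proof -
    have "set_integrable lborel {a..b} (\<lambda>y. exp (- y\<^sup>2 / 2) :: real)"
      by (intro borel_integrable_atLeastAtMost') (intro continuous_intros, auto)
    then show ?thesis by (rule set_integrable_subset) auto
  qed
  have "(LINT y:{a<..b}|lborel. exp (- y\<^sup>2 / 2)) \<le> (LINT y:{a<..b}|lborel. (1::real))"
    by (intro set_integral_mono i1)
      (auto simp: set_integrable_def emeasure_lborel_Ioc assms intro!: integrable_real_indicator)
  also have "\<dots> = b - a" using assms by (simp add: set_lebesgue_integral_def)
  finally have *: "(LINT y:{a<..b}|lborel. exp (- y\<^sup>2 / 2)) \<le> b - a" .
  have "4 \<le> 2 * pi" using pi_gt3 by simp
  then have "sqrt 4 \<le> sqrt (2 * pi)" by (rule real_sqrt_le_mono)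
  then have s: "2 \<le> sqrt (2 * pi)" by simp
  have "(LINT y:{a<..b}|lborel. exp (- y\<^sup>2 / 2)) / sqrt (2 * pi) \<le> (b - a) / 2"
    using * s assms by (intro frac_le) auto
  with std_normal_cdf_diff[OF assms] show ?thesis by simp
qed

lemma abs_sin_mult_div_le: "\<bar>sin (z * v) / z\<bar> \<le> \<bar>v :: real\<bar>"
proof (cases "z = 0")
  case False
  have "\<bar>sin (z * v)\<bar> \<le> \<bar>z * v\<bar>" by (rule abs_sin_x_le_abs_x)
  with False show ?thesis by (simp add: abs_mult field_simps)
qed simp

lemma std_normal_expectation_cos:
  "(LINT z|std_normal_distribution. cos (z * y)) = exp (- y\<^sup>2 / 2)"
proof -
  interpret real_distribution std_normal_distribution by (rule real_dist_normal_dist)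
  have "Re (char std_normal_distribution y) = (LINT z|std_normal_distribution. Re (iexp (y * z)))"
    unfolding char_def by (intro integral_Re[symmetric] integrable_iexp) auto
  then show ?thesis
    by (simp add: char_std_normal_distribution mult.commute Re_exp)
qed

text \<open>The function \<open>exp (- y^2 / 2)\<close> is the Gaussian mean of
  \<open>cos (z * y)\<close>. Integrating in y under this mean turns the cosine into
  \<open>sin (z * v) / z\<close>, an inversion formula in which the Gaussian itself supplies the
  convergence.\<close>

lemma std_normal_cdf_eq_expectation_sin:
  "cdf std_normal_distribution v - cdf std_normal_distribution 0
    = (LINT z|std_normal_distribution. sin (z * v) / z) / sqrt (2 * pi)"
proof -
  interpret N: real_distribution std_normal_distribution by (rule real_dist_normal_dist)
  interpret P: pair_sigma_finite std_normal_distribution lborel ..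
  have nonneg: "cdf std_normal_distribution b - cdf std_normal_distribution 0
      = (LINT z|std_normal_distribution. sin (z * b) / z) / sqrt (2 * pi)"
    and neg: "cdf std_normal_distribution 0 - cdf std_normal_distribution (- b)
      = (LINT z|std_normal_distribution. sin (z * b) / z) / sqrt (2 * pi)"
    if b: "0 \<le> b" for b :: real
  proof -
    have ind: "integrable lborel (indicator {a<..c} :: real \<Rightarrow> real)" for a c :: real
      by (cases "a \<le> c") (auto intro!: integrable_real_indicator simp: emeasure_lborel_Ioc)
    have int: "integrable (std_normal_distribution \<Otimes>\<^sub>M lborel)
        (\<lambda>(z, y). indicator {a<..c} y *\<^sub>R cos (z * y))" for a c :: real
    proof (rule P.Fubini_integrable)
      have eq: "(LINT y|lborel. norm (indicator {a<..c} y *\<^sub>R cos (z * y)))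
          \<le> (LINT y|lborel. indicator {a<..c} y)" for z
        by (rule integral_mono_AE'[OF ind]) (auto simp: indicator_def)
      show "integrable std_normal_distribution
          (\<lambda>z. LINT y|lborel. norm (case (z, y) of (z, y) \<Rightarrow> indicator {a<..c} y *\<^sub>R cos (z * y)))"
        using eq by (intro N.integrable_const_bound[where B="LINT y|lborel. indicator {a<..c} y"]) auto
      show "AE z in std_normal_distribution. integrable lborel
          (\<lambda>y. case (z, y) of (z, y) \<Rightarrow> indicator {a<..c} y *\<^sub>R cos (z * y))"
      proof (rule AE_I2, simp)
        fix z
        show "integrable lborel (\<lambda>y. indicator {a<..c} y * cos (z * y))"
          by (rule Bochner_Integration.integrable_bound[OF ind]) (auto simp: indicator_def)
      qed
    qed measurable
    have fub: "(LINT z|std_normal_distribution. (LINT y:{a<..c}|lborel. cos (z * y)))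
        = (LINT y:{a<..c}|lborel. exp (- y\<^sup>2 / 2))" for a c :: real
    proof -
      have "(LINT z|std_normal_distribution. (LINT y:{a<..c}|lborel. cos (z * y)))
        = (LINT y|lborel. LINT z|std_normal_distribution. indicator {a<..c} y *\<^sub>R cos (z * y))"
        unfolding set_lebesgue_integral_def by (rule P.Fubini_integral[OF int, symmetric])
      also have "\<dots> = (LINT y:{a<..c}|lborel. exp (- y\<^sup>2 / 2))"
        unfolding set_lebesgue_integral_def by (simp add: std_normal_expectation_cos)
      finally show ?thesis .
    qed
    have ftc: "(LINT y:{a<..c}|lborel. cos (z * y)) = sin (z * c) / z - sin (z * a) / z"
      if "a \<le> c" "z \<noteq> 0" for a c z :: real
    proof -
      have "(LINT y:{a<..c}|lborel. cos (z * y)) = (LBINT y=a..c. cos (z * y))"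
        using that by (simp add: interval_integral_Ioc)
      also have "\<dots> = sin (z * c) / z - sin (z * a) / z"
        using that
        by (intro interval_integral_FTC_finite)
           (auto intro!: continuous_intros derivative_eq_intros
             simp: has_real_derivative_iff_has_vector_derivative[symmetric])
      finally show ?thesis .
    qed
    \<comment> \<open>At \<open>z = 0\<close> the quotient is 0 by convention while the inner
      integral is the length of the interval, so the two agree only almost everywhere.\<close>
    have ae: "AE z in std_normal_distribution. z \<noteq> 0"
      by (auto simp: AE_density intro: AE_mp[OF AE_lborel_singleton[of 0]])
    have 1: "(LINT z|std_normal_distribution. (LINT y:{0<..b}|lborel. cos (z * y)))
        = (LINT z|std_normal_distribution. sin (z * b) / z)"
      using ae ftc[OF b] by (intro integral_cong_AE) (auto simp: set_lebesgue_integral_def)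
    have 2: "(LINT z|std_normal_distribution. (LINT y:{-b<..0}|lborel. cos (z * y)))
        = (LINT z|std_normal_distribution. sin (z * b) / z)"
      using ae ftc[of "-b" 0] b by (intro integral_cong_AE) (auto simp: set_lebesgue_integral_def)
    show "cdf std_normal_distribution b - cdf std_normal_distribution 0
        = (LINT z|std_normal_distribution. sin (z * b) / z) / sqrt (2 * pi)"
      using std_normal_cdf_diff[OF b] fub[of 0 b] 1 by simp
    show "cdf std_normal_distribution 0 - cdf std_normal_distribution (- b)
        = (LINT z|std_normal_distribution. sin (z * b) / z) / sqrt (2 * pi)"
      using std_normal_cdf_diff[of "-b" 0] b fub[of "-b" 0] 2 by simp
  qed
  show ?thesis
  proof (cases "0 \<le> v")
    case True then show ?thesis by (rule nonneg)
  next
    case False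
    then show ?thesis using neg[of "-v"] by simp
  qed
qed

text \<open>Take \<open>v = (x - X) / s\<close> in the sine formula and exchange the means over X
  and z: the sine becomes the imaginary part of a characteristic function at \<open>- z / s\<close>.
  The first moment of X justifies Fubini, because the quotient is bounded by
  \<open>\<bar>v\<bar>\<close>.\<close>

lemma (in real_distribution) expectation_std_normal_cdf:
  assumes "integrable M (\<lambda>x. x)" and s: "s > 0"
  shows "(LINT X|M. cdf std_normal_distribution ((x - X) / s)) - cdf std_normal_distribution 0
      = (LINT z|std_normal_distribution. Im (iexp (z * x / s) * char M (- z / s)) / z) / sqrt (2 * pi)"
      (is ?eq)
    and "integrable std_normal_distribution (\<lambda>z. Im (iexp (z * x / s) * char M (- z / s)) / z)" (is ?int)
proof -
  interpret N: real_distribution std_normal_distribution by (rule real_dist_normal_dist)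
  interpret P: pair_sigma_finite M std_normal_distribution ..
  have [measurable]: "cdf std_normal_distribution \<in> borel_measurable borel"
    by (rule borel_measurable_mono) (auto simp: mono_def N.cdf_nondecreasing)
  have int1: "integrable M (\<lambda>X. cdf std_normal_distribution ((x - X) / s))"
    by (rule integrable_const_bound[where B=1]) (auto simp: N.cdf_nonneg N.cdf_bounded_prob)
  have intz: "integrable std_normal_distribution (\<lambda>z. sin (z * v) / z)" for v
    by (rule N.integrable_const_bound[where B="\<bar>v\<bar>"]) (use abs_sin_mult_div_le in auto)
  have int: "integrable (M \<Otimes>\<^sub>M std_normal_distribution) (\<lambda>(X, z). sin (z * ((x - X) / s)) / z)"
  proof (rule P.Fubini_integrable)
    have le: "(LINT z|std_normal_distribution. \<bar>sin (z * v) / z\<bar>) \<le> \<bar>v\<bar>" for v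
    proof -
      have "(LINT z|std_normal_distribution. \<bar>sin (z * v) / z\<bar>) \<le> (LINT z|std_normal_distribution. \<bar>v\<bar>)"
        by (intro integral_mono integrable_abs intz abs_sin_mult_div_le) simp
      then show ?thesis using N.prob_space by simp
    qed
    have ge: "0 \<le> (LINT z|std_normal_distribution. \<bar>sin (z * v) / z\<bar>)" for v by simp
    have "integrable M (\<lambda>X. (LINT z|std_normal_distribution. \<bar>sin (z * ((x - X) / s)) / z\<bar>))"
    proof (rule Bochner_Integration.integrable_bound[where f="\<lambda>X. (x - X) / s"])
      show "integrable M (\<lambda>X. (x - X) / s)" using assms(1) by simp
      show "(\<lambda>X. (LINT z|std_normal_distribution. \<bar>sin (z * ((x - X) / s)) / z\<bar>)) \<in> borel_measurable M"
        by measurable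
      show "AE X in M. norm (LINT z|std_normal_distribution. \<bar>sin (z * ((x - X) / s)) / z\<bar>)
          \<le> norm ((x - X) / s)"
        by (intro AE_I2) (simp only: real_norm_def abs_of_nonneg[OF ge] le)
    qed
    then show "integrable M (\<lambda>X. LINT z|std_normal_distribution.
        norm (case (X, z) of (X, z) \<Rightarrow> sin (z * ((x - X) / s)) / z))" by simp
    show "AE X in M. integrable std_normal_distribution (\<lambda>z. case (X, z) of (X, z) \<Rightarrow> sin (z * ((x - X) / s)) / z)"
      using intz by (intro AE_I2) (simp only: prod.case)
  qed measurable
  have "(LINT X|M. cdf std_normal_distribution ((x - X) / s)) - cdf std_normal_distribution 0
     = (LINT X|M. cdf std_normal_distribution ((x - X) / s) - cdf std_normal_distribution 0)"
    using int1 by (simp add: prob_space[simplified])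
  also have "\<dots> = (LINT X|M. LINT z|std_normal_distribution. sin (z * ((x - X) / s)) / z) / sqrt (2 * pi)"
    by (simp only: std_normal_cdf_eq_expectation_sin integral_divide_zero)
  also have "(LINT X|M. LINT z|std_normal_distribution. sin (z * ((x - X) / s)) / z)
     = (LINT z|std_normal_distribution. LINT X|M. sin (z * ((x - X) / s)) / z)"
    by (rule P.Fubini_integral[OF int, symmetric])
  also have char: "(\<lambda>z. LINT X|M. sin (z * ((x - X) / s)) / z)
     = (\<lambda>z. Im (iexp (z * x / s) * char M (- z / s)) / z)"
  proof
    fix z
    have i: "integrable M (\<lambda>X. iexp (z * x / s) * iexp (- z / s * X))"
      by (intro integrable_mult_right integrable_iexp) auto
    have "iexp (z * x / s) * char M (- z / s) = (LINT X|M. iexp (z * x / s) * iexp (- z / s * X))"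
      unfolding char_def by simp
    then have "Im (iexp (z * x / s) * char M (- z / s)) = (LINT X|M. Im (iexp (z * x / s) * iexp (- z / s * X)))"
      using integral_Im[OF i] by simp
    also have "\<dots> = (LINT X|M. sin (z * ((x - X) / s)))"
    proof (rule Bochner_Integration.integral_cong[OF refl])
      fix X
      have "iexp (z * x / s) * iexp (- z / s * X) = iexp (z * ((x - X) / s))"
        unfolding exp_add[symmetric] by (rule arg_cong[where f=exp]) (use s in \<open>simp add: field_simps\<close>)
      then show "Im (iexp (z * x / s) * iexp (- z / s * X)) = sin (z * ((x - X) / s))"
        by (simp add: Im_exp)
    qed
    finally show "(LINT X|M. sin (z * ((x - X) / s)) / z) = Im (iexp (z * x / s) * char M (- z / s)) / z"
      by simp
  qed
  finally show ?eq .
  show ?int using P.integrable_snd[OF int] unfolding char .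
qed

text \<open>Both sides are the probability of \<open>X + s * z \<le> x\<close> for independent X and
  z.\<close>

lemma (in real_distribution) expectation_cdf_shift:
  assumes s: "s > 0"
  shows "(LINT z|std_normal_distribution. cdf M (x - s * z))
    = (LINT X|M. cdf std_normal_distribution ((x - X) / s))"
proof -
  interpret N: real_distribution std_normal_distribution by (rule real_dist_normal_dist)
  interpret P: pair_sigma_finite M std_normal_distribution ..
  interpret PP: pair_prob_space M std_normal_distribution ..
  define f :: "real \<times> real \<Rightarrow> real" where "f = (\<lambda>(X, z). indicator {p. fst p + s * snd p \<le> x} (X, z))"
  have [measurable]: "f \<in> borel_measurable (M \<Otimes>\<^sub>M std_normal_distribution)"
    unfolding f_def by measurable
  have int: "integrable (M \<Otimes>\<^sub>M std_normal_distribution) (\<lambda>(X, z). f (X, z))"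
    by (rule PP.integrable_const_bound[where B=1]) (auto simp: f_def)
  have "(LINT z|std_normal_distribution. LINT X|M. f (X, z)) = (LINT X|M. LINT z|std_normal_distribution. f (X, z))"
    by (rule P.Fubini_integral[OF int])
  moreover have "(LINT X|M. f (X, z)) = cdf M (x - s * z)" for z
  proof -
    have "(LINT X|M. f (X, z)) = (LINT X|M. indicator {..x - s * z} X)"
      by (rule Bochner_Integration.integral_cong) (auto simp: f_def indicator_def)
    then show ?thesis by (simp add: cdf_def)
  qed
  moreover have "(LINT z|std_normal_distribution. f (X, z)) = cdf std_normal_distribution ((x - X) / s)" for X
  proof -
    have "(LINT z|std_normal_distribution. f (X, z)) = (LINT z|std_normal_distribution. indicator {..(x - X) / s} z)"
      by (rule Bochner_Integration.integral_cong) (use s in \<open>auto simp: f_def indicator_def field_simps\<close>)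
    then show ?thesis by (simp add: cdf_def)
  qed
  ultimately show ?thesis by simp
qed

text \<open>The factor \<open>\<bar>t\<bar>\<close> in the hypothesis cancels the singular weight
  \<open>1 / z\<close>, and the substitution \<open>t = - z / s\<close> leaves \<open>1 / s\<close>.
  The Gaussian weight takes the place of a sharp frequency cut-off.\<close>

lemma (in real_distribution) smoothed_cdf_diff_le:
  assumes int: "integrable M (\<lambda>x. x)" and s: "s > 0"
    and h: "\<And>t. norm (char M t - char std_normal_distribution t) \<le> \<bar>t\<bar> * h t"
    and h0: "\<And>t. 0 \<le> h t"
    and ih: "integrable std_normal_distribution (\<lambda>z. h (- z / s))"
  shows "\<bar>(LINT z|std_normal_distribution. cdf M (x - s * z) - cdf std_normal_distribution (x - s * z))\<bar>
    \<le> (LINT z|std_normal_distribution. h (- z / s)) / s"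
proof -
  interpret N: real_distribution std_normal_distribution by (rule real_dist_normal_dist)
  have mono_cdf: "cdf R \<in> borel_measurable borel" if "real_distribution R" for R
  proof -
    interpret R: real_distribution R by fact
    show ?thesis by (rule borel_measurable_mono) (auto simp: mono_def R.cdf_nondecreasing)
  qed
  have [measurable]: "cdf std_normal_distribution \<in> borel_measurable borel" "cdf M \<in> borel_measurable borel"
    by (auto intro!: mono_cdf real_dist_normal_dist) unfold_locales
  have i1: "integrable std_normal_distribution (\<lambda>z. cdf M (x - s * z))"
    by (rule N.integrable_const_bound[where B=1]) (auto simp: cdf_nonneg cdf_bounded_prob)
  have i2: "integrable std_normal_distribution (\<lambda>z. cdf std_normal_distribution (x - s * z))"
    by (rule N.integrable_const_bound[where B=1]) (auto simp: N.cdf_nonneg N.cdf_bounded_prob)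
  have intN: "integrable std_normal_distribution (\<lambda>x. x)"
    using integrable_std_normal_distribution_moment[of 1] by simp
  define k where "k R z = Im (iexp (z * x / s) * char R (- z / s)) / z" for R :: "real measure" and z :: real
  have kb: "\<bar>k M z - k std_normal_distribution z\<bar> \<le> h (- z / s) / s" for z
  proof (cases "z = 0")
    case True
    then show ?thesis using h0 s by (simp add: k_def)
  next
    case False
    have "k M z - k std_normal_distribution z = Im (iexp (z * x / s) * (char M (- z / s) - char std_normal_distribution (- z / s))) / z"
      by (simp add: k_def right_diff_distrib diff_divide_distrib)
    also have "\<bar>\<dots>\<bar> \<le> norm (iexp (z * x / s) * (char M (- z / s) - char std_normal_distribution (- z / s))) / \<bar>z\<bar>"
      unfolding abs_divide by (intro divide_right_mono abs_Im_le_cmod) simp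
    also have "\<dots> = norm (char M (- z / s) - char std_normal_distribution (- z / s)) / \<bar>z\<bar>"
      by (simp add: norm_mult)
    also have "\<dots> \<le> (\<bar>- z / s\<bar> * h (- z / s)) / \<bar>z\<bar>"
      by (intro divide_right_mono h) auto
    also have "\<dots> = h (- z / s) / s" using False s by (simp add: abs_div)
    finally show ?thesis .
  qed
  have eqR: "(LINT z|std_normal_distribution. cdf R (x - s * z)) - cdf std_normal_distribution 0
      = (LINT z|std_normal_distribution. k R z) / sqrt (2 * pi)"
    and intk: "integrable std_normal_distribution (k R)"
    if "real_distribution R" "integrable R (\<lambda>x. x)" for R
  proof -
    interpret R: real_distribution R by fact
    show "(LINT z|std_normal_distribution. cdf R (x - s * z)) - cdf std_normal_distribution 0
      = (LINT z|std_normal_distribution. k R z) / sqrt (2 * pi)"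
      unfolding R.expectation_cdf_shift[OF s] R.expectation_std_normal_cdf[OF that(2) s] k_def ..
    show "integrable std_normal_distribution (k R)"
      using R.expectation_std_normal_cdf(2)[OF that(2) s] unfolding k_def .
  qed
  have M: "real_distribution M" by unfold_locales
  note kM = intk[OF M int] and kN = intk[OF real_dist_normal_dist intN]
  have "(LINT z|std_normal_distribution. cdf M (x - s * z) - cdf std_normal_distribution (x - s * z))
      = (LINT z|std_normal_distribution. k M z - k std_normal_distribution z) / sqrt (2 * pi)"
    using eqR[OF M int] eqR[OF real_dist_normal_dist intN] i1 i2 kM kN
    by (simp add: diff_divide_distrib)
  also have "\<bar>\<dots>\<bar> \<le> \<bar>LINT z|std_normal_distribution. k M z - k std_normal_distribution z\<bar>"
  proof -
    have "1 \<le> sqrt (2 * pi)" using pi_gt3 by simp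
    then show ?thesis by (simp add: divide_le_eq mult_le_cancel_left1)
  qed
  also have "\<dots> \<le> (LINT z|std_normal_distribution. h (- z / s) / s)"
    by (intro integral_abs_bound_integral kb Bochner_Integration.integrable_diff kM kN
        integrable_divide_zero) (use ih in simp_all)
  finally show ?thesis by simp
qed
text \<open>Removes the smoothing, in the manner of Esseen. With \<Delta> the supremum of the
  difference, the argument gives
  \<open>\<Delta>^2 \<le> 2 * \<epsilon> * \<Delta> + 4 * s^2\<close>, which is impossible for
  \<Delta> above \<open>2 * \<epsilon> + 2 * s\<close>.\<close>

lemma (in real_distribution) cdf_dist_std_normal_le:
  assumes s: "s > 0"
    and D: "\<And>x. \<bar>(LINT z|std_normal_distribution. cdf M (x - s * z) - cdf std_normal_distribution (x - s * z))\<bar> \<le> \<epsilon>"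
  shows "\<bar>cdf M x - cdf std_normal_distribution x\<bar> \<le> 2 * \<epsilon> + 2 * s"
proof -
  interpret N: real_distribution std_normal_distribution by (rule real_dist_normal_dist)
  define G where "G x = cdf M x - cdf std_normal_distribution x" for x
  define \<Delta> where "\<Delta> = (SUP x. \<bar>G x\<bar>)"
  have [measurable]: "cdf std_normal_distribution \<in> borel_measurable borel" "cdf M \<in> borel_measurable borel"
    by (rule borel_measurable_mono; auto simp: mono_def N.cdf_nondecreasing cdf_nondecreasing)+
  have [measurable]: "G \<in> borel_measurable borel" unfolding G_def by measurable
  have G1: "\<bar>G x\<bar> \<le> 1" for x
    using cdf_nonneg[of x] cdf_bounded_prob[of x] N.cdf_nonneg[of x] N.cdf_bounded_prob[of x]
    by (simp add: G_def)
  have bdd: "bdd_above (range (\<lambda>x. \<bar>G x\<bar>))" using G1 by (intro bdd_aboveI2)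
  have le: "\<bar>G x\<bar> \<le> \<Delta>" for x unfolding \<Delta>_def by (rule cSUP_upper[OF UNIV_I bdd])
  have \<Delta>0: "0 \<le> \<Delta>" using le[of 0] by linarith
  have e0: "0 \<le> \<epsilon>" using D[of 0] by linarith
  have intG: "integrable std_normal_distribution (\<lambda>z. G (x - s * z))" for x
    using G1 by (intro N.integrable_const_bound[where B=1]) auto
  have i1: "integrable std_normal_distribution (\<lambda>z. z)"
    using integrable_std_normal_distribution_moment[of 1] by simp
  have i2: "integrable std_normal_distribution (\<lambda>z. z\<^sup>2)"
    by (rule integrable_std_normal_distribution_moment)
  have m1: "(LINT z|std_normal_distribution. z) = 0"
    using integral_std_normal_distribution_moment_odd[of 1] by simp
  have m2: "(LINT z|std_normal_distribution. z\<^sup>2) = 1"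
    using std_normal_distribution_even_moments(1)[of 1] by simp
  \<comment> \<open>Shifting by \<open>\<Delta>\<close> keeps half of an extreme value of \<open>G\<close> on the window \<open>\<bar>s z\<bar> < \<Delta>\<close>, since
    \<open>cdf M\<close> is monotone and the normal cdf has Lipschitz constant at most 1/2.\<close>
  have key: "\<bar>G x\<bar> * \<Delta> - \<Delta>\<^sup>2 / 2 \<le> \<epsilon> * \<Delta> + 2 * s\<^sup>2" for x
  proof (cases "\<Delta> = 0")
    case False
    then have \<Delta>: "\<Delta> > 0" using \<Delta>0 by simp
    define c :: real where "c = (if G x \<ge> 0 then 1 else -1)"
    have c: "c * G x = \<bar>G x\<bar>" "\<bar>c\<bar> = 1" "c * c = 1" by (auto simp: c_def)
    \<comment> \<open>The quadratic penalty pays for the range outside the window, where only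
      \<open>c * G \<ge> - \<Delta>\<close> is known; 2 is the least coefficient that suffices at
      \<open>\<bar>s z\<bar> = \<Delta>\<close>. On integration the linear term vanishes and the
      penalty becomes \<open>2 * s^2 / \<Delta>\<close>.\<close>
    have pw: "\<bar>G x\<bar> - \<Delta> / 2 + c * s * z / 2 - 2 * (s * z)\<^sup>2 / \<Delta> \<le> c * G (x + c * \<Delta> - s * z)" for z
    proof (cases "\<bar>s * z\<bar> < \<Delta>")
      case True
      have "0 \<le> 2 * (s * z)\<^sup>2 / \<Delta>" using \<Delta> by simp
      moreover have "\<bar>G x\<bar> - \<Delta> / 2 + c * s * z / 2 \<le> c * G (x + c * \<Delta> - s * z)"
      proof (cases "G x \<ge> 0")
        case True
        with \<open>\<bar>s * z\<bar> < \<Delta>\<close> have "x \<le> x + \<Delta> - s * z" by linarith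
        with cdf_nondecreasing[OF this] std_normal_cdf_lipschitz[OF this] show ?thesis
          using True unfolding c_def G_def by (simp add: field_simps)
      next
        case False
        with \<open>\<bar>s * z\<bar> < \<Delta>\<close> have "x - \<Delta> - s * z \<le> x" by linarith
        with cdf_nondecreasing[OF this] std_normal_cdf_lipschitz[OF this] show ?thesis
          using False unfolding c_def G_def by (simp add: field_simps)
      qed
      ultimately show ?thesis by linarith
    next
      case False
      have "\<bar>c * s * z\<bar> = \<bar>s * z\<bar>" using c(2) by (simp add: abs_mult)
      then have a: "c * s * z \<le> \<bar>s * z\<bar>" by linarith
      have "\<bar>s * z\<bar> * \<Delta> \<le> \<bar>s * z\<bar> * \<bar>s * z\<bar>" using False by (intro mult_left_mono) auto
      then have b: "\<bar>s * z\<bar> \<le> (s * z)\<^sup>2 / \<Delta>" using \<Delta> by (simp add: field_simps power2_eq_square)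
      have "\<bar>c * G (x + c * \<Delta> - s * z)\<bar> \<le> \<Delta>" using c(2) le by (simp add: abs_mult)
      then show ?thesis using a b le[of x] False by linarith
    qed
    have "\<bar>G x\<bar> - \<Delta> / 2 - 2 * s\<^sup>2 / \<Delta>
        = (LINT z|std_normal_distribution. \<bar>G x\<bar> - \<Delta> / 2 + c * s * z / 2 - 2 * (s * z)\<^sup>2 / \<Delta>)"
      using i1 i2 m1 m2 N.prob_space by (simp add: power_mult_distrib)
    also have "\<dots> \<le> (LINT z|std_normal_distribution. c * G (x + c * \<Delta> - s * z))"
      by (intro integral_mono pw) (use i1 i2 intG in \<open>simp_all add: power_mult_distrib\<close>)
    also have "\<dots> = c * (LINT z|std_normal_distribution. G (x + c * \<Delta> - s * z))" by simp
    also have "\<dots> \<le> \<bar>LINT z|std_normal_distribution. G (x + c * \<Delta> - s * z)\<bar>"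
      by (cases "G x \<ge> 0") (simp_all add: c_def)
    also have "\<dots> \<le> \<epsilon>" using D[of "x + c * \<Delta>"] unfolding G_def .
    finally have "(\<bar>G x\<bar> - \<Delta> / 2 - 2 * s\<^sup>2 / \<Delta>) * \<Delta> \<le> \<epsilon> * \<Delta>"
      using \<Delta> by (intro mult_right_mono) auto
    moreover have "2 * s\<^sup>2 / \<Delta> * \<Delta> = 2 * s\<^sup>2" using \<Delta> by simp
    ultimately show ?thesis by (simp add: left_diff_distrib power2_eq_square)
  qed simp
  have "\<Delta> * \<Delta> - \<Delta>\<^sup>2 / 2 \<le> \<epsilon> * \<Delta> + 2 * s\<^sup>2"
  proof (cases "\<Delta> = 0")
    case False
    then have \<Delta>: "\<Delta> > 0" using \<Delta>0 by simp
    have "\<Delta> \<le> (\<epsilon> * \<Delta> + 2 * s\<^sup>2 + \<Delta>\<^sup>2 / 2) / \<Delta>"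
      unfolding \<Delta>_def[symmetric]
      by (subst \<Delta>_def, rule cSUP_least) (use key \<Delta> in \<open>auto simp: pos_le_divide_eq algebra_simps\<close>)
    then show ?thesis using \<Delta> by (simp add: field_simps)
  qed simp
  then have q: "\<Delta> * \<Delta> \<le> 2 * \<epsilon> * \<Delta> + 4 * s\<^sup>2" by (simp add: power2_eq_square)
  have "\<Delta> \<le> 2 * \<epsilon> + 2 * s"
  proof (rule ccontr)
    assume "\<not> ?thesis"
    then have 1: "\<Delta> > 2 * \<epsilon> + 2 * s" by simp
    then have "2 * s * \<Delta> < (\<Delta> - 2 * \<epsilon>) * \<Delta>"
      using s e0 by (intro mult_strict_right_mono) auto
    moreover have "2 * s * (2 * s) \<le> 2 * s * \<Delta>"
      using s e0 1 by (intro mult_left_mono) auto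
    ultimately     show False using q by (simp add: algebra_simps power2_eq_square)
  qed
  with le[of x] show ?thesis by (simp add: G_def)
qed

section \<open>Covariance inequalities\<close>

text \<open>Sigma-algebras are encoded as measures so that measurability with respect to them can be
  expressed. \<alpha> is any upper bound and not the supremum, so coefficients may be replaced by
  larger ones.\<close>

definition mixing_le :: "'w measure \<Rightarrow> 'w measure \<Rightarrow> 'w measure \<Rightarrow> real \<Rightarrow> bool" where
  "mixing_le M F G \<alpha> \<longleftrightarrow> subalgebra M F \<and> subalgebra M G \<and>
     (\<forall>A\<in>sets F. \<forall>B\<in>sets G. \<bar>measure M (A \<inter> B) - measure M A * measure M B\<bar> \<le> \<alpha>)"

text \<open>If f is not integrable, its integral is 0 by convention, and g has a nonnegative
  integral since it dominates a norm.\<close>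

lemma norm_integral_le:
  fixes f :: "'a \<Rightarrow> 'b::{banach, second_countable_topology}"
  assumes "integrable M g" "\<And>x. x \<in> space M \<Longrightarrow> norm (f x) \<le> g x"
  shows "norm (integral\<^sup>L M f) \<le> integral\<^sup>L M g"
proof (cases "integrable M f")
  case True
  have "norm (integral\<^sup>L M f) \<le> (LINT x|M. norm (f x))" by (rule integral_norm_bound)
  also have "\<dots> \<le> integral\<^sup>L M g" using True assms by (intro integral_mono) auto
  finally show ?thesis .
next
  case False
  have "0 \<le> integral\<^sup>L M g"
    by (rule integral_nonneg_AE, rule AE_I2) (use assms(2) norm_ge_zero order_trans in blast)
  then show ?thesis using False by (simp add: not_integrable_integral_eq)
qed

context prob_space
begin

lemma integrable_bounded_real:
  assumes "f \<in> borel_measurable M" "\<And>x. x \<in> space M \<Longrightarrow> \<bar>f x :: real\<bar> \<le> c"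
  shows "integrable M f"
  using assms by (intro integrable_const_bound[where B=c]) auto

text \<open>The covariance is the mean of \<open>X * Z\<close> with Z the centred conditional
  expectation of Y. Among functions bounded by \<open>a\<close> this is largest for \<open>a\<close>
  times the sign of Z, and \<open>2 * indicator A - 1\<close> is that sign.\<close>

lemma covariance_sign:
  assumes sub: "subalgebra M F"
    and X: "X \<in> borel_measurable F" "\<And>x. x \<in> space M \<Longrightarrow> \<bar>X x\<bar> \<le> a" and a: "0 \<le> (a::real)"
    and Y: "integrable M Y"
  obtains A where "A \<in> sets F"
    "\<bar>expectation (\<lambda>x. X x * Y x) - expectation X * expectation Y\<bar>
      \<le> a * \<bar>expectation (\<lambda>x. (2 * indicator A x - 1) * Y x)
            - expectation (\<lambda>x. 2 * indicator A x - 1) * expectation Y\<bar>"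
proof -
  interpret F: finite_measure_subalgebra M F using sub by unfold_locales
  have [measurable]: "X \<in> borel_measurable M" "\<And>A. A \<in> sets F \<Longrightarrow> A \<in> sets M"
    using measurable_from_subalg[OF sub] X(1) sub by (auto simp: subalgebra_def)
  define Z where "Z x = real_cond_exp M F Y x - expectation Y" for x
  have ZF: "Z \<in> borel_measurable F" unfolding Z_def by measurable
  have Zi: "integrable M Z" unfolding Z_def using F.real_cond_exp_int(1)[OF Y] by simp
  define A where "A = {x \<in> space M. Z x \<ge> 0}"
  have sp: "space F = space M" using sub by (simp add: subalgebra_def)
  have AF: "A \<in> sets F" unfolding A_def sp[symmetric] using ZF by measurable
  have red: "expectation (\<lambda>x. U x * Y x) - expectation U * expectation Y = expectation (\<lambda>x. U x * Z x)"
    if UF: "U \<in> borel_measurable F" and Ub: "\<And>x. x \<in> space M \<Longrightarrow> \<bar>U x\<bar> \<le> c" for U and c :: real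
  proof -
    have [measurable]: "U \<in> borel_measurable M" by (rule measurable_from_subalg[OF sub UF])
    have iU: "integrable M U" by (rule integrable_bounded_real) (use Ub in auto)
    have iUV: "integrable M (\<lambda>x. U x * V x)" if "integrable M V" for V :: "'a \<Rightarrow> real"
    proof (rule Bochner_Integration.integrable_bound[where f="\<lambda>x. c * V x"])
      show "AE x in M. norm (U x * V x) \<le> norm (c * V x)"
      proof (rule AE_I2)
        fix x assume "x \<in> space M"
        then have "\<bar>U x\<bar> \<le> \<bar>c\<bar>" using Ub[of x] by linarith
        then show "norm (U x * V x) \<le> norm (c * V x)" by (simp add: abs_mult mult_right_mono)
      qed
    qed (use that in auto)
    have "expectation (\<lambda>x. U x * Y x) = expectation (\<lambda>x. U x * real_cond_exp M F Y x)"
      by (rule F.real_cond_exp_intg(2)[symmetric, OF iUV[OF Y] UF]) (use Y in auto)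
    moreover have "expectation (\<lambda>x. U x * Z x)
        = expectation (\<lambda>x. U x * real_cond_exp M F Y x - U x * expectation Y)"
      by (simp add: Z_def right_diff_distrib)
    moreover have "integrable M (\<lambda>x. U x * real_cond_exp M F Y x)"
      by (rule iUV[OF F.real_cond_exp_int(1)[OF Y]])
    ultimately show ?thesis using iU by simp
  qed
  have 1: "expectation (\<lambda>x. (2 * indicator A x - 1) * Z x) = expectation (\<lambda>x. \<bar>Z x\<bar>)"
    by (rule Bochner_Integration.integral_cong) (auto simp: A_def indicator_def)
  have "\<bar>expectation (\<lambda>x. X x * Z x)\<bar> \<le> expectation (\<lambda>x. a * \<bar>Z x\<bar>)"
  proof -
    have "norm (expectation (\<lambda>x. X x * Z x)) \<le> expectation (\<lambda>x. a * \<bar>Z x\<bar>)"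
      using Zi X(2) by (intro norm_integral_le) (auto simp: abs_mult mult_right_mono)
    then show ?thesis by simp
  qed
  then have "\<bar>expectation (\<lambda>x. X x * Z x)\<bar> \<le> a * \<bar>expectation (\<lambda>x. \<bar>Z x\<bar>)\<bar>" by simp
  then show ?thesis
    using red[OF X] red[of "\<lambda>x. 2 * indicator A x - 1" 1] AF 1
    by (intro that[OF AF]) (auto simp: indicator_def)
qed

text \<open>Both factors are replaced in turn by signs of events A and B, whose covariance is
  \<open>4 * (prob (A \<inter> B) - prob A * prob B)\<close>.\<close>

lemma covariance_le:
  assumes mix: "mixing_le M F G \<alpha>"
    and X: "X \<in> borel_measurable F" "\<And>x. x \<in> space M \<Longrightarrow> \<bar>X x\<bar> \<le> a" and a: "0 \<le> (a::real)"
    and Y: "Y \<in> borel_measurable G" "\<And>x. x \<in> space M \<Longrightarrow> \<bar>Y x\<bar> \<le> b" and b: "0 \<le> (b::real)"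
  shows "\<bar>expectation (\<lambda>x. X x * Y x) - expectation X * expectation Y\<bar> \<le> 4 * a * b * \<alpha>"
proof -
  have F: "subalgebra M F" and G: "subalgebra M G" using mix by (auto simp: mixing_le_def)
  have [measurable]: "Y \<in> borel_measurable M" by (rule measurable_from_subalg[OF G Y(1)])
  have iY: "integrable M Y" by (rule integrable_bounded_real) (use Y in auto)
  obtain A where A: "A \<in> sets F" and 1: "\<bar>expectation (\<lambda>x. X x * Y x) - expectation X * expectation Y\<bar>
      \<le> a * \<bar>expectation (\<lambda>x. (2 * indicator A x - 1) * Y x)
            - expectation (\<lambda>x. 2 * indicator A x - 1) * expectation Y\<bar>"
    using covariance_sign[OF F X a iY] by blast
  have [measurable]: "A \<in> sets M" using A F by (auto simp: subalgebra_def)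
  have iA: "integrable M (\<lambda>x. 2 * indicator A x - 1 :: real)"
    by (rule integrable_bounded_real[where c=1]) (auto simp: indicator_def)
  obtain B where B: "B \<in> sets G" and 2: "\<bar>expectation (\<lambda>x. Y x * (2 * indicator A x - 1))
        - expectation Y * expectation (\<lambda>x. 2 * indicator A x - 1)\<bar>
      \<le> b * \<bar>expectation (\<lambda>x. (2 * indicator B x - 1) * (2 * indicator A x - 1))
            - expectation (\<lambda>x. 2 * indicator B x - 1) * expectation (\<lambda>x. 2 * indicator A x - 1)\<bar>"
    using covariance_sign[OF G Y b iA] by blast
  have [measurable]: "B \<in> sets M" using B G by (auto simp: subalgebra_def)
  have ind: "expectation (\<lambda>x. 2 * indicator C x - 1 :: real) = 2 * prob C - 1" if C: "C \<in> sets M" for C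
  proof -
    have "integrable M (\<lambda>x. 2 * indicator C x :: real)"
      by (rule integrable_bounded_real[where c=2]) (use C in \<open>auto simp: indicator_def\<close>)
    then have "expectation (\<lambda>x. 2 * indicator C x - 1 :: real) = expectation (\<lambda>x. 2 * indicator C x) - expectation (\<lambda>x. 1)"
      by (rule Bochner_Integration.integral_diff) simp
    then show ?thesis using C prob_space by simp
  qed
  have [simp]: "integrable M (indicator C :: _ \<Rightarrow> real)" if "C \<in> sets M" for C
    by (rule integrable_bounded_real[where c=1]) (use that in \<open>auto simp: indicator_def\<close>)
  have "expectation (\<lambda>x. (2 * indicator B x - 1) * (2 * indicator A x - 1) :: real)
      = expectation (\<lambda>x. 4 * indicator (A \<inter> B) x - 2 * indicator A x - 2 * indicator B x + 1 :: real)"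
    by (rule Bochner_Integration.integral_cong) (auto simp: indicator_def)
  also have "\<dots> = 4 * prob (A \<inter> B) - 2 * prob A - 2 * prob B + 1"
    using prob_space by simp
  finally have 3: "expectation (\<lambda>x. (2 * indicator B x - 1) * (2 * indicator A x - 1) :: real)
      - expectation (\<lambda>x. 2 * indicator B x - 1) * expectation (\<lambda>x. 2 * indicator A x - 1)
      = 4 * (prob (A \<inter> B) - prob A * prob B)"
    by (simp only: ind[OF \<open>A \<in> sets M\<close>] ind[OF \<open>B \<in> sets M\<close>]) (simp add: algebra_simps)
  define D where "D = prob (A \<inter> B) - prob A * prob B"
  have "\<bar>D\<bar> \<le> \<alpha>" using mix A B by (simp add: mixing_le_def D_def)
  then have "\<bar>4 * D\<bar> \<le> 4 * \<alpha>" by (simp add: abs_mult)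
  then have "b * \<bar>4 * D\<bar> \<le> b * (4 * \<alpha>)" using b by (rule mult_left_mono)
  with 2 have "\<bar>expectation (\<lambda>x. Y x * (2 * indicator A x - 1))
        - expectation Y * expectation (\<lambda>x. 2 * indicator A x - 1)\<bar> \<le> b * (4 * \<alpha>)"
    unfolding 3 D_def by (rule order_trans)
  then have "a * \<bar>expectation (\<lambda>x. (2 * indicator A x - 1) * Y x)
            - expectation (\<lambda>x. 2 * indicator A x - 1) * expectation Y\<bar> \<le> a * (b * (4 * \<alpha>))"
    using a by (intro mult_left_mono) (simp_all add: mult.commute)
  with 1 show ?thesis by (simp add: algebra_simps)
qed

text \<open>Real and imaginary parts pair up in four ways, each costing
  \<open>4 * a * b * \<alpha>\<close>.\<close>

lemma covariance_complex_le:
  fixes X Y :: "'a \<Rightarrow> complex"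
  assumes mix: "mixing_le M F G \<alpha>"
    and X: "X \<in> borel_measurable F" "\<And>x. x \<in> space M \<Longrightarrow> norm (X x) \<le> a" and a: "0 \<le> a"
    and Y: "Y \<in> borel_measurable G" "\<And>x. x \<in> space M \<Longrightarrow> norm (Y x) \<le> b" and b: "0 \<le> b"
  shows "norm (expectation (\<lambda>x. X x * Y x) - expectation X * expectation Y) \<le> 16 * a * b * \<alpha>"
proof -
  have F: "subalgebra M F" and G: "subalgebra M G" using mix by (auto simp: mixing_le_def)
  have [measurable]: "Y \<in> borel_measurable M" "X \<in> borel_measurable M"
    by (rule measurable_from_subalg[OF G Y(1)] measurable_from_subalg[OF F X(1)])+
  have iX: "integrable M X" by (rule integrable_const_bound[where B=a]) (use X in auto)
  have iY: "integrable M Y" by (rule integrable_const_bound[where B=b]) (use Y in auto)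
  have iXY: "integrable M (\<lambda>x. X x * Y x)"
    by (rule integrable_const_bound[where B="a * b"])
       (use X(2) Y(2) a b in \<open>auto simp: norm_mult intro!: mult_mono\<close>)
  have i: "integrable M (\<lambda>x. f (X x) * g (Y x))"
    if "f = Re \<or> f = Im" "g = Re \<or> g = Im" for f g :: "complex \<Rightarrow> real"
  proof (rule integrable_bounded_real)
    show "(\<lambda>x. f (X x) * g (Y x)) \<in> borel_measurable M" using that by auto
    show "\<bar>f (X x) * g (Y x)\<bar> \<le> a * b" if x: "x \<in> space M" for x
    proof -
      have "\<bar>f (X x)\<bar> \<le> norm (X x)" "\<bar>g (Y x)\<bar> \<le> norm (Y x)"
        using \<open>f = Re \<or> f = Im\<close> \<open>g = Re \<or> g = Im\<close> abs_Re_le_cmod abs_Im_le_cmod by auto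
      with X(2)[OF x] Y(2)[OF x] a show ?thesis unfolding abs_mult by (intro mult_mono) auto
    qed
  qed
  have c: "\<bar>expectation (\<lambda>x. f (X x) * g (Y x)) - expectation (\<lambda>x. f (X x)) * expectation (\<lambda>x. g (Y x))\<bar>
      \<le> 4 * a * b * \<alpha>"
    if "f = Re \<or> f = Im" "g = Re \<or> g = Im" for f g :: "complex \<Rightarrow> real"
  proof (rule covariance_le[OF mix _ _ a _ _ b])
    show "(\<lambda>x. f (X x)) \<in> borel_measurable F" "(\<lambda>x. g (Y x)) \<in> borel_measurable G"
      using that X(1) Y(1) by auto
    show "\<bar>f (X x)\<bar> \<le> a" if "x \<in> space M" for x
      using X(2)[OF that] \<open>f = Re \<or> f = Im\<close> abs_Re_le_cmod[of "X x"] abs_Im_le_cmod[of "X x"] by auto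
    show "\<bar>g (Y x)\<bar> \<le> b" if "x \<in> space M" for x
      using Y(2)[OF that] \<open>g = Re \<or> g = Im\<close> abs_Re_le_cmod[of "Y x"] abs_Im_le_cmod[of "Y x"] by auto
  qed
  let ?D = "expectation (\<lambda>x. X x * Y x) - expectation X * expectation Y"
  have "Re ?D = (expectation (\<lambda>x. Re (X x) * Re (Y x)) - expectation (\<lambda>x. Re (X x)) * expectation (\<lambda>x. Re (Y x)))
      - (expectation (\<lambda>x. Im (X x) * Im (Y x)) - expectation (\<lambda>x. Im (X x)) * expectation (\<lambda>x. Im (Y x)))"
    using integral_Re[OF iXY] integral_Re[OF iX] integral_Re[OF iY] integral_Im[OF iX] integral_Im[OF iY]
      i[of Re Re] i[of Im Im]
    by simp
  with c[of Re Re] c[of Im Im] have re: "\<bar>Re ?D\<bar> \<le> 8 * a * b * \<alpha>" by simp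
  have "Im ?D = (expectation (\<lambda>x. Re (X x) * Im (Y x)) - expectation (\<lambda>x. Re (X x)) * expectation (\<lambda>x. Im (Y x)))
      + (expectation (\<lambda>x. Im (X x) * Re (Y x)) - expectation (\<lambda>x. Im (X x)) * expectation (\<lambda>x. Re (Y x)))"
    using integral_Im[OF iXY] integral_Re[OF iX] integral_Re[OF iY] integral_Im[OF iX] integral_Im[OF iY]
      i[of Re Im] i[of Im Re]
    by simp
  with c[of Re Im] c[of Im Re] have "\<bar>Im ?D\<bar> \<le> 8 * a * b * \<alpha>" by simp
  with re cmod_le[of ?D] show ?thesis by simp
qed

lemma truncated_product_le:
  fixes x y R :: real
  assumes R: "R > 0" and x: "R < \<bar>x\<bar>" and p: "2 \<le> p"
  shows "\<bar>x\<bar> * \<bar>y\<bar> \<le> (\<bar>x\<bar> ^ p + \<bar>y\<bar> ^ p) / R ^ (p - 2)"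
proof -
  obtain m where m: "p = Suc (Suc m)" using p by (metis add_2_eq_Suc le_Suc_ex)
  have "R ^ m \<le> \<bar>x\<bar> ^ m" using R x by (intro power_mono) auto
  then have "\<bar>x\<bar> * \<bar>y\<bar> * R ^ m \<le> \<bar>x\<bar> * \<bar>y\<bar> * \<bar>x\<bar> ^ m" by (intro mult_left_mono) auto
  also have "\<dots> = \<bar>x\<bar> ^ Suc m * \<bar>y\<bar>" by simp
  also have "\<dots> \<le> (max \<bar>x\<bar> (\<bar>y\<bar>)) ^ Suc m * (max \<bar>x\<bar> (\<bar>y\<bar>))"
    by (intro mult_mono power_mono) auto
  also have "\<dots> = (max \<bar>x\<bar> (\<bar>y\<bar>)) ^ p" by (simp add: m)
  also have "\<dots> \<le> \<bar>x\<bar> ^ p + \<bar>y\<bar> ^ p" by (auto simp: max_def)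
  finally show ?thesis using R by (simp add: m pos_le_divide_eq)
qed

text \<open>Davydov's inequality by truncation. At level R the bounded parts cost
  \<open>R^2 * \<alpha>\<close> and the tails \<open>c^p / R^(p - 2)\<close>; the R of the proof
  makes both equal to \<open>c^2 * \<alpha> powr (1 - 2 / p)\<close>. The 9 is 4 for the bounded
  parts, 2 for each tail and 1 for the means. K secures integrability and does not enter the
  bound.\<close>

lemma covariance_moment_le:
  assumes mix: "mixing_le M F G \<alpha>"
    and X: "X \<in> borel_measurable F" "\<And>x. x \<in> space M \<Longrightarrow> \<bar>X x\<bar> \<le> K"
    and Y: "Y \<in> borel_measurable G" "\<And>x. x \<in> space M \<Longrightarrow> \<bar>Y x\<bar> \<le> K"
    and X0: "expectation X = 0"
    and p: "2 \<le> p" and c: "0 < c" and \<alpha>: "0 < \<alpha>"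
    and mX: "expectation (\<lambda>x. \<bar>X x\<bar> ^ p) \<le> c ^ p" and mY: "expectation (\<lambda>x. \<bar>Y x\<bar> ^ p) \<le> c ^ p"
  shows "\<bar>expectation (\<lambda>x. X x * Y x)\<bar> \<le> 9 * c\<^sup>2 * \<alpha> powr (1 - 2 / p)"
proof -
  have F: "subalgebra M F" and G: "subalgebra M G" using mix by (auto simp: mixing_le_def)
  have XM[measurable]: "X \<in> borel_measurable M" and YM[measurable]: "Y \<in> borel_measurable M"
    by (rule measurable_from_subalg[OF F X(1)] measurable_from_subalg[OF G Y(1)])+
  define R where "R = c * \<alpha> powr (- 1 / p)"
  have R: "R > 0" using c \<alpha> by (simp add: R_def)
  have K: "0 \<le> K" using X(2) not_empty by (metis abs_ge_zero order_trans ex_in_conv)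
  note ib = integrable_bounded_real
  define T where "T u = (if \<bar>u\<bar> \<le> R then u else 0)" for u :: real
  have TR: "\<bar>T u\<bar> \<le> R" and Tu: "\<bar>T u\<bar> \<le> \<bar>u\<bar>" for u using R by (auto simp: T_def)
  have [measurable]: "T \<in> borel_measurable borel" unfolding T_def by measurable
  have iXp: "integrable M (\<lambda>x. \<bar>X x\<bar> ^ p)"
    by (rule ib[where c="K ^ p"]) (use X in \<open>auto intro!: power_mono\<close>)
  have iYp: "integrable M (\<lambda>x. \<bar>Y x\<bar> ^ p)"
    by (rule ib[where c="K ^ p"]) (use Y in \<open>auto intro!: power_mono\<close>)
  have iX: "integrable M X" by (rule ib[OF _ X(2)]) auto
  have iT: "integrable M (\<lambda>x. T (X x))" "integrable M (\<lambda>x. T (Y x))"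
    by (rule ib[where c=R]; use TR in auto)+
  have iTT: "integrable M (\<lambda>x. T (X x) * T (Y x))"
    by (rule ib[where c="R * R"]) (use TR R in \<open>auto simp: abs_mult intro!: mult_mono\<close>)
  have iTY: "integrable M (\<lambda>x. (X x - T (X x)) * T (Y x))"
    by (rule ib[where c="(K + R) * R"])
       (use TR R K X(2) in \<open>auto simp: abs_mult intro!: mult_mono order_trans[OF abs_triangle_ineq4] add_mono\<close>)
  have iXT: "integrable M (\<lambda>x. X x * (Y x - T (Y x)))"
    by (rule ib[where c="K * (K + R)"])
       (use TR R K X(2) Y(2) in \<open>auto simp: abs_mult intro!: mult_mono order_trans[OF abs_triangle_ineq4] add_mono\<close>)
  define Q where "Q = 1 / R ^ (p - 2)"
  have Q0: "0 < Q" using R by (simp add: Q_def)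
  have "expectation (\<lambda>x. X x * Y x) = expectation (\<lambda>x. T (X x) * T (Y x) + (X x - T (X x)) * T (Y x)
       + X x * (Y x - T (Y x)))"
    by (rule Bochner_Integration.integral_cong) (auto simp: algebra_simps)
  also have "\<dots> = expectation (\<lambda>x. T (X x) * T (Y x)) + expectation (\<lambda>x. (X x - T (X x)) * T (Y x))
       + expectation (\<lambda>x. X x * (Y x - T (Y x)))"
    using iTT iTY iXT by simp
  finally have dec: "expectation (\<lambda>x. X x * Y x) = \<dots>" .
  have iS: "integrable M (\<lambda>x. (\<bar>X x\<bar> ^ p + \<bar>Y x\<bar> ^ p) * Q)" using iXp iYp by simp
  have ES: "expectation (\<lambda>x. (\<bar>X x\<bar> ^ p + \<bar>Y x\<bar> ^ p) * Q) \<le> 2 * c ^ p * Q"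
    using iXp iYp mX mY Q0 by (simp add: mult_right_mono)
  have 1: "\<bar>expectation (\<lambda>x. (X x - T (X x)) * T (Y x))\<bar> \<le> 2 * c ^ p * Q"
  proof -
    have "norm (expectation (\<lambda>x. (X x - T (X x)) * T (Y x))) \<le> expectation (\<lambda>x. (\<bar>X x\<bar> ^ p + \<bar>Y x\<bar> ^ p) * Q)"
    proof (rule norm_integral_le[OF iS])
      fix x
      show "norm ((X x - T (X x)) * T (Y x)) \<le> (\<bar>X x\<bar> ^ p + \<bar>Y x\<bar> ^ p) * Q"
      proof (cases "\<bar>X x\<bar> \<le> R")
        case True
        then show ?thesis using Q0 by (simp add: T_def)
      next
        case False
        then have "norm ((X x - T (X x)) * T (Y x)) \<le> \<bar>X x\<bar> * \<bar>Y x\<bar>"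
          using Tu[of "Y x"] by (simp add: T_def[of "X x"] abs_mult mult_left_mono)
        also have "\<dots> \<le> (\<bar>X x\<bar> ^ p + \<bar>Y x\<bar> ^ p) / R ^ (p - 2)"
          using truncated_product_le[OF R _ p, of "X x"] False by simp
        finally show ?thesis by (simp add: Q_def)
      qed
    qed
    with ES show ?thesis by simp
  qed
  have 2: "\<bar>expectation (\<lambda>x. X x * (Y x - T (Y x)))\<bar> \<le> 2 * c ^ p * Q"
  proof -
    have "norm (expectation (\<lambda>x. X x * (Y x - T (Y x)))) \<le> expectation (\<lambda>x. (\<bar>X x\<bar> ^ p + \<bar>Y x\<bar> ^ p) * Q)"
    proof (rule norm_integral_le[OF iS])
      fix x
      show "norm (X x * (Y x - T (Y x))) \<le> (\<bar>X x\<bar> ^ p + \<bar>Y x\<bar> ^ p) * Q"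
      proof (cases "\<bar>Y x\<bar> \<le> R")
        case True
        then show ?thesis using Q0 by (simp add: T_def)
      next
        case False
        then have "norm (X x * (Y x - T (Y x))) = \<bar>Y x\<bar> * \<bar>X x\<bar>"
          by (simp add: T_def abs_mult)
        also have "\<dots> \<le> (\<bar>Y x\<bar> ^ p + \<bar>X x\<bar> ^ p) / R ^ (p - 2)"
          using truncated_product_le[OF R _ p, of "Y x"] False by simp
        finally show ?thesis by (simp add: Q_def add.commute)
      qed
    qed
    with ES show ?thesis by simp
  qed
  have 3: "\<bar>expectation (\<lambda>x. T (X x) * T (Y x)) - expectation (\<lambda>x. T (X x)) * expectation (\<lambda>x. T (Y x))\<bar>
      \<le> 4 * R * R * \<alpha>"
    by (rule covariance_le[OF mix]) (use TR R X(1) Y(1) in auto)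
  \<comment> \<open>X has mean 0, so the mean of its truncation is a tail; the truncated Y is simply
    bounded by R.\<close>
  have 4: "\<bar>expectation (\<lambda>x. T (X x)) * expectation (\<lambda>x. T (Y x))\<bar> \<le> c ^ p * Q"
  proof -
    have y: "\<bar>expectation (\<lambda>x. T (Y x))\<bar> \<le> R"
    proof -
      have "norm (expectation (\<lambda>x. T (Y x))) \<le> expectation (\<lambda>x. R)"
        by (rule norm_integral_le) (use TR in auto)
      then show ?thesis using prob_space by simp
    qed
    have "expectation (\<lambda>x. T (X x) - X x) = expectation (\<lambda>x. T (X x))" using iT iX X0 by simp
    moreover have "norm (expectation (\<lambda>x. T (X x) - X x)) \<le> expectation (\<lambda>x. \<bar>X x\<bar> ^ p * (Q / R))"
    proof (rule norm_integral_le)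
      fix x
      show "norm (T (X x) - X x) \<le> \<bar>X x\<bar> ^ p * (Q / R)"
      proof (cases "\<bar>X x\<bar> \<le> R")
        case True
        then show ?thesis using Q0 R by (simp add: T_def)
      next
        case False
        obtain m where m: "p = Suc (Suc m)" using p by (metis add_2_eq_Suc le_Suc_ex)
        have "R ^ Suc m \<le> \<bar>X x\<bar> ^ Suc m" using R False by (intro power_mono) auto
        then have "\<bar>X x\<bar> * R ^ Suc m \<le> \<bar>X x\<bar> * \<bar>X x\<bar> ^ Suc m" by (intro mult_left_mono) auto
        then have "\<bar>X x\<bar> * (R ^ m * R) \<le> \<bar>X x\<bar> ^ p" by (simp add: m mult_ac)
        then show ?thesis using False R by (simp add: T_def Q_def m field_simps)
      qed
    qed (use iXp in simp)
    moreover have "expectation (\<lambda>x. \<bar>X x\<bar> ^ p * (Q / R)) \<le> c ^ p * (Q / R)"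
      unfolding integral_mult_left_zero using mX Q0 R by (intro mult_right_mono) auto
    ultimately have x: "\<bar>expectation (\<lambda>x. T (X x))\<bar> \<le> c ^ p * (Q / R)" by simp
    have "\<bar>expectation (\<lambda>x. T (X x)) * expectation (\<lambda>x. T (Y x))\<bar> \<le> c ^ p * (Q / R) * R"
      unfolding abs_mult using x y c Q0 R by (intro mult_mono) auto
    then show ?thesis using R by simp
  qed
  have e1: "R * R * \<alpha> = c\<^sup>2 * \<alpha> powr (1 - 2 / p)"
  proof -
    have "R * R * \<alpha> = c\<^sup>2 * (\<alpha> powr (- 1 / p) * \<alpha> powr (- 1 / p) * \<alpha> powr 1)"
      using \<alpha> by (simp add: R_def power2_eq_square algebra_simps)
    also have "\<alpha> powr (- 1 / p) * \<alpha> powr (- 1 / p) * \<alpha> powr 1 = \<alpha> powr (1 - 2 / p)"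
      unfolding powr_add[symmetric] by (simp add: field_simps)
    finally show ?thesis .
  qed
  have e2: "c ^ p * Q = c\<^sup>2 * \<alpha> powr (1 - 2 / p)"
  proof -
    obtain m where m: "p = m + 2" using p by (metis add.commute le_Suc_ex)
    have "R ^ m = c ^ m * \<alpha> powr (- (real m / p))"
      using \<alpha> by (simp add: R_def power_mult_distrib powr_realpow[symmetric] powr_powr mult.commute)
    moreover have "c ^ p / (c ^ m * b) = c\<^sup>2 * inverse b" for b
      using c by (simp add: m power_add field_simps power2_eq_square)
    ultimately have "c ^ p * Q = c\<^sup>2 * inverse (\<alpha> powr (- (real m / p)))"
      by (simp add: Q_def m)
    then have "c ^ p * Q = c\<^sup>2 * \<alpha> powr (real m / p)" by (simp only: powr_minus inverse_inverse_eq)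
    also have "real m / p = 1 - 2 / p" using m by (simp add: field_simps)
    finally show ?thesis .
  qed
  have "\<bar>expectation (\<lambda>x. X x * Y x)\<bar> \<le> 4 * (R * R * \<alpha>) + 5 * (c ^ p * Q)"
    using 1 2 3 4 unfolding dec by linarith
  then show ?thesis by (simp add: e1 e2)
qed

end

section \<open>Moments of partial sums under uniform mixing\<close>

text \<open>\<open>Pa s\<close> is the past up to s, \<open>Fu s\<close> the future from s on.
  Uniform mixing enters in a one-sided form and at the single distance d. The bound K holds at every
  point, so that overshoots can be estimated path by path.\<close>

locale mixing_row = prob_space M for M :: "'w measure" +
  fixes n :: nat and X :: "nat \<Rightarrow> 'w \<Rightarrow> real" and Pa Fu :: "nat \<Rightarrow> 'w measure"
    and K :: real and d :: nat and \<phi> :: real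
  assumes subalgebra_past: "subalgebra M (Pa s)" and subalgebra_future: "subalgebra M (Fu s)"
    and X_past: "1 \<le> j \<Longrightarrow> j \<le> s \<Longrightarrow> s \<le> n \<Longrightarrow> X j \<in> borel_measurable (Pa s)"
    and X_future: "1 \<le> j \<Longrightarrow> s \<le> j \<Longrightarrow> j \<le> n \<Longrightarrow> X j \<in> borel_measurable (Fu s)"
    and X_bound: "1 \<le> j \<Longrightarrow> j \<le> n \<Longrightarrow> x \<in> space M \<Longrightarrow> \<bar>X j x\<bar> \<le> K"
    and X_mean: "1 \<le> j \<Longrightarrow> j \<le> n \<Longrightarrow> expectation (X j) = 0"
    and K_pos: "0 < K" and d_pos: "1 \<le> d"
    and phi_mixing: "s + d \<le> n \<Longrightarrow> A \<in> sets (Pa s) \<Longrightarrow> B \<in> sets (Fu (s + d))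
          \<Longrightarrow> prob (A \<inter> B) \<le> prob A * (prob B + \<phi>)"
    and phi_less: "\<phi> < 1 / 2"
begin

definition S :: "nat \<Rightarrow> nat \<Rightarrow> 'w \<Rightarrow> real" where "S p q x = (\<Sum>j\<in>{p<..q}. X j x)"

lemma space_past: "space (Pa s) = space M" and space_future: "space (Fu s) = space M"
  using subalgebra_past subalgebra_future by (auto simp: subalgebra_def)

lemma past_events: "A \<in> sets (Pa s) \<Longrightarrow> A \<in> events"
  using subalgebra_past[of s] by (auto simp: subalgebra_def)

lemma future_events: "A \<in> sets (Fu s) \<Longrightarrow> A \<in> events"
  using subalgebra_future[of s] by (auto simp: subalgebra_def)

lemma S_past: "q \<le> s \<Longrightarrow> s \<le> n \<Longrightarrow> S p q \<in> borel_measurable (Pa s)"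
  unfolding S_def[abs_def] by (intro borel_measurable_sum X_past) auto

lemma S_future: "s \<le> Suc p \<Longrightarrow> q \<le> n \<Longrightarrow> S p q \<in> borel_measurable (Fu s)"
  unfolding S_def[abs_def] by (intro borel_measurable_sum X_future) auto

lemma S_measurable: "q \<le> n \<Longrightarrow> S p q \<in> borel_measurable M"
  using S_past[of q q p] measurable_from_subalg[OF subalgebra_past] by blast

lemma S_split: "p \<le> r \<Longrightarrow> r \<le> q \<Longrightarrow> S p q x = S p r x + S r q x"
proof -
  assume "p \<le> r" "r \<le> q"
  then have "{p<..q} = {p<..r} \<union> {r<..q}" by auto
  then show ?thesis unfolding S_def by (simp add: sum.union_disjoint)
qed

lemma S_self [simp]: "S p p x = 0" by (simp add: S_def)

lemma S_bound: "q \<le> n \<Longrightarrow> x \<in> space M \<Longrightarrow> \<bar>S p q x\<bar> \<le> real (q - p) * K"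
proof -
  assume "q \<le> n" "x \<in> space M"
  then have "\<bar>S p q x\<bar> \<le> (\<Sum>j\<in>{p<..q}. K)"
    unfolding S_def by (intro order_trans[OF sum_abs] sum_mono X_bound) auto
  then show ?thesis by simp
qed

lemma S_bound': "q \<le> n \<Longrightarrow> x \<in> space M \<Longrightarrow> q - p \<le> m \<Longrightarrow> \<bar>S p q x\<bar> \<le> real m * K"
  using S_bound[of q x p] K_pos by (meson mult_right_mono of_nat_le_iff order_trans less_imp_le)

lemma S_integrable: "q \<le> n \<Longrightarrow> integrable M (S p q)"
  by (rule integrable_bounded_real[OF S_measurable S_bound])

lemma S_mean: "q \<le> n \<Longrightarrow> expectation (S p q) = 0"
proof -
  assume q: "q \<le> n"
  have "expectation (S p q) = (\<Sum>j\<in>{p<..q}. expectation (X j))"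
    unfolding S_def[abs_def]
  proof (rule Bochner_Integration.integral_sum)
    fix j assume "j \<in> {p<..q}"
    then show "integrable M (X j)"
      using q by (intro integrable_bounded_real[OF measurable_from_subalg[OF subalgebra_past X_past] X_bound]) auto
  qed
  then show ?thesis using X_mean q by simp
qed

lemma S_power_integrable: "q \<le> n \<Longrightarrow> integrable M (\<lambda>x. \<bar>S p q x\<bar> ^ m)"
proof (rule integrable_bounded_real)
  assume q: "q \<le> n"
  then show "(\<lambda>x. \<bar>S p q x\<bar> ^ m) \<in> borel_measurable M" using S_measurable by simp
  show "\<bar>\<bar>S p q x\<bar> ^ m\<bar> \<le> (real (q - p) * K) ^ m" if "x \<in> space M" for x
    using S_bound[OF q that] by (auto intro: power_mono)
qed

section \<open>First passage times and maximal inequalities\<close>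

definition exceeds :: "nat \<Rightarrow> nat \<Rightarrow> real \<Rightarrow> 'w set" where
  "exceeds p q u = {x \<in> space M. \<exists>l\<in>{p..q}. u < \<bar>S p l x\<bar>}"

definition passage :: "nat \<Rightarrow> real \<Rightarrow> nat \<Rightarrow> 'w set" where
  "passage p u l = {x \<in> space M. u < \<bar>S p l x\<bar> \<and> (\<forall>i\<in>{p..<l}. \<bar>S p i x\<bar> \<le> u)}"

lemma passage_past: "l \<le> n \<Longrightarrow> passage p u l \<in> sets (Pa l)"
proof -
  assume l: "l \<le> n"
  have [measurable]: "S p i \<in> borel_measurable (Pa l)" if "i \<le> l" for i
    by (rule S_past) (use that l in auto)
  have "passage p u l = {x \<in> space (Pa l). u < \<bar>S p l x\<bar>}
      \<inter> {x \<in> space (Pa l). \<forall>i\<in>{p..<l}. \<bar>S p i x\<bar> \<le> u}"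
    by (auto simp: passage_def space_past)
  also have "\<dots> \<in> sets (Pa l)"
  proof (intro sets.Int sets.sets_Collect_finite_All)
    show "{x \<in> space (Pa l). u < \<bar>S p l x\<bar>} \<in> sets (Pa l)" by measurable
    show "{x \<in> space (Pa l). \<bar>S p i x\<bar> \<le> u} \<in> sets (Pa l)" if "i \<in> {p..<l}" for i
    proof -
      have [measurable]: "S p i \<in> borel_measurable (Pa l)" using that l by (intro S_past) auto
      show ?thesis by measurable
    qed
  qed auto
  finally show ?thesis .
qed

lemma exceeds_future: "q \<le> n \<Longrightarrow> s \<le> Suc p \<Longrightarrow> exceeds p q u \<in> sets (Fu s)"
proof -
  assume q: "q \<le> n" "s \<le> Suc p"
  have "{x \<in> space (Fu s). \<exists>l\<in>{p..q}. u < \<bar>S p l x\<bar>} \<in> sets (Fu s)"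
  proof (intro sets.sets_Collect_finite_Ex)
    show "{x \<in> space (Fu s). u < \<bar>S p l x\<bar>} \<in> sets (Fu s)" if "l \<in> {p..q}" for l
    proof -
      have [measurable]: "S p l \<in> borel_measurable (Fu s)" using that q by (intro S_future) auto
      show ?thesis by measurable
    qed
  qed auto
  then show ?thesis by (simp add: exceeds_def space_future)
qed

lemma exceeds_event: "q \<le> n \<Longrightarrow> exceeds p q u \<in> events"
  using exceeds_future[of q 0 p u] future_events by simp

lemma exceeds_mono: "u \<le> v \<Longrightarrow> exceeds p q v \<subseteq> exceeds p q u"
  by (auto simp: exceeds_def intro: le_less_trans)

lemma exceeds_eq_Union: "exceeds p q u = (\<Union>l\<in>{p..q}. passage p u l)"
proof (intro equalityI subsetI)
  fix x assume x: "x \<in> exceeds p q u"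
  define P where "P l \<longleftrightarrow> l \<in> {p..q} \<and> u < \<bar>S p l x\<bar>" for l
  have "\<exists>l. P l" using x by (auto simp: P_def exceeds_def)
  then have P: "P (LEAST l. P l)" by (rule LeastI_ex)
  have "\<bar>S p i x\<bar> \<le> u" if "i \<in> {p..<(LEAST l. P l)}" for i
    using not_less_Least[of i P] that P by (force simp: P_def)
  with P x show "x \<in> (\<Union>l\<in>{p..q}. passage p u l)"
    by (auto simp: P_def passage_def exceeds_def)
qed (auto simp: exceeds_def passage_def)

lemma passage_disjoint: "disjoint_family_on (passage p u) {p..q}"
  unfolding disjoint_family_on_def
proof (intro ballI impI)
  fix i j assume ij: "i \<in> {p..q}" "j \<in> {p..q}" "i \<noteq> j"
  show "passage p u i \<inter> passage p u j = {}"
    using ij by (cases "i < j") (force simp: passage_def)+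
qed

text \<open>Cut E along the first passage times. The passage at l is a past event and
  \<open>B l\<close> lies in the future after a pause of length d, so mixing gives each piece the
  factor \<open>\<beta> + \<phi>\<close>, and the disjoint passages add up to
  \<open>exceeds\<close>. \<open>B l\<close> is demanded only for nonempty pieces, since otherwise
  \<open>l + d\<close> may lie beyond the row.\<close>

lemma first_passage_le:
  assumes q: "q \<le> n" and E: "E \<in> events" "E \<subseteq> exceeds p q u"
    and \<beta>: "0 \<le> \<beta> + \<phi>"
    and B: "\<And>l. l \<in> {p..q} \<Longrightarrow> E \<inter> passage p u l \<noteq> {} \<Longrightarrow>
        l + d \<le> n \<and> E \<inter> passage p u l \<subseteq> B l \<and> B l \<in> sets (Fu (l + d)) \<and> prob (B l) \<le> \<beta>"
  shows "prob E \<le> (\<beta> + \<phi>) * prob (exceeds p q u)"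
proof -
  have ev: "passage p u l \<in> events" if "l \<in> {p..q}" for l
    using that q past_events passage_past[of l p u] by auto
  have dj: "disjoint_family_on (\<lambda>l. E \<inter> passage p u l) {p..q}"
    using passage_disjoint[of p u q] by (auto simp: disjoint_family_on_def)
  have "E = (\<Union>l\<in>{p..q}. E \<inter> passage p u l)" using E(2) by (auto simp: exceeds_eq_Union)
  then have "prob E = (\<Sum>l\<in>{p..q}. prob (E \<inter> passage p u l))"
    using finite_measure_finite_Union[OF _ _ dj] ev E(1) by (auto simp: image_subset_iff)
  also have "\<dots> \<le> (\<Sum>l\<in>{p..q}. (\<beta> + \<phi>) * prob (passage p u l))"
  proof (rule sum_mono)
    fix l assume l: "l \<in> {p..q}"
    show "prob (E \<inter> passage p u l) \<le> (\<beta> + \<phi>) * prob (passage p u l)"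
    proof (cases "E \<inter> passage p u l = {}")
      case True
      then show ?thesis using \<beta> by simp
    next
      case False
      note Bl = B[OF l False]
      have "prob (E \<inter> passage p u l) \<le> prob (passage p u l \<inter> B l)"
        using Bl ev[OF l] future_events by (intro finite_measure_mono) auto
      also have "\<dots> \<le> prob (passage p u l) * (prob (B l) + \<phi>)"
        using Bl l q by (intro phi_mixing[OF _ passage_past]) auto
      also have "\<dots> \<le> prob (passage p u l) * (\<beta> + \<phi>)"
        using Bl by (intro mult_left_mono) auto
      finally show ?thesis by (simp add: mult.commute)
    qed
  qed
  also have "\<dots> = (\<beta> + \<phi>) * prob (exceeds p q u)"
    unfolding exceeds_eq_Union sum_distrib_left[symmetric]
    using finite_measure_finite_Union[OF _ _ passage_disjoint] ev by (auto simp: image_subset_iff)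
  finally show ?thesis .
qed

text \<open>All subintervals are included because the maximal inequalities restart at a first
  passage time inside the block.\<close>

definition tame :: "real \<Rightarrow> nat \<Rightarrow> nat \<Rightarrow> bool" where
  "tame V p q \<longleftrightarrow> q \<le> n \<and> (\<forall>i j. p \<le> i \<longrightarrow> i \<le> j \<longrightarrow> j \<le> q \<longrightarrow> expectation (\<lambda>x. (S i j x)\<^sup>2) \<le> V)"

lemma tame_sub: "tame V p q \<Longrightarrow> p \<le> p' \<Longrightarrow> q' \<le> q \<Longrightarrow> tame V p' q'"
  unfolding tame_def by (meson order_trans)

lemma phi_nonneg: "d \<le> n \<Longrightarrow> 0 \<le> \<phi>"
  using phi_mixing[of 0 "space M" "space M"] sets.top[of "Pa 0"] sets.top[of "Fu d"]
  by (simp add: space_past space_future prob_space)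

lemma tame_tail:
  assumes t: "tame V p q" and pq: "p \<le> i" "i \<le> j" "j \<le> q" and V: "V > 0"
  shows "prob {x \<in> space M. 4 * sqrt V < \<bar>S i j x\<bar>} \<le> 1 / 16"
proof -
  have jn: "j \<le> n" using t pq by (auto simp: tame_def)
  have [measurable]: "S i j \<in> borel_measurable M" by (rule S_measurable[OF jn])
  have i2: "integrable M (\<lambda>x. (S i j x)\<^sup>2)" using S_power_integrable[OF jn, of i 2] by simp
  have "prob {x \<in> space M. 4 * sqrt V < \<bar>S i j x\<bar>} \<le> prob {x \<in> space M. (4 * sqrt V)\<^sup>2 \<le> (S i j x)\<^sup>2}"
  proof (intro finite_measure_mono subsetI)
    fix x assume "x \<in> {x \<in> space M. 4 * sqrt V < \<bar>S i j x\<bar>}"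
    then show "x \<in> {x \<in> space M. (4 * sqrt V)\<^sup>2 \<le> (S i j x)\<^sup>2}"
      using V power_mono[of "4 * sqrt V" "\<bar>S i j x\<bar>" 2] by simp
  qed measurable
  also have "\<dots> \<le> expectation (\<lambda>x. (S i j x)\<^sup>2) / (4 * sqrt V)\<^sup>2"
    using V by (intro integral_Markov_inequality_measure[OF i2, where A="{}"]) auto
  also have "\<dots> \<le> V / (4 * sqrt V)\<^sup>2"
    using t pq by (intro divide_right_mono) (auto simp: tame_def)
  also have "\<dots> = 1 / 16" using V by (simp add: power_mult_distrib)
  finally show ?thesis .
qed

text \<open>A path that passes the level but ends within \<open>4 * sqrt V\<close> must move by more
  than \<open>4 * sqrt V\<close> after a pause, which itself changes the sum by at most
  \<open>d * K\<close>. Given the passage this has probability at most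
  \<open>1 / 16 + \<phi>\<close>, below \<open>9 / 16\<close>. With Chebyshev for the other paths,
  the probability x satisfies \<open>x \<le> 9 / 16 * x + 1 / 16\<close>, whence
  \<open>x \<le> 1 / 7\<close>.\<close>

lemma ottaviani:
  assumes t: "tame V p q" and V: "V > 0"
  shows "prob (exceeds p q (8 * sqrt V + d * K)) \<le> 1 / 7"
proof -
  define x0 where "x0 = 4 * sqrt V"
  define y where "y = 8 * sqrt V + d * K"
  have x0: "x0 > 0" using V by (simp add: x0_def)
  have y0: "y > 0" using V K_pos by (simp add: y_def add_pos_nonneg)
  have q: "q \<le> n" using t by (simp add: tame_def)
  have [measurable]: "S p q \<in> borel_measurable M" by (rule S_measurable[OF q])
  define E where "E = exceeds p q y \<inter> {x \<in> space M. \<bar>S p q x\<bar> \<le> x0}"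
  have E: "E \<in> events" "E \<subseteq> exceeds p q y"
    using exceeds_event[OF q] by (auto simp: E_def)
  have main: "prob E \<le> (1 / 16 + \<phi>) * prob (exceeds p q y)" if ne: "E \<noteq> {}"
  proof -
    have B: "l + d \<le> q \<and> E \<inter> passage p y l \<subseteq> {x \<in> space M. x0 < \<bar>S (l + d - 1) q x\<bar>}"
      if l: "l \<in> {p..q}" and nonempty: "E \<inter> passage p y l \<noteq> {}" for l
    proof -
      have *: "l + d \<le> q \<and> x0 < \<bar>S (l + d - 1) q x\<bar>" if x: "x \<in> E \<inter> passage p y l" for x
      proof -
        have xs: "x \<in> space M" and a: "y < \<bar>S p l x\<bar>" and b: "\<bar>S p q x\<bar> \<le> x0"
          using x by (auto simp: passage_def E_def)
        have s1: "S p q x = S p l x + S l q x" using l by (intro S_split) auto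
        show ?thesis
        proof (cases "l + d \<le> q")
          case True
          have s2: "S l q x = S l (l + d - 1) x + S (l + d - 1) q x"
            using True d_pos by (intro S_split) auto
          have "\<bar>S l (l + d - 1) x\<bar> \<le> real d * K" using True q xs by (intro S_bound') auto
          then show ?thesis using a b s1 s2 True x0 unfolding y_def x0_def by linarith
        next
          \<comment> \<open>Fewer than d terms remain after the passage, too few to return from y,
            so this case is contradictory.\<close>
          case False
          have "\<bar>S l q x\<bar> \<le> real d * K" using False q xs by (intro S_bound') auto
          then show ?thesis using a b s1 x0 unfolding y_def x0_def by linarith
        qed
      qed
      then show ?thesis using nonempty by (auto simp: passage_def)
    qed
    have dn: "d \<le> n"
    proof -
      obtain x where "x \<in> E" using ne by auto
      then obtain l where "l \<in> {p..q}" "x \<in> E \<inter> passage p y l"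
        using E(2) by (auto simp: exceeds_eq_Union)
      then have "l + d \<le> q" using B[of l] by blast
      then show ?thesis using q by linarith
    qed
    show ?thesis
    proof (rule first_passage_le[OF q E, where B="\<lambda>l. {x \<in> space M. x0 < \<bar>S (l + d - 1) q x\<bar>}"])
      show "0 \<le> 1 / 16 + \<phi>" using phi_nonneg[OF dn] by simp
      fix l assume l: "l \<in> {p..q}" "E \<inter> passage p y l \<noteq> {}"
      have [measurable]: "S (l + d - 1) q \<in> borel_measurable (Fu (l + d))"
        using q by (intro S_future) auto
      have "{x \<in> space (Fu (l + d)). x0 < \<bar>S (l + d - 1) q x\<bar>} \<in> sets (Fu (l + d))" by measurable
      moreover have "prob {x \<in> space M. x0 < \<bar>S (l + d - 1) q x\<bar>} \<le> 1 / 16"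
        unfolding x0_def using B[OF l] l d_pos by (intro tame_tail[OF t _ _ _ V]) auto
      ultimately show "l + d \<le> n \<and> E \<inter> passage p y l \<subseteq> {x \<in> space M. x0 < \<bar>S (l + d - 1) q x\<bar>} \<and>
          {x \<in> space M. x0 < \<bar>S (l + d - 1) q x\<bar>} \<in> sets (Fu (l + d)) \<and>
          prob {x \<in> space M. x0 < \<bar>S (l + d - 1) q x\<bar>} \<le> 1 / 16"
        using B[OF l] q by (simp add: space_future)
    qed
  qed
  have E_le: "prob E \<le> 9 / 16 * prob (exceeds p q y)"
  proof (cases "E = {}")
    case False
    have "(1 / 16 + \<phi>) * prob (exceeds p q y) \<le> 9 / 16 * prob (exceeds p q y)"
      using phi_less by (intro mult_right_mono) auto
    with main[OF False] show ?thesis by linarith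
  qed simp
  show ?thesis
  proof (cases "p \<le> q")
    case True
    have "prob (exceeds p q y) \<le> prob (E \<union> {x \<in> space M. 4 * sqrt V < \<bar>S p q x\<bar>})"
      using E(1) by (intro finite_measure_mono) (auto simp: E_def x0_def exceeds_def)
    also have "\<dots> \<le> prob E + prob {x \<in> space M. 4 * sqrt V < \<bar>S p q x\<bar>}"
      using E(1) by (intro measure_Un_le) auto
    finally show ?thesis using E_le tame_tail[OF t order_refl True order_refl V] by (simp add: y_def)
  next
    case False
    then have "exceeds p q y = {}" by (auto simp: exceeds_def)
    then show ?thesis by (simp add: y_def)
  qed
qed

text \<open>Hoffmann-Joergensen's argument. At the first passage of u the sum is at most
  \<open>u + K\<close> in modulus and a pause adds at most \<open>d * K\<close>, so reaching the new
  level forces an excursion beyond the Ottaviani level. Given the passage this has probability at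
  most \<open>1 / 7 + \<phi>\<close>, below \<open>9 / 14\<close>.\<close>

lemma exceeds_step:
  assumes t: "tame V p q" and V: "V > 0" and u: "0 \<le> u"
  shows "prob (exceeds p q (u + (8 * sqrt V + (2 * d + 1) * K))) \<le> 9 / 14 * prob (exceeds p q u)"
proof -
  define y where "y = 8 * sqrt V + d * K"
  define A where "A = 8 * sqrt V + (2 * d + 1) * K"
  have Ay: "A = y + d * K + K" by (simp add: A_def y_def algebra_simps)
  have y0: "y > 0" using V K_pos by (simp add: y_def add_pos_nonneg)
  have dK: "0 \<le> d * K" using K_pos by simp
  have q: "q \<le> n" using t by (simp add: tame_def)
  define E where "E = exceeds p q (u + A)"
  have E: "E \<in> events" "E \<subseteq> exceeds p q u"
    using exceeds_event[OF q] exceeds_mono[of u "u + A" p q] y0 K_pos dK by (simp_all add: E_def Ay)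
  show ?thesis
  proof (cases "E = {}")
    case False
    have B: "l + d \<le> q \<and> E \<inter> passage p u l \<subseteq> exceeds (l + d - 1) q y"
      if l: "l \<in> {p..q}" and nonempty: "E \<inter> passage p u l \<noteq> {}" for l
    proof -
      have *: "l + d \<le> q \<and> x \<in> exceeds (l + d - 1) q y" if x: "x \<in> E \<inter> passage p u l" for x
      proof -
        have xs: "x \<in> space M" and a: "u < \<bar>S p l x\<bar>" and b: "\<And>i. p \<le> i \<Longrightarrow> i < l \<Longrightarrow> \<bar>S p i x\<bar> \<le> u"
          using x by (auto simp: passage_def)
        have "l \<noteq> p" using a u by auto
        then have pl: "p < l" using l by auto
        have "S p l x = S p (l - 1) x + S (l - 1) l x" using pl by (intro S_split) auto
        moreover have "\<bar>S (l - 1) l x\<bar> \<le> real 1 * K" using l q xs by (intro S_bound') auto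
        moreover have "\<bar>S p (l - 1) x\<bar> \<le> u" using pl by (intro b) auto
        ultimately have Sl: "\<bar>S p l x\<bar> \<le> u + K" by linarith
        obtain r where r: "r \<in> {p..q}" "u + A < \<bar>S p r x\<bar>"
          using x by (auto simp: E_def exceeds_def)
        have "l \<le> r"
        proof (rule ccontr)
          assume "\<not> l \<le> r"
          then have "\<bar>S p r x\<bar> \<le> u" using r(1) by (intro b) auto
          with r(2) y0 dK K_pos show False unfolding Ay by linarith
        qed
        then have "S p r x = S p l x + S l r x" using l by (intro S_split) auto
        with Sl r have Slr: "y + d * K < \<bar>S l r x\<bar>" unfolding Ay by linarith
        have lr: "l + d \<le> r"
        proof (rule ccontr)
          assume "\<not> l + d \<le> r"
          then have "\<bar>S l r x\<bar> \<le> real d * K" using r q xs by (intro S_bound') auto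
          with Slr y0 show False by linarith
        qed
        have "S l r x = S l (l + d - 1) x + S (l + d - 1) r x" using lr d_pos by (intro S_split) auto
        moreover have "\<bar>S l (l + d - 1) x\<bar> \<le> real d * K" using r lr q xs by (intro S_bound') auto
        ultimately have "y < \<bar>S (l + d - 1) r x\<bar>" using Slr by linarith
        then show ?thesis using lr r xs by (auto simp: exceeds_def)
      qed
      then show ?thesis using nonempty by auto
    qed
    have dn: "d \<le> n"
    proof -
      obtain x where "x \<in> E" using False by auto
      then obtain l where "l \<in> {p..q}" "x \<in> E \<inter> passage p u l"
        using E(2) by (auto simp: exceeds_eq_Union)
      then have "l + d \<le> q" using B[of l] by blast
      then show ?thesis using q by linarith
    qed
    have "prob E \<le> (1 / 7 + \<phi>) * prob (exceeds p q u)"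
    proof (rule first_passage_le[OF q E, where B="\<lambda>l. exceeds (l + d - 1) q y"])
      show "0 \<le> 1 / 7 + \<phi>" using phi_nonneg[OF dn] by simp
      fix l assume l: "l \<in> {p..q}" "E \<inter> passage p u l \<noteq> {}"
      have "exceeds (l + d - 1) q y \<in> sets (Fu (l + d))" using q d_pos by (intro exceeds_future) auto
      moreover have "tame V (l + d - 1) q" using l d_pos by (intro tame_sub[OF t]) auto
      then have "prob (exceeds (l + d - 1) q y) \<le> 1 / 7" unfolding y_def by (rule ottaviani[OF _ V])
      ultimately show "l + d \<le> n \<and> E \<inter> passage p u l \<subseteq> exceeds (l + d - 1) q y \<and>
          exceeds (l + d - 1) q y \<in> sets (Fu (l + d)) \<and> prob (exceeds (l + d - 1) q y) \<le> 1 / 7"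
        using B[OF l] q by simp
    qed
    also have "\<dots> \<le> 9 / 14 * prob (exceeds p q u)"
      using phi_less by (intro mult_right_mono) auto
    finally show ?thesis by (simp add: E_def A_def)
  qed (simp add: E_def A_def)
qed

text \<open>Iterates the step; \<open>K \<le> sqrt V\<close> turns its additive terms into one
  multiple of \<open>sqrt V\<close>.\<close>

lemma exceeds_geometric:
  assumes t: "tame V p q" and V: "K\<^sup>2 \<le> V"
  shows "prob (exceeds p q (real r * ((2 * d + 9) * sqrt V))) \<le> (9 / 14) ^ r"
proof (induction r)
  case (Suc r)
  have V0: "V > 0" using V K_pos by (meson less_le_trans zero_less_power)
  have KV: "K \<le> sqrt V" using V K_pos by (simp add: real_le_rsqrt)
  let ?c = "(2 * d + 9) * sqrt V"
  have c: "8 * sqrt V + (2 * d + 1) * K \<le> ?c"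
    using mult_left_mono[OF KV, of "2 * d + 1"] by (simp add: algebra_simps)
  have "q \<le> n" using t by (simp add: tame_def)
  then have "prob (exceeds p q (real (Suc r) * ?c)) \<le> prob (exceeds p q (real r * ?c + (8 * sqrt V + (2 * d + 1) * K)))"
    using c by (intro finite_measure_mono exceeds_event exceeds_mono) (simp_all add: algebra_simps)
  also have "\<dots> \<le> 9 / 14 * prob (exceeds p q (real r * ?c))"
    by (intro exceeds_step[OF t V0]) (use V0 in auto)
  finally show ?case using Suc by simp
qed simp

end

text \<open>Bounds the moment of order p of a nonnegative variable whose tail at each integer r is
  at most \<open>(9 / 14)^r\<close>.\<close>

definition geometric_moment :: "nat \<Rightarrow> real" where
  "geometric_moment p = (\<Sum>r. (real r + 1) ^ p * (9 / 14) ^ r)"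

lemma summable_geometric_moment: "summable (\<lambda>r. (real r + 1) ^ p * (9 / 14 :: real) ^ r)"
proof (rule summable_comparison_test_bigo)
  show "summable (\<lambda>r. norm ((3 / 4 :: real) ^ r))" by simp
  show "(\<lambda>r. (real r + 1) ^ p * (9 / 14 :: real) ^ r) \<in> O(\<lambda>r. (3 / 4) ^ r)"
    by real_asymp
qed

lemma geometric_moment_ge_1: "1 \<le> geometric_moment p"
proof -
  have "(\<Sum>r<1. (real r + 1) ^ p * (9 / 14 :: real) ^ r) \<le> geometric_moment p"
    unfolding geometric_moment_def by (intro sum_le_suminf summable_geometric_moment) auto
  then show ?thesis by simp
qed

context mixing_row
begin

text \<open>The range is sliced at the multiples of c and the geometric tails are summed.
  \<open>geometric_moment m\<close> is enlarged to its m-th power so that the bound is a pure m-th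
  power, the form in which moments are rescaled later.\<close>

lemma tame_moment:
  assumes t: "tame V p q" and V: "K\<^sup>2 \<le> V" and pq: "p \<le> q" and m: "1 \<le> m"
  shows "expectation (\<lambda>x. \<bar>S p q x\<bar> ^ m) \<le> ((2 * d + 9) * geometric_moment m * sqrt V) ^ m"
proof -
  have V0: "V > 0" using V K_pos by (meson less_le_trans zero_less_power)
  have q: "q \<le> n" using t by (simp add: tame_def)
  define c where "c = (2 * d + 9) * sqrt V"
  have c: "c > 0" using V0 by (simp add: c_def add_nonneg_pos)
  \<comment> \<open>The sum is bounded, so finitely many slices cover its range.\<close>
  obtain R :: nat where R: "real (q - p) * K \<le> real R * c"
    using reals_Archimedean3[OF c] by (meson less_imp_le)
  have [measurable]: "S p q \<in> borel_measurable M" by (rule S_measurable[OF q])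
  have pw: "\<bar>s\<bar> ^ m \<le> (\<Sum>r<R. ((real r + 1) * c) ^ m * indicator {real r * c<..} \<bar>s\<bar>)"
    if s: "\<bar>s\<bar> \<le> real R * c" for s :: real
  proof (cases "s = 0")
    case False
    define r where "r = (LEAST r. \<bar>s\<bar> \<le> real (Suc r) * c)"
    have R0: "R > 0" using s False by (cases R) auto
    have ex: "\<bar>s\<bar> \<le> real (Suc (R - 1)) * c" using s R0 by simp
    have r1: "\<bar>s\<bar> \<le> real (Suc r) * c" unfolding r_def by (rule LeastI[of _ "R - 1"]) (rule ex)
    have r2: "r < R" using Least_le[of "\<lambda>r. \<bar>s\<bar> \<le> real (Suc r) * c" "R - 1"] ex R0 unfolding r_def by linarith
    have r3: "real r * c < \<bar>s\<bar>"
    proof (cases r)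
      case 0
      then show ?thesis using False by simp
    next
      case (Suc r')
      then have "\<not> \<bar>s\<bar> \<le> real (Suc r') * c" using not_less_Least[of r' "\<lambda>r. \<bar>s\<bar> \<le> real (Suc r) * c"] unfolding r_def by simp
      then show ?thesis using Suc by simp
    qed
    have "\<bar>s\<bar> ^ m \<le> ((real r + 1) * c) ^ m * indicator {real r * c<..} \<bar>s\<bar>"
      using r1 r3 by (auto simp: add.commute intro!: power_mono)
    also have "\<dots> \<le> (\<Sum>r<R. ((real r + 1) * c) ^ m * indicator {real r * c<..} \<bar>s\<bar>)"
      by (rule member_le_sum) (use r2 c in auto)
    finally show ?thesis .
  qed (use m c in \<open>simp add: zero_power sum_nonneg\<close>)
  have iI: "integrable M (\<lambda>x. ((real r + 1) * c) ^ m * indicator {real r * c<..} \<bar>S p q x\<bar>)" for r :: nat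
    by (rule integrable_bounded_real[where c="((real r + 1) * c) ^ m"]) (use c in \<open>auto simp: indicator_def\<close>)
  have "expectation (\<lambda>x. \<bar>S p q x\<bar> ^ m)
      \<le> expectation (\<lambda>x. \<Sum>r<R. ((real r + 1) * c) ^ m * indicator {real r * c<..} \<bar>S p q x\<bar>)"
    by (intro integral_mono S_power_integrable[OF q] Bochner_Integration.integrable_sum iI pw)
       (use S_bound[OF q] R order_trans in blast)
  also have "\<dots> = (\<Sum>r<R. ((real r + 1) * c) ^ m * prob {x \<in> space M. real r * c < \<bar>S p q x\<bar>})"
  proof (subst Bochner_Integration.integral_sum[OF iI], intro sum.cong refl)
    fix r :: nat
    have "expectation (\<lambda>x. indicator {real r * c<..} \<bar>S p q x\<bar> :: real)
        = expectation (indicator {x \<in> space M. real r * c < \<bar>S p q x\<bar>})"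
      by (intro Bochner_Integration.integral_cong) (auto simp: indicator_def)
    then show "expectation (\<lambda>x. ((real r + 1) * c) ^ m * indicator {real r * c<..} \<bar>S p q x\<bar>)
        = ((real r + 1) * c) ^ m * prob {x \<in> space M. real r * c < \<bar>S p q x\<bar>}" by simp
  qed
  also have "\<dots> \<le> (\<Sum>r<R. ((real r + 1) * c) ^ m * (9 / 14) ^ r)"
  proof (intro sum_mono mult_left_mono)
    fix r :: nat
    have "prob {x \<in> space M. real r * c < \<bar>S p q x\<bar>} \<le> prob (exceeds p q (real r * c))"
      using pq by (intro finite_measure_mono exceeds_event[OF q]) (auto simp: exceeds_def)
    also have "\<dots> \<le> (9 / 14) ^ r" unfolding c_def by (rule exceeds_geometric[OF t V])
    finally show "prob {x \<in> space M. real r * c < \<bar>S p q x\<bar>} \<le> (9 / 14) ^ r" .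
  qed (use c in auto)
  also have "\<dots> = c ^ m * (\<Sum>r<R. (real r + 1) ^ m * (9 / 14) ^ r)"
    by (simp add: sum_distrib_left power_mult_distrib mult_ac)
  also have "\<dots> \<le> c ^ m * geometric_moment m"
    unfolding geometric_moment_def using c
    by (intro mult_left_mono sum_le_suminf summable_geometric_moment) auto
  also have "\<dots> \<le> c ^ m * geometric_moment m ^ m"
    using c geometric_moment_ge_1[of m] m by (intro mult_left_mono) (auto intro: self_le_power)
  finally show ?thesis by (simp add: c_def power_mult_distrib mult_ac)
qed

end

section \<open>Stability of the recursion\<close>

lemma exp_minus_le_one_minus_half:
  fixes x :: real
  assumes "0 \<le> x" "x \<le> 1"
  shows "exp (- x) \<le> 1 - x / 2"
proof -
  have "1 \<le> (1 - x / 2) * (1 + x)" using assms by (simp add: field_simps) (meson mult_left_le)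
  also have "\<dots> \<le> (1 - x / 2) * exp x" using assms exp_ge_add_one_self[of x] by (intro mult_left_mono) auto
  finally show ?thesis by (simp add: exp_minus field_simps)
qed

lemma geometric_tail_le:
  "(\<Sum>r\<in>{3..m}. (1 / 2) ^ r * (5 / 4 :: real) ^ (r + 1)) \<le> 1"
proof -
  have "(\<Sum>r\<in>{3..m}. (5 / 8 :: real) ^ r) \<le> (5 / 8) ^ 3 / (1 - 5 / 8)"
    by (subst sum_gp) (auto simp: field_simps power3_eq_cube)
  moreover have "(\<Sum>r\<in>{3..m}. (1 / 2) ^ r * (5 / 4 :: real) ^ (r + 1)) = 5 / 4 * (\<Sum>r\<in>{3..m}. (5 / 8) ^ r)"
    by (simp add: sum_distrib_left power_mult_distrib[symmetric] mult_ac)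
  ultimately show ?thesis by (simp add: power3_eq_cube)
qed

text \<open>E will be a characteristic function minus a Gaussian. The coefficients are of size
  \<open>u^2\<close>, so E varies slowly and its delayed values can be moved to \<open>i - 1\<close>
  at a cost of higher order; what remains contracts by \<open>1 - c0 * u^2\<close>. A forcing of
  order \<open>u^3\<close> divided by this rate gives order u, whatever k is. Indices below 0 are
  truncated to 0, where E vanishes.\<close>

lemma recursion_stability:
  fixes E \<tau> c1 c2 :: "nat \<Rightarrow> complex" and u c0 Q Z \<eta> :: real
  assumes E0: "E 0 = 0"
    and rec: "\<And>i. 1 \<le> i \<Longrightarrow> i \<le> k \<Longrightarrow> E i = E (i - 1) + c1 i * E (i - 2) + c2 i * E (i - 3) + \<tau> i"
    and c1: "\<And>i. 1 \<le> i \<Longrightarrow> i \<le> k \<Longrightarrow> norm (c1 i) \<le> u\<^sup>2"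
    and c2: "\<And>i. 1 \<le> i \<Longrightarrow> i \<le> k \<Longrightarrow> norm (c2 i) \<le> u\<^sup>2"
    and c12: "\<And>i. 1 \<le> i \<Longrightarrow> i \<le> k \<Longrightarrow> norm (1 + c1 i + c2 i) \<le> 1 - c0 * u\<^sup>2"
    and \<tau>: "\<And>i. 1 \<le> i \<Longrightarrow> i \<le> k \<Longrightarrow>
        norm (\<tau> i) \<le> Q * u ^ 3 * (\<Sum>r\<in>{3..m}. (1 / 2) ^ r * norm (E (i - (r + 1))))
          + Z * u ^ 3 * exp (- (c0 * u\<^sup>2 / 2) * i) + \<eta>"
    and u: "0 < u" "u \<le> 1 / 4" and c0: "0 < c0" and Q: "0 \<le> Q" and Z: "0 < Z" and \<eta>: "0 \<le> \<eta>"
    and small: "c0 * u\<^sup>2 \<le> 2 / 5" "(4 + 2 * Q) * u \<le> c0 / 8"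
    and i: "i \<le> k"
  shows "norm (E i) \<le> 12 * Z / c0 * u * exp (- (c0 * u\<^sup>2 / 2) * i) + 10 * \<eta> * i"
  using i
proof (induction i rule: less_induct)
  case (less i)
  \<comment> \<open>The contraction is \<open>1 - 2 * \<theta>\<close>, but only the decay
    \<open>exp (- \<theta>)\<close> per step is claimed. The difference pays for all error
    terms.\<close>
  define \<theta> where "\<theta> = c0 * u\<^sup>2 / 2"
  have \<theta>: "0 < \<theta>" "\<theta> \<le> 1 / 5" using small u c0 by (auto simp: \<theta>_def)
  \<comment> \<open>Chosen so that in the last estimate the forcing Z takes exactly the share
    \<open>\<theta> / 4\<close> of the spare contraction.\<close>
  define P where "P = 12 * Z / c0"
  have P: "0 < P" using Z c0 by (simp add: P_def)
  define W where "W j = P * u * exp (- \<theta> * real j)" for j :: nat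
  define N where "N j = W j + 10 * \<eta> * real j" for j :: nat
  have IH: "norm (E j) \<le> N j" if "j < i" for j
    using less.IH[OF that] less.prems that by (simp add: N_def W_def P_def \<theta>_def)
  have W0: "0 < W j" for j using P u by (simp add: W_def)
  have N0: "0 < N j" for j using W0[of j] \<eta> by (simp add: N_def add_pos_nonneg)
  have e\<theta>: "exp \<theta> \<le> 5 / 4"
  proof -
    have "exp \<theta> \<le> 1 + \<theta> + \<theta>\<^sup>2" using \<theta> by (intro exp_bound) auto
    also have "\<theta>\<^sup>2 \<le> 1 / 5 * (1 / 5)" unfolding power2_eq_square using \<theta> by (intro mult_mono) auto
    finally show ?thesis using \<theta> by simp
  qed
  have W1: "W j \<le> 5 / 4 * W (Suc j)" for j
  proof -
    have "W j = exp \<theta> * W (Suc j)"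
      by (simp add: W_def exp_add[symmetric] algebra_simps)
    then show ?thesis using e\<theta> W0[of "Suc j"] by (simp add: mult_right_mono)
  qed
  have N1: "N j \<le> 5 / 4 * N (Suc j)" for j
  proof -
    have "real j \<le> 5 / 4 * real (Suc j)" by simp
    then have "10 * \<eta> * real j \<le> 10 * \<eta> * (5 / 4 * real (Suc j))" using \<eta> by (intro mult_left_mono) auto
    then show ?thesis using W1[of j] by (simp only: N_def distrib_left)
  qed
  have Nsub: "N (j - r) \<le> (5 / 4) ^ r * N j" for j r
  proof (induction r)
    case (Suc r)
    have "N (j - Suc r) \<le> 5 / 4 * N (j - r)"
    proof (cases "j - r")
      case 0
      then show ?thesis using N0[of 0] by simp
    next
      case (Suc q)
      then have "j - Suc r = q" by simp
      then show ?thesis using N1[of q] Suc by simp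
    qed
    with Suc show ?case by simp
  qed simp
  have Wsub: "W (j - r) \<le> (5 / 4) ^ r * W j" for j r
  proof (induction r)
    case (Suc r)
    have "W (j - Suc r) \<le> 5 / 4 * W (j - r)"
    proof (cases "j - r")
      case 0
      then show ?thesis using W0[of 0] by simp
    next
      case (Suc q)
      then have "j - Suc r = q" by simp
      then show ?thesis using W1[of q] Suc by simp
    qed
    with Suc show ?case by simp
  qed simp
  show ?case
  proof (cases "i = 0")
    case True
    then show ?thesis using E0 Z c0 u by simp
  next
    case False
    then have i1: "1 \<le> i" "i \<le> k" using less.prems by auto
    \<comment> \<open>The part of the forcing other than \<eta>, expressed through the comparison
      functions at i; moving it to an earlier index costs only powers of 5/4.\<close>
    define U where "U = Q * u ^ 3 * N i + Z / (P * u) * u ^ 3 * W i"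
    have U0: "0 \<le> U" using Q u N0[of i] W0[of i] Z P by (simp add: U_def)
    have Enn: "norm (E (i - r)) \<le> (5 / 4) ^ r * N i" if "1 \<le> r" for r
    proof (cases "i - r < i")
      case True
      then show ?thesis using IH Nsub[of i r] order_trans by blast
    qed (use that False in simp)
    have tau: "norm (\<tau> (i - s)) \<le> (5 / 4) ^ s * U + \<eta>" if s: "s < i" for s
    proof -
      have le: "1 \<le> i - s" "i - s \<le> k" using s i1 by auto
      have "(\<Sum>r\<in>{3..m}. (1 / 2) ^ r * norm (E (i - s - (r + 1))))
          \<le> (\<Sum>r\<in>{3..m}. (1 / 2) ^ r * ((5 / 4) ^ (r + 1 + s) * N i))"
      proof (intro sum_mono mult_left_mono)
        fix r
        have "i - s - (r + 1) = i - (r + 1 + s)" by simp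
        then show "norm (E (i - s - (r + 1))) \<le> (5 / 4) ^ (r + 1 + s) * N i"
          using Enn[of "r + 1 + s"] by simp
      qed simp
      also have "\<dots> = (5 / 4) ^ s * N i * (\<Sum>r\<in>{3..m}. (1 / 2) ^ r * (5 / 4) ^ (r + 1))"
        by (simp add: sum_distrib_left power_add mult_ac)
      also have "\<dots> \<le> (5 / 4) ^ s * N i * 1"
        using N0[of i] by (intro mult_left_mono geometric_tail_le) simp
      finally have "Q * u ^ 3 * (\<Sum>r\<in>{3..m}. (1 / 2) ^ r * norm (E (i - s - (r + 1))))
          \<le> Q * u ^ 3 * ((5 / 4) ^ s * N i)"
        using Q u by (intro mult_left_mono) auto
      moreover have "Z * u ^ 3 * exp (- (c0 * u\<^sup>2 / 2) * (i - s)) = Z / (P * u) * u ^ 3 * W (i - s)"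
        using P u by (simp add: W_def \<theta>_def)
      moreover have "Z / (P * u) * u ^ 3 * W (i - s) \<le> Z / (P * u) * u ^ 3 * ((5 / 4) ^ s * W i)"
        using Z P u by (intro mult_left_mono Wsub) auto
      ultimately have "norm (\<tau> (i - s)) \<le> Q * u ^ 3 * ((5 / 4) ^ s * N i) + Z / (P * u) * u ^ 3 * ((5 / 4) ^ s * W i) + \<eta>"
        using \<tau>[OF le] by linarith
      then show ?thesis by (simp add: U_def algebra_simps)
    qed
    \<comment> \<open>One use of the recursion shows that consecutive values are close: the change
      carries a factor \<open>u^2\<close> or comes from the forcing. Past the start both indices are
      truncated to 0.\<close>
    have diff: "norm (E (i - s) - E (i - (s + 1))) \<le> u\<^sup>2 * ((5 / 4) ^ (s + 2) * N i) + u\<^sup>2 * ((5 / 4) ^ (s + 3) * N i) + (5 / 4) ^ s * U + \<eta>"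
      if s: "1 \<le> s" for s
    proof (cases "s < i")
      case True
      have j: "1 \<le> i - s" "i - s \<le> k" using True i1 by auto
      have e: "i - s - 1 = i - (s + 1)" "i - s - 2 = i - (s + 2)" "i - s - 3 = i - (s + 3)" by auto
      have "E (i - s) - E (i - (s + 1)) = c1 (i - s) * E (i - (s + 2)) + c2 (i - s) * E (i - (s + 3)) + \<tau> (i - s)"
        using rec[OF j] unfolding e by simp
      also have "norm \<dots> \<le> norm (c1 (i - s)) * norm (E (i - (s + 2))) + norm (c2 (i - s)) * norm (E (i - (s + 3))) + norm (\<tau> (i - s))"
        by (intro order_trans[OF norm_triangle_ineq] add_mono) (auto simp: norm_mult)
      also have "\<dots> \<le> u\<^sup>2 * ((5 / 4) ^ (s + 2) * N i) + u\<^sup>2 * ((5 / 4) ^ (s + 3) * N i) + ((5 / 4) ^ s * U + \<eta>)"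
        by (intro add_mono mult_mono c1 c2 j Enn tau True) auto
      finally show ?thesis by simp
    next
      case False
      then have z: "i - s = 0" "i - (s + 1) = 0" by auto
      have "0 \<le> u\<^sup>2 * ((5 / 4) ^ (s + 2) * N i) + u\<^sup>2 * ((5 / 4) ^ (s + 3) * N i) + (5 / 4) ^ s * U + \<eta>"
        using N0[of i] U0 \<eta> by simp
      then show ?thesis unfolding z by simp
    qed
    define D where "D = 16 * u\<^sup>2 * N i + 5 * U + 3 * \<eta>"
    have d1: "norm (E (i - 1) - E (i - 2)) + norm (E (i - 1) - E (i - 3)) \<le> D"
    proof -
      have e: "E (i - 1) - E (i - 3) = (E (i - 1) - E (i - 2)) + (E (i - 2) - E (i - 3))" by simp
      have "norm (E (i - 1) - E (i - 3)) \<le> norm (E (i - 1) - E (i - 2)) + norm (E (i - 2) - E (i - 3))"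
        unfolding e by (rule norm_triangle_ineq)
      moreover have "norm (E (i - 1) - E (i - 2)) \<le> u\<^sup>2 * N i * ((5 / 4) ^ 3 + (5 / 4) ^ 4) + 5 / 4 * U + \<eta>"
        using diff[of 1] by (simp add: eval_nat_numeral algebra_simps)
      moreover have "norm (E (i - 2) - E (i - 3)) \<le> u\<^sup>2 * N i * ((5 / 4) ^ 4 + (5 / 4) ^ 5) + (5 / 4)\<^sup>2 * U + \<eta>"
        using diff[of 2] by (simp add: eval_nat_numeral algebra_simps)
      ultimately have "norm (E (i - 1) - E (i - 2)) + norm (E (i - 1) - E (i - 3))
          \<le> u\<^sup>2 * N i * (2 * ((5 / 4) ^ 3 + (5 / 4) ^ 4) + ((5 / 4) ^ 4 + (5 / 4) ^ 5)) + (2 * (5 / 4) + (5 / 4)\<^sup>2) * U + 3 * \<eta>"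
        by (simp add: algebra_simps)
      also have "\<dots> \<le> u\<^sup>2 * N i * 16 + 5 * U + 3 * \<eta>"
        using N0[of i] U0 by (intro add_mono mult_left_mono mult_right_mono) (auto simp: power_divide)
      finally show ?thesis by (simp add: D_def)
    qed
    \<comment> \<open>Everything is gathered at \<open>i - 1\<close>, so that the modulus of the sum
      of the coefficients counts and not the sum of their moduli, which may exceed 1.\<close>
    have "E i = (1 + c1 i + c2 i) * E (i - 1) - c1 i * (E (i - 1) - E (i - 2)) - c2 i * (E (i - 1) - E (i - 3)) + \<tau> i"
      using rec[OF i1] by (simp add: algebra_simps)
    also have "norm \<dots> \<le> norm (1 + c1 i + c2 i) * norm (E (i - 1)) + norm (c1 i) * norm (E (i - 1) - E (i - 2))
        + norm (c2 i) * norm (E (i - 1) - E (i - 3)) + norm (\<tau> i)"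
      by (intro order_trans[OF norm_triangle_ineq] order_trans[OF norm_triangle_ineq4] add_mono) (auto simp: norm_mult)
    also have "\<dots> \<le> (1 - c0 * u\<^sup>2) * N (i - 1) + u\<^sup>2 * norm (E (i - 1) - E (i - 2))
        + u\<^sup>2 * norm (E (i - 1) - E (i - 3)) + (U + \<eta>)"
      using tau[of 0] i1 IH[of "i - 1"] small(1) c1[OF i1] c2[OF i1] c12[OF i1]
      by (intro add_mono mult_mono) auto
    also have "\<dots> \<le> (1 - c0 * u\<^sup>2) * N (i - 1) + u\<^sup>2 * D + (U + \<eta>)"
      using d1 mult_left_mono[OF d1, of "u\<^sup>2"] by (simp add: distrib_left)
    also have "\<dots> \<le> (1 - c0 * u\<^sup>2) * N (i - 1) + (4 + 2 * Q) * u ^ 3 * N i + 3 / 2 * (Z / (P * u)) * u ^ 3 * W i + 3 / 2 * \<eta>"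
    proof -
      have u2: "u\<^sup>2 \<le> 1 / 16" using u power_mono[of u "1/4" 2] by (simp add: power2_eq_square)
      have "u\<^sup>2 * D + (U + \<eta>) = 16 * (u * u ^ 3) * N i + (1 + 5 * u\<^sup>2) * U + (1 + 3 * u\<^sup>2) * \<eta>"
        by (simp add: D_def algebra_simps eval_nat_numeral)
      moreover have "16 * (u * u ^ 3) * N i \<le> 16 * (1 / 4 * u ^ 3) * N i"
        using u N0[of i] by (intro mult_right_mono mult_left_mono) auto
      moreover have "(1 + 5 * u\<^sup>2) * U \<le> 3 / 2 * U" using u2 U0 by (intro mult_right_mono) auto
      moreover have "(1 + 3 * u\<^sup>2) * \<eta> \<le> 3 / 2 * \<eta>" using u2 \<eta> by (intro mult_right_mono) auto
      moreover have "3 / 2 * U = 3 / 2 * Q * u ^ 3 * N i + 3 / 2 * (Z / (P * u)) * u ^ 3 * W i"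
        by (simp add: U_def algebra_simps)
      moreover have "3 / 2 * Q * u ^ 3 * N i \<le> 2 * Q * u ^ 3 * N i"
        using Q u N0[of i] by (intro mult_right_mono) auto
      ultimately show ?thesis by (simp add: algebra_simps)
    qed
    also have "\<dots> \<le> N i"
    proof -
      have u3: "(4 + 2 * Q) * u ^ 3 \<le> \<theta> / 4"
      proof -
        have "(4 + 2 * Q) * u ^ 3 = ((4 + 2 * Q) * u) * u\<^sup>2" by (simp add: eval_nat_numeral)
        also have "\<dots> \<le> c0 / 8 * u\<^sup>2" using small(2) by (intro mult_right_mono) auto
        finally show ?thesis by (simp add: \<theta>_def)
      qed
      have z: "3 / 2 * (Z / (P * u)) * u ^ 3 = \<theta> / 4"
        using P u c0 Z by (simp add: P_def \<theta>_def field_simps eval_nat_numeral)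
      have "1 - c0 * u\<^sup>2 \<le> exp (- (2 * \<theta>))" using exp_ge_add_one_self[of "- (2 * \<theta>)"] by (simp add: \<theta>_def)
      moreover have "W (i - 1) = exp \<theta> * W i"
        using i1 by (simp add: W_def exp_add[symmetric] of_nat_diff algebra_simps)
      ultimately have "(1 - c0 * u\<^sup>2) * W (i - 1) \<le> exp (- (2 * \<theta>)) * (exp \<theta> * W i)"
        using W0[of "i - 1"] by (metis less_imp_le mult_right_mono)
      also have "\<dots> = exp (- \<theta>) * W i" by (simp add: exp_add[symmetric])
      also have "\<dots> \<le> (1 - \<theta> / 2) * W i"
        using \<theta> W0[of i] by (intro mult_right_mono exp_minus_le_one_minus_half) auto
      finally have 1: "(1 - c0 * u\<^sup>2) * W (i - 1) \<le> (1 - \<theta> / 2) * W i" .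
      \<comment> \<open>Of the \<open>10 * \<eta>\<close> gained per step the new error takes
        \<open>3 / 2 * \<eta>\<close>. The growing term is covered by the contraction of the old one
        from \<open>i = 2\<close> on, since then \<open>i / 4 \<le> 2 * (i - 1)\<close>.\<close>
      have 2: "(1 - c0 * u\<^sup>2) * (10 * \<eta> * (i - 1)) + \<theta> / 4 * (10 * \<eta> * i) + 3 / 2 * \<eta> \<le> 10 * \<eta> * i"
      proof -
        have ri: "real (i - 1) = real i - 1" using i1 by simp
        have "(1 - c0 * u\<^sup>2) * (10 * (real i - 1)) + \<theta> / 4 * (10 * i) + 3 / 2 \<le> 10 * i"
        proof (cases "i = 1")
          case True
          then show ?thesis using \<theta> by simp
        next
          case False
          then have i2: "2 \<le> real i" using i1 by simp
          have "\<theta> * (real i / 4) \<le> \<theta> * (2 * (real i - 1))" using i2 \<theta> by (intro mult_left_mono) auto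
          moreover have "(1 - c0 * u\<^sup>2) * (10 * (real i - 1)) = 10 * (real i - 1) - 10 * (\<theta> * (2 * (real i - 1)))"
            by (simp add: \<theta>_def algebra_simps) (simp add: field_simps)
          ultimately show ?thesis by simp
        qed
        from mult_left_mono[OF this \<eta>] show ?thesis unfolding ri by (simp add: algebra_simps)
      qed
      have 3: "(4 + 2 * Q) * u ^ 3 * N i \<le> \<theta> / 4 * N i" using u3 N0[of i] by (intro mult_right_mono) auto
      have "(1 - c0 * u\<^sup>2) * N (i - 1) = (1 - c0 * u\<^sup>2) * W (i - 1) + (1 - c0 * u\<^sup>2) * (10 * \<eta> * (i - 1))"
        by (simp add: N_def distrib_left)
      moreover have "\<theta> / 4 * N i = \<theta> / 4 * W i + \<theta> / 4 * (10 * \<eta> * i)" by (simp add: N_def distrib_left)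
      moreover have "N i = W i + 10 * \<eta> * i" by (simp add: N_def)
      ultimately show ?thesis using 1 2 3 unfolding z by (simp add: algebra_simps)
    qed
    finally show ?thesis by (simp add: N_def W_def P_def \<theta>_def)
  qed
qed

section \<open>Characteristic functions of weakly dependent blocks\<close>

lemma norm_iexp_minus_1: "norm (iexp x - 1) \<le> \<bar>x\<bar>"
  using iexp_approx1[of x 0] by simp

lemma norm_iexp_minus_1': "norm (iexp x - 1) \<le> 2"
  using norm_triangle_ineq4[of "iexp x" 1] by simp

lemma norm_iexp_approx_linear: "norm (iexp x - 1 - \<i> * x) \<le> x\<^sup>2 / 2"
  using iexp_approx1[of x 1] by (simp add: diff_diff_eq power2_eq_square)

lemma norm_iexp_approx_quadratic: "norm (iexp x - 1 - \<i> * x + x\<^sup>2 / 2) \<le> \<bar>x\<bar> ^ 3 / 6"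
  using iexp_approx1[of x 2] by (simp add: eval_nat_numeral algebra_simps power_mult_distrib)

lemma norm_diff5_le:
  fixes a b c d e :: "'b::real_normed_vector"
  assumes "norm a \<le> a'" "norm b \<le> b'" "norm c \<le> c'" "norm d \<le> d'" "norm e \<le> e'"
  shows "norm (a - b - c - d - e) \<le> a' + b' + c' + d' + e'"
proof -
  have "norm (a - b - c - d - e) \<le> norm (a - b - c - d) + norm e" by (rule norm_triangle_ineq4)
  also have "norm (a - b - c - d) \<le> norm (a - b - c) + norm d" by (rule norm_triangle_ineq4)
  also have "norm (a - b - c) \<le> norm (a - b) + norm c" by (rule norm_triangle_ineq4)
  also have "norm (a - b) \<le> norm a + norm b" by (rule norm_triangle_ineq4)
  finally show ?thesis using assms by linarith
qed

text \<open>\<open>y 0 = 0\<close> is a sentinel: with truncated subtraction, a product reaching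
  below the first block contains \<open>Z 0 = 0\<close> and vanishes. Mixing is assumed only across
  a skipped block.\<close>

locale block_row = prob_space M for M :: "'w measure" +
  fixes k :: nat and y :: "nat \<Rightarrow> 'w \<Rightarrow> real" and PA FU :: "nat \<Rightarrow> 'w measure"
    and \<delta> lam Ky t :: real
  assumes y_0: "y 0 x = 0"
    and y_past: "j \<le> s \<Longrightarrow> s \<le> k \<Longrightarrow> y j \<in> borel_measurable (PA s)"
    and y_future: "s \<le> j \<Longrightarrow> j \<le> k \<Longrightarrow> y j \<in> borel_measurable (FU s)"
    and subalgebra_PA: "subalgebra M (PA s)"
    and mixing: "s + 2 \<le> k \<Longrightarrow> mixing_le M (PA s) (FU (s + 2)) \<delta>"
    and y_bound: "j \<le> k \<Longrightarrow> x \<in> space M \<Longrightarrow> \<bar>y j x\<bar> \<le> Ky"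
    and y_mean: "j \<le> k \<Longrightarrow> expectation (y j) = 0"
    and moment1: "j \<le> k \<Longrightarrow> expectation (\<lambda>x. \<bar>y j x\<bar>) \<le> lam"
    and moment2: "j \<le> k \<Longrightarrow> expectation (\<lambda>x. (y j x)\<^sup>2) \<le> lam\<^sup>2"
    and moment3: "j \<le> k \<Longrightarrow> expectation (\<lambda>x. \<bar>y j x\<bar> ^ 3) \<le> lam ^ 3"
    and \<delta>_nonneg: "0 \<le> \<delta>" and lam_pos: "0 < lam"
begin

section \<open>Expansion of the characteristic functions of the partial sums\<close>

definition "u = \<bar>t\<bar> * lam"
definition "e j x = iexp (t * y j x)"
definition "Z j x = e j x - 1"
definition "F i = expectation (\<lambda>x. \<Prod>j\<in>{1..i}. e j x)"
definition "ZP i r x = (\<Prod>l<r. Z (i - l) x)"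
definition "c i r = expectation (ZP i r)"
definition "C i r = expectation (\<lambda>x. norm (ZP i r x))"
text \<open>A stage of the expansion: the last r exponentials have been replaced by their
  increments, the others are untouched.\<close>

definition "R i r = expectation (\<lambda>x. (\<Prod>j\<in>{1..i - r}. e j x) * ZP i r x)"

lemma u_nonneg: "0 \<le> u" using lam_pos by (simp add: u_def)

lemma e_0 [simp]: "e 0 x = 1" by (simp add: e_def y_0)
lemma Z_0 [simp]: "Z 0 x = 0" by (simp add: Z_def)
lemma norm_e [simp]: "norm (e j x) = 1" by (simp add: e_def)

lemma norm_Z2: "norm (Z j x) \<le> 2"
  unfolding Z_def e_def by (rule norm_iexp_minus_1')

lemma norm_Z1: "norm (Z j x) \<le> \<bar>t\<bar> * \<bar>y j x\<bar>"
  unfolding Z_def e_def using norm_iexp_minus_1[of "t * y j x"] by (simp add: abs_mult)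

lemma e_PA: "j \<le> s \<Longrightarrow> s \<le> k \<Longrightarrow> e j \<in> borel_measurable (PA s)"
  using y_past[of j s] unfolding e_def[abs_def] by measurable
lemma e_FU: "s \<le> j \<Longrightarrow> j \<le> k \<Longrightarrow> e j \<in> borel_measurable (FU s)"
  using y_future[of s j] unfolding e_def[abs_def] by measurable
lemma Z_PA: "j \<le> s \<Longrightarrow> s \<le> k \<Longrightarrow> Z j \<in> borel_measurable (PA s)"
  using e_PA[of j s] unfolding Z_def[abs_def] by measurable
lemma Z_FU: "s \<le> j \<Longrightarrow> j \<le> k \<Longrightarrow> Z j \<in> borel_measurable (FU s)"
  using e_FU[of s j] unfolding Z_def[abs_def] by measurable
lemma y_M [measurable]: "j \<le> k \<Longrightarrow> y j \<in> borel_measurable M"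
  using y_past[of j j] measurable_from_subalg[OF subalgebra_PA] by blast
lemma e_M [measurable]: "j \<le> k \<Longrightarrow> e j \<in> borel_measurable M"
  using e_PA[of j j] measurable_from_subalg[OF subalgebra_PA] by blast
lemma Z_M [measurable]: "j \<le> k \<Longrightarrow> Z j \<in> borel_measurable M"
  using Z_PA[of j j] measurable_from_subalg[OF subalgebra_PA] by blast

lemma ZP_FU: "i \<le> k \<Longrightarrow> s + r \<le> Suc i \<Longrightarrow> ZP i r \<in> borel_measurable (FU s)"
  unfolding ZP_def[abs_def] by (intro borel_measurable_prod Z_FU) auto

lemma ZP_M: "i \<le> k \<Longrightarrow> ZP i r \<in> borel_measurable M"
  unfolding ZP_def[abs_def] by (intro borel_measurable_prod Z_M) auto

lemma prod_e_PA: "i \<le> k \<Longrightarrow> (\<lambda>x. \<Prod>j\<in>{1..i}. e j x) \<in> borel_measurable (PA i)"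
  by (intro borel_measurable_prod e_PA) auto

lemma norm_prod_e [simp]: "norm (\<Prod>j\<in>A. e j x) = 1"
  by (simp add: prod_norm[symmetric])

lemma norm_ZP: "norm (ZP i r x) = (\<Prod>l<r. norm (Z (i - l) x))"
  by (simp add: ZP_def prod_norm)

lemma norm_ZP_le: "norm (ZP i r x) \<le> 2 ^ r"
  using prod_mono[of "{..<r}" "\<lambda>l. norm (Z (i - l) x)" "\<lambda>_. 2"] norm_Z2 by (simp add: norm_ZP)

lemma ZP_eq_0: "i < r \<Longrightarrow> ZP i r x = 0"
  unfolding ZP_def by (rule prod_zero) (auto intro!: bexI[of _ i])

lemma ZP_Suc: "ZP i (Suc r) x = ZP i r x * Z (i - r) x"
  by (simp add: ZP_def)

lemma integrable_y [simp]: "j \<le> k \<Longrightarrow> integrable M (y j)"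
  by (rule integrable_bounded_real[OF y_M y_bound])

lemma integrable_y_power [simp]: "j \<le> k \<Longrightarrow> integrable M (\<lambda>x. \<bar>y j x\<bar> ^ m)"
  by (rule integrable_bounded_real[where c="Ky ^ m"]) (auto intro!: power_mono y_bound)

lemma integrable_y2 [simp]: "j \<le> k \<Longrightarrow> integrable M (\<lambda>x. (y j x)\<^sup>2)"
  using integrable_y_power[of j 2] by simp

lemma integrable_yy: "j \<le> k \<Longrightarrow> i \<le> k \<Longrightarrow> integrable M (\<lambda>x. y j x * y i x)"
proof (rule integrable_bounded_real[where c="Ky * Ky"])
  fix x assume "j \<le> k" "i \<le> k" "x \<in> space M"
  then show "\<bar>y j x * y i x\<bar> \<le> Ky * Ky"
    using y_bound[of j x] y_bound[of i x] by (auto simp: abs_mult intro!: mult_mono order_trans[OF abs_ge_zero])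
qed measurable

lemma integrable_bounded_complex:
  assumes "f \<in> borel_measurable M" "\<And>x. norm (f x :: complex) \<le> a"
  shows "integrable M f"
  using assms by (intro integrable_const_bound[where B=a]) auto

text \<open>Write \<open>e = 1 + Z\<close> for block \<open>i - r\<close>. The summand 1 deletes
  this block, which separates the earlier exponentials from the r factors Z, so that mixing factors
  the mean; the summand Z gives the next stage. The error uses the bounds 1 and \<open>2^r\<close>
  of the two factors.\<close>

lemma R_step:
  assumes i: "i \<le> k" and r: "1 \<le> r"
  shows "norm (R i r - R i (Suc r) - c i r * F (i - (r + 1))) \<le> 16 * 2 ^ r * \<delta>"
proof (cases "i < r")
  case True
  then have "ZP i r = (\<lambda>x. 0)" "ZP i (Suc r) = (\<lambda>x. 0)" by (auto simp: ZP_eq_0)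
  then show ?thesis using \<delta>_nonneg by (simp add: R_def c_def)
next
  case False
  then have ri: "r \<le> i" by simp
  define G where "G x = (\<Prod>j\<in>{1..i - (r + 1)}. e j x)" for x
  have GM: "G \<in> borel_measurable M"
    unfolding G_def[abs_def] using i by (intro borel_measurable_prod e_M) auto
  have "(\<Prod>j\<in>{1..i - r}. e j x) * ZP i r x = G x * ZP i r x + (\<Prod>j\<in>{1..i - Suc r}. e j x) * ZP i (Suc r) x" for x
  proof (cases "i = r")
    case True
    then show ?thesis by (simp add: G_def ZP_Suc)
  next
    case False
    then obtain q where q: "i - r = Suc q" using ri by (cases "i - r") auto
    then have "i - (r + 1) = q" "i - Suc r = q" by auto
    then show ?thesis using q by (simp add: G_def ZP_Suc Z_def algebra_simps)
  qed
  then have "R i r = expectation (\<lambda>x. G x * ZP i r x + (\<Prod>j\<in>{1..i - Suc r}. e j x) * ZP i (Suc r) x)"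
    by (simp add: R_def)
  also have "\<dots> = expectation (\<lambda>x. G x * ZP i r x) + R i (Suc r)"
    unfolding R_def
  proof (rule Bochner_Integration.integral_add)
    have G': "(\<lambda>x. (\<Prod>j\<in>{1..i - Suc r}. e j x) * ZP i (Suc r) x) = (\<lambda>x. G x * ZP i (Suc r) x)"
      by (simp add: G_def)
    have nG: "norm (G x) = 1" for x by (simp add: G_def)
    show "integrable M (\<lambda>x. G x * ZP i r x)"
      using norm_ZP_le[of i r] GM ZP_M[OF i]
      by (intro integrable_bounded_complex[where a="2 ^ r"]) (auto simp: norm_mult nG)
    show "integrable M (\<lambda>x. (\<Prod>j\<in>{1..i - Suc r}. e j x) * ZP i (Suc r) x)"
      unfolding G' using norm_ZP_le[of i "Suc r"] GM ZP_M[OF i]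
      by (intro integrable_bounded_complex[where a="2 ^ Suc r"]) (auto simp: norm_mult nG)
  qed
  finally have *: "R i r - R i (Suc r) - c i r * F (i - (r + 1))
      = expectation (\<lambda>x. G x * ZP i r x) - expectation G * expectation (ZP i r)"
    by (simp add: c_def F_def G_def[abs_def])
  show ?thesis
  proof (cases "i = r")
    case True
    then show ?thesis using \<delta>_nonneg prob_space unfolding * by (simp add: G_def[abs_def])
  next
    case False
    then have "i - (r + 1) + 2 = i - r + 1" using ri by linarith
    moreover have "i - r + 1 \<le> i" using r ri by linarith
    ultimately have s: "i - (r + 1) + 2 \<le> k" "i - (r + 1) + 2 + r \<le> Suc i" using ri i by linarith+
    have "norm (expectation (\<lambda>x. G x * ZP i r x) - expectation G * expectation (ZP i r)) \<le> 16 * 1 * 2 ^ r * \<delta>"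
    proof (rule covariance_complex_le[OF mixing[OF s(1)]])
      show "G \<in> borel_measurable (PA (i - (r + 1)))" unfolding G_def[abs_def] using i by (intro prod_e_PA) auto
      show "ZP i r \<in> borel_measurable (FU (i - (r + 1) + 2))" by (rule ZP_FU[OF i s(2)])
    qed (use norm_ZP_le in \<open>auto simp: G_def\<close>)
    then show ?thesis unfolding * by simp
  qed
qed

text \<open>Again \<open>e = 1 + Z\<close>, but the exponentials left in \<open>R i 1\<close> are
  adjacent to block i, so nothing can be factored yet.\<close>

lemma F_step: "1 \<le> i \<Longrightarrow> i \<le> k \<Longrightarrow> F i = F (i - 1) + R i 1"
proof -
  assume i: "1 \<le> i" "i \<le> k"
  define G where "G x = (\<Prod>j\<in>{1..i - 1}. e j x)" for x
  have GM: "G \<in> borel_measurable M"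
    unfolding G_def[abs_def] using i by (intro borel_measurable_prod e_M) auto
  have ins: "{1..i} = insert i {1..i - 1}" using i by auto
  have "(\<Prod>j\<in>{1..i}. e j x) = G x + G x * Z i x" for x
    unfolding ins G_def using i by (subst prod.insert) (auto simp: Z_def algebra_simps)
  then have "F i = expectation (\<lambda>x. G x + G x * Z i x)" by (simp add: F_def)
  also have "\<dots> = expectation G + expectation (\<lambda>x. G x * Z i x)"
  proof (rule Bochner_Integration.integral_add)
    show "integrable M G" using GM by (intro integrable_bounded_complex[where a=1]) (auto simp: G_def)
    have nG: "norm (G x) = 1" for x by (simp add: G_def)
    show "integrable M (\<lambda>x. G x * Z i x)"
      using norm_Z2[of i] GM Z_M[OF i(2)]
      by (intro integrable_bounded_complex[where a=2]) (auto simp: norm_mult nG)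
  qed
  finally show ?thesis by (simp add: F_def R_def G_def[abs_def] ZP_def)
qed

lemma norm_F: "norm (F i) \<le> 1"
proof -
  have "norm (F i) \<le> expectation (\<lambda>x. 1)"
    unfolding F_def by (rule norm_integral_le) auto
  then show ?thesis using prob_space by simp
qed

lemma norm_c_le_C: "norm (c i r) \<le> C i r"
  unfolding c_def C_def by (rule integral_norm_bound)

lemma norm_R_le_C: "i \<le> k \<Longrightarrow> norm (R i r) \<le> C i r"
  unfolding R_def C_def using ZP_M[of i r] norm_ZP_le[of i r]
  by (intro norm_integral_le integrable_norm integrable_bounded_complex[where a="2 ^ r"]) (auto simp: norm_mult)

text \<open>The stages telescope. Their mixing errors form a geometric sum below
  \<open>32 * 2^\<nu> * \<delta>\<close>, and the last stage is bounded by absolute values.\<close>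

lemma norm_recursion_remainder:
  assumes i: "1 \<le> i" "i \<le> k"
  shows "norm (F i - F (i - 1) - (\<Sum>r\<in>{1..\<nu>}. c i r * F (i - (r + 1)))) \<le> 32 * 2 ^ \<nu> * \<delta> + C i (\<nu> + 1)"
proof -
  have "norm (R i 1 - R i (Suc m) - (\<Sum>r\<in>{1..m}. c i r * F (i - (r + 1)))) \<le> 32 * 2 ^ m * \<delta>" for m
  proof (induction m)
    case 0
    then show ?case using \<delta>_nonneg by simp
  next
    case (Suc m)
    have "R i 1 - R i (Suc (Suc m)) - (\<Sum>r\<in>{1..Suc m}. c i r * F (i - (r + 1)))
       = (R i 1 - R i (Suc m) - (\<Sum>r\<in>{1..m}. c i r * F (i - (r + 1))))
         + (R i (Suc m) - R i (Suc (Suc m)) - c i (Suc m) * F (i - (Suc m + 1)))"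
    proof -
      have "(\<Sum>r\<in>{1..Suc m}. c i r * F (i - (r + 1))) = (\<Sum>r\<in>{1..m}. c i r * F (i - (r + 1))) + c i (Suc m) * F (i - (Suc m + 1))"
        by simp
      then show ?thesis by (simp only:) simp
    qed
    also have "norm \<dots> \<le> 32 * 2 ^ m * \<delta> + 16 * 2 ^ Suc m * \<delta>"
      by (intro order_trans[OF norm_triangle_ineq] add_mono Suc R_step i) simp
    finally show ?case by (simp add: mult_ac)
  qed
  from this[of \<nu>] have 1: "norm (R i 1 - R i (Suc \<nu>) - (\<Sum>r\<in>{1..\<nu>}. c i r * F (i - (r + 1)))) \<le> 32 * 2 ^ \<nu> * \<delta>" .
  have "F i - F (i - 1) - (\<Sum>r\<in>{1..\<nu>}. c i r * F (i - (r + 1)))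
     = (R i 1 - R i (Suc \<nu>) - (\<Sum>r\<in>{1..\<nu>}. c i r * F (i - (r + 1)))) + R i (Suc \<nu>)"
    using F_step[OF i] by simp
  then show ?thesis
    using norm_triangle_ineq[of "R i 1 - R i (Suc \<nu>) - (\<Sum>r\<in>{1..\<nu>}. c i r * F (i - (r + 1)))" "R i (Suc \<nu>)"]
      1 norm_R_le_C[OF i(2), of "Suc \<nu>"] by simp
qed

text \<open>Only every second factor: these blocks are pairwise non-adjacent, hence nearly
  independent.\<close>

definition "AP i r x = (\<Prod>l<r. norm (Z (i - 2 * l) x))"

lemma AP_PA: "i \<le> s \<Longrightarrow> s \<le> k \<Longrightarrow> AP i r \<in> borel_measurable (PA s)"
  unfolding AP_def[abs_def]
proof (rule borel_measurable_prod)
  fix l assume "i \<le> s" "s \<le> k"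
  then have [measurable]: "Z (i - 2 * l) \<in> borel_measurable (PA s)" by (intro Z_PA) auto
  show "(\<lambda>x. norm (Z (i - 2 * l) x)) \<in> borel_measurable (PA s)" by measurable
qed

lemma AP_nonneg: "0 \<le> AP i r x" by (simp add: AP_def prod_nonneg)

lemma AP_le: "AP i r x \<le> 2 ^ r"
  using prod_mono[of "{..<r}" "\<lambda>l. norm (Z (i - 2 * l) x)" "\<lambda>_. 2"] norm_Z2 by (simp add: AP_def)

lemma AP_Suc: "AP i (Suc r) x = AP (i - 2) r x * norm (Z i x)"
proof -
  have "i - 2 * Suc l = i - 2 - 2 * l" for l by simp
  then show ?thesis unfolding AP_def by (subst prod.lessThan_Suc_shift) (simp add: mult.commute)
qed

lemma expectation_norm_Z: "j \<le> k \<Longrightarrow> expectation (\<lambda>x. norm (Z j x)) \<le> u"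
proof -
  assume j: "j \<le> k"
  have "expectation (\<lambda>x. norm (Z j x)) \<le> expectation (\<lambda>x. \<bar>t\<bar> * \<bar>y j x\<bar>)"
    using j norm_Z2 by (intro integral_mono norm_Z1 integrable_norm integrable_bounded_complex[where a=2]) auto
  also have "\<dots> \<le> u" using moment1[OF j] by (simp add: u_def mult_left_mono)
  finally show ?thesis .
qed

text \<open>Each new factor costs one covariance error \<open>4 * 2^r * 2 * \<delta>\<close>, and
  \<open>u \<le> 1\<close> keeps the old error from growing, so the errors add up to
  \<open>8 * 2^r * \<delta>\<close>.\<close>

lemma expectation_AP:
  assumes u1: "u \<le> 1" and i: "i \<le> k"
  shows "expectation (AP i r) \<le> u ^ r + 8 * 2 ^ r * \<delta>"
  using i
proof (induction r arbitrary: i)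
  case 0
  then show ?case using \<delta>_nonneg prob_space by (simp add: AP_def[abs_def])
next
  case (Suc r)
  show ?case
  proof (cases "r = 0 \<or> i < 2")
    case True
    then show ?thesis
    proof
      assume "r = 0"
      then show ?thesis using expectation_norm_Z[OF Suc.prems] \<delta>_nonneg by (simp add: AP_def[abs_def])
    next
      assume "i < 2"
      show ?thesis
      proof (cases r)
        case 0
        then show ?thesis using expectation_norm_Z[OF Suc.prems] \<delta>_nonneg by (simp add: AP_def[abs_def])
      next
        case (Suc q)
        \<comment> \<open>The factor with \<open>l = 1\<close> is \<open>Z 0\<close>.\<close>
        then have "AP i (Suc r) x = 0" for x
          unfolding AP_def using \<open>i < 2\<close> by (intro prod_zero) (auto intro!: bexI[of _ 1])
        then have "AP i (Suc r) = (\<lambda>x. 0)" by auto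
        then show ?thesis using u_nonneg \<delta>_nonneg by simp
      qed
    qed
  next
    case False
    then have i: "i - 2 + 2 = i" "i - 2 + 2 \<le> k" "i - 2 \<le> k" using Suc.prems by auto
    have "\<bar>expectation (\<lambda>x. AP (i - 2) r x * norm (Z i x)) - expectation (AP (i - 2) r) * expectation (\<lambda>x. norm (Z i x))\<bar>
        \<le> 4 * 2 ^ r * 2 * \<delta>"
    proof (rule covariance_le[OF mixing[OF i(2)]])
      show "AP (i - 2) r \<in> borel_measurable (PA (i - 2))" by (rule AP_PA) (use i in auto)
      have "Z i \<in> borel_measurable (FU (i - 2 + 2))" by (rule Z_FU) (use i Suc.prems in auto)
      then show "(\<lambda>x. norm (Z i x)) \<in> borel_measurable (FU (i - 2 + 2))" by measurable
    qed (use AP_le AP_nonneg norm_Z2 in auto)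
    moreover have "expectation (AP (i - 2) r) * expectation (\<lambda>x. norm (Z i x)) \<le> (u ^ r + 8 * 2 ^ r * \<delta>) * u"
      using Suc.IH[OF i(3)] expectation_norm_Z[OF Suc.prems] u_nonneg \<delta>_nonneg
      by (intro mult_mono) auto
    moreover have "8 * 2 ^ r * \<delta> * u \<le> 8 * 2 ^ r * \<delta> * 1" using u1 \<delta>_nonneg by (intro mult_left_mono) auto
    ultimately show ?thesis unfolding AP_Suc[abs_def] by (simp add: algebra_simps)
  qed
qed

lemma norm_ZP_le_AP: "norm (ZP i (2 * p) x) \<le> 2 ^ p * AP i p x"
proof (induction p)
  case (Suc p)
  have "norm (ZP i (2 * Suc p) x) = norm (ZP i (2 * p) x) * norm (Z (i - 2 * p) x) * norm (Z (i - (2 * p + 1)) x)"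
    by (simp add: norm_ZP)
  also have "\<dots> \<le> 2 ^ p * AP i p x * norm (Z (i - 2 * p) x) * 2"
    using Suc norm_Z2 AP_nonneg by (intro mult_mono) auto
  finally show ?case by (simp add: AP_def mult_ac)
qed (simp add: ZP_def AP_def)

text \<open>Alternate factors are estimated in the mean and all others by 2, including the one left
  over for odd r. This is why only the power \<open>r div 2\<close> of u appears.\<close>

lemma C_le:
  assumes u1: "u \<le> 1" and i: "i \<le> k"
  shows "C i r \<le> 2 * (2 * u) ^ (r div 2) + 8 * 2 ^ r * \<delta>"
proof -
  define p where "p = r div 2"
  define s where "s = r mod 2"
  have r: "r = 2 * p + s" by (simp add: p_def s_def)
  have s: "(2::real) ^ s \<le> 2" "2 ^ s * 2 ^ p * 2 ^ p = (2::real) ^ r"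
    by (simp add: s_def, cases "even r") (auto simp: r power_add mult_2 mod2_eq_if)
  have AM: "integrable M (AP i p)"
    using AP_PA[OF i order_refl, of p] measurable_from_subalg[OF subalgebra_PA] AP_le AP_nonneg
    by (intro integrable_bounded_real[where c="2 ^ p"]) auto
  have pw: "norm (ZP i r x) \<le> 2 ^ s * (2 ^ p * AP i p x)" for x
  proof -
    have "norm (ZP i r x) \<le> 2 ^ s * norm (ZP i (2 * p) x)"
    proof (cases "s = 0")
      case False
      then have "s = 1" by (simp add: s_def)
      moreover have "norm (ZP i (2 * p) x) * norm (Z (i - 2 * p) x) \<le> norm (ZP i (2 * p) x) * 2"
        by (intro mult_left_mono norm_Z2) simp
      ultimately show ?thesis by (simp add: r ZP_Suc norm_mult)
    qed (simp add: r)
    also have "\<dots> \<le> 2 ^ s * (2 ^ p * AP i p x)" by (intro mult_left_mono norm_ZP_le_AP) simp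
    finally show ?thesis .
  qed
  have "C i r \<le> expectation (\<lambda>x. 2 ^ s * (2 ^ p * AP i p x))"
    unfolding C_def using ZP_M[OF i] norm_ZP_le AM
    by (intro integral_mono pw integrable_norm integrable_bounded_complex[where a="2 ^ r"]) auto
  also have "\<dots> = 2 ^ s * (2 ^ p * expectation (AP i p))" by simp
  also have "\<dots> \<le> 2 ^ s * (2 ^ p * (u ^ p + 8 * 2 ^ p * \<delta>))"
    by (intro mult_left_mono expectation_AP u1 i) auto
  also have "\<dots> = 2 ^ s * (2 * u) ^ p + 8 * (2 ^ s * 2 ^ p * 2 ^ p) * \<delta>"
    by (simp add: algebra_simps power_mult_distrib)
  also have "\<dots> \<le> 2 * (2 * u) ^ p + 8 * 2 ^ r * \<delta>"
    unfolding s(2) using s(1) u_nonneg by (intro add_mono mult_right_mono order_refl) auto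
  finally show ?thesis by (simp add: p_def)
qed

text \<open>For these r the general bound gives too small a power of u. Instead three neighbouring
  factors are treated with AM-GM and third moments, which requires no independence, and the at most
  two remaining ones are bounded by 2.\<close>

lemma C_le_cubic:
  assumes i: "i \<le> k" and r: "3 \<le> r" "r \<le> 5"
  shows "C i r \<le> 4 * u ^ 3"
proof -
  \<comment> \<open>Half of the product below is
    \<open>a^3 + b^3 + c^3 - 3 * a * b * c\<close>.\<close>
  have amgm: "a * b * c \<le> (a ^ 3 + b ^ 3 + c ^ 3) / 3" if "0 \<le> a" "0 \<le> b" "0 \<le> c" for a b c :: real
  proof -
    have "0 \<le> (a + b + c) * ((a - b)\<^sup>2 + (b - c)\<^sup>2 + (c - a)\<^sup>2)"
      using that by (intro mult_nonneg_nonneg) auto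
    then show ?thesis by (simp add: algebra_simps power2_eq_square power3_eq_cube)
  qed
  have step: "norm (ZP i (3 + m) x) \<le> 2 ^ m * norm (ZP i 3 x)" for m x
  proof (induction m)
    case (Suc m)
    have "norm (ZP i (3 + Suc m) x) = norm (ZP i (3 + m) x) * norm (Z (i - (3 + m)) x)"
      using ZP_Suc[of i "3 + m" x] by (simp add: norm_mult)
    also have "\<dots> \<le> 2 ^ m * norm (ZP i 3 x) * 2" using Suc norm_Z2 by (intro mult_mono) auto
    finally show ?case by simp
  qed simp
  obtain m where m: "r = 3 + m" using le_Suc_ex[OF r(1)] by blast
  then have m2: "m \<le> 2" using r(2) by simp
  have pm: "(2::real) ^ m \<le> 4" using power_increasing[OF m2, of "2::real"] by simp
  have pw: "norm (ZP i r x) \<le> 4 * \<bar>t\<bar> ^ 3 / 3 * (\<bar>y i x\<bar> ^ 3 + \<bar>y (i - 1) x\<bar> ^ 3 + \<bar>y (i - 2) x\<bar> ^ 3)" for x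
  proof -
    have "norm (ZP i 3 x) = norm (Z i x) * norm (Z (i - 1) x) * norm (Z (i - 2) x)"
      by (simp add: norm_ZP eval_nat_numeral)
    also have "\<dots> \<le> (\<bar>t\<bar> * \<bar>y i x\<bar>) * (\<bar>t\<bar> * \<bar>y (i - 1) x\<bar>) * (\<bar>t\<bar> * \<bar>y (i - 2) x\<bar>)"
      by (intro mult_mono norm_Z1) auto
    also have "\<dots> = \<bar>t\<bar> ^ 3 * (\<bar>y i x\<bar> * \<bar>y (i - 1) x\<bar> * \<bar>y (i - 2) x\<bar>)"
      by (simp add: power3_eq_cube mult_ac)
    also have "\<dots> \<le> \<bar>t\<bar> ^ 3 * ((\<bar>y i x\<bar> ^ 3 + \<bar>y (i - 1) x\<bar> ^ 3 + \<bar>y (i - 2) x\<bar> ^ 3) / 3)"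
      by (intro mult_left_mono amgm) auto
    finally have z3: "norm (ZP i 3 x) \<le> \<dots>" .
    have "norm (ZP i r x) \<le> 2 ^ m * norm (ZP i 3 x)" using step[of m x] m by simp
    also have "\<dots> \<le> 4 * (\<bar>t\<bar> ^ 3 * ((\<bar>y i x\<bar> ^ 3 + \<bar>y (i - 1) x\<bar> ^ 3 + \<bar>y (i - 2) x\<bar> ^ 3) / 3))"
      using pm z3 by (intro mult_mono) auto
    finally show ?thesis by simp
  qed
  have k: "i \<le> k" "i - 1 \<le> k" "i - 2 \<le> k" using i by auto
  have "C i r \<le> expectation (\<lambda>x. 4 * \<bar>t\<bar> ^ 3 / 3 * (\<bar>y i x\<bar> ^ 3 + \<bar>y (i - 1) x\<bar> ^ 3 + \<bar>y (i - 2) x\<bar> ^ 3))"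
    unfolding C_def using ZP_M[OF i, of r] norm_ZP_le[of i r] k
    by (intro integral_mono pw integrable_norm integrable_bounded_complex[where a="2 ^ r"]) auto
  also have "\<dots> = 4 * \<bar>t\<bar> ^ 3 / 3 * (expectation (\<lambda>x. \<bar>y i x\<bar> ^ 3) + expectation (\<lambda>x. \<bar>y (i - 1) x\<bar> ^ 3) + expectation (\<lambda>x. \<bar>y (i - 2) x\<bar> ^ 3))"
    using k by simp
  also have "\<dots> \<le> 4 * \<bar>t\<bar> ^ 3 / 3 * (lam ^ 3 + lam ^ 3 + lam ^ 3)"
    by (intro mult_left_mono add_mono moment3 k) auto
  finally show ?thesis by (simp add: u_def power_mult_distrib mult_ac)
qed

text \<open>Joins the two ranges in the form required by the stability lemma. For
  \<open>r \<ge> 6\<close> the constant arises as \<open>2 * 8 * 128\<close>, the 128 from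
  \<open>r \<le> 2 * p + 7\<close>; for smaller r the cubic bound leaves room.\<close>

lemma C_le_geometric:
  assumes u8: "u \<le> 1 / 8" and i: "i \<le> k" and r: "3 \<le> r"
  shows "C i r \<le> 2048 * u ^ 3 * (1 / 2) ^ r + 8 * 2 ^ r * \<delta>"
proof (cases "r \<le> 5")
  case True
  have "(1 / 2 :: real) ^ 5 \<le> (1 / 2) ^ r" using True by (intro power_decreasing) auto
  then have "2048 * u ^ 3 * (1 / 2) ^ 5 \<le> 2048 * u ^ 3 * (1 / 2) ^ r"
    using u_nonneg by (intro mult_left_mono) auto
  moreover have "0 \<le> 8 * 2 ^ r * \<delta>" "0 \<le> u ^ 3" using \<delta>_nonneg u_nonneg by auto
  moreover have "2048 * u ^ 3 * (1 / 2) ^ 5 = 64 * u ^ 3" by (simp add: power_divide)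
  ultimately show ?thesis using C_le_cubic[OF i r True] by linarith
next
  case False
  then have "3 \<le> r div 2" by linarith
  then obtain p where p: "r div 2 = 3 + p" using le_Suc_ex by blast
  have "(2 * u) ^ (3 + p) = 8 * u ^ 3 * (2 * u) ^ p" by (simp add: power_add power_mult_distrib)
  also have "\<dots> \<le> 8 * u ^ 3 * (1 / 4) ^ p"
    using u8 u_nonneg by (intro mult_left_mono power_mono) auto
  also have "(1 / 4 :: real) ^ p = (1 / 2) ^ (2 * p)" by (simp add: power_mult power_divide)
  also have "(1 / 2 :: real) ^ (2 * p) \<le> 128 * (1 / 2) ^ r"
  proof -
    have "r \<le> 2 * p + 7" using p by linarith
    then have "(1 / 2 :: real) ^ (2 * p + 7) \<le> (1 / 2) ^ r" by (intro power_decreasing) auto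
    then show ?thesis by (simp add: power_add power_divide)
  qed
  finally have "2 * (2 * u) ^ (r div 2) \<le> 2 * (8 * u ^ 3 * (128 * (1 / 2) ^ r))"
    using u_nonneg p by (simp add: mult_left_mono)
  then show ?thesis using C_le[OF _ i, of r] u8 by (simp add: mult_ac)
qed

section \<open>Second order expansion of the first two coefficients\<close>

definition "v i = expectation (\<lambda>x. (y i x)\<^sup>2)"
definition "cv i = expectation (\<lambda>x. y (i - 1) x * y i x)"
text \<open>Half of what block i adds to the variance if, among earlier blocks, only its neighbour
  is correlated with it.\<close>

definition "a i = v i / 2 + cv i"

lemma expectation_abs_mult_le:
  assumes "i \<le> k" "j \<le> k"
  shows "integrable M (\<lambda>x. \<bar>y i x\<bar> * \<bar>y j x\<bar>)" "expectation (\<lambda>x. \<bar>y i x\<bar> * \<bar>y j x\<bar>) \<le> lam\<^sup>2"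
proof -
  show int: "integrable M (\<lambda>x. \<bar>y i x\<bar> * \<bar>y j x\<bar>)"
    using integrable_abs[OF integrable_yy[OF assms]] by (simp add: abs_mult)
  have "a * b \<le> (a\<^sup>2 + b\<^sup>2) / 2" for a b :: real
    using zero_le_power2[of "a - b"] by (simp add: power2_diff)
  from this[of "\<bar>y i _\<bar>" "\<bar>y j _\<bar>"] have "expectation (\<lambda>x. \<bar>y i x\<bar> * \<bar>y j x\<bar>) \<le> expectation (\<lambda>x. (\<bar>y i x\<bar>\<^sup>2 + \<bar>y j x\<bar>\<^sup>2) / 2)"
    using assms by (intro integral_mono int) simp_all
  also have "\<dots> = (v i + v j) / 2" using assms by (simp add: v_def)
  also have "\<dots> \<le> lam\<^sup>2" using moment2[OF assms(1)] moment2[OF assms(2)] by (simp add: v_def)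
  finally show "expectation (\<lambda>x. \<bar>y i x\<bar> * \<bar>y j x\<bar>) \<le> lam\<^sup>2" .
qed

lemma abs_cv_le: "i \<le> k \<Longrightarrow> \<bar>cv i\<bar> \<le> lam\<^sup>2"
proof -
  assume i: "i \<le> k"
  have "norm (cv i) \<le> expectation (\<lambda>x. \<bar>y (i - 1) x\<bar> * \<bar>y i x\<bar>)"
    unfolding cv_def using i by (intro norm_integral_le expectation_abs_mult_le) (auto simp: abs_mult)
  then show ?thesis using expectation_abs_mult_le(2)[of "i - 1" i] i by (simp add: le_diff_conv)
qed

lemma a_le: "i \<le> k \<Longrightarrow> a i \<le> 3 / 2 * lam\<^sup>2"
  using abs_cv_le[of i] moment2[of i] by (simp add: a_def v_def)

text \<open>The linear term of the exponential has mean 0, so the quadratic one leads.\<close>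

lemma c1_approx: "i \<le> k \<Longrightarrow> norm (c i 1 + t\<^sup>2 * v i / 2) \<le> u ^ 3 / 6"
  and norm_c1: "i \<le> k \<Longrightarrow> norm (c i 1) \<le> u\<^sup>2"
proof -
  assume i: "i \<le> k"
  have iZ: "integrable M (Z i)" using norm_Z2 i by (intro integrable_bounded_complex[where a=2]) auto
  have iy: "integrable M (\<lambda>x. complex_of_real (y i x))" "expectation (\<lambda>x. complex_of_real (y i x)) = 0"
    using i y_mean[OF i] by (auto simp: integral_complex_of_real)
  have iy2: "integrable M (\<lambda>x. complex_of_real ((y i x)\<^sup>2))" "expectation (\<lambda>x. complex_of_real ((y i x)\<^sup>2)) = v i"
    using i by (auto simp: integral_complex_of_real v_def simp del: of_real_power)
  have c1: "c i 1 = expectation (Z i)" by (simp add: c_def ZP_def[abs_def])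
  have lin: "c i 1 = expectation (\<lambda>x. Z i x - \<i> * t * complex_of_real (y i x))"
    unfolding c1 using iZ iy by simp
  have "norm (c i 1) \<le> expectation (\<lambda>x. t\<^sup>2 / 2 * (y i x)\<^sup>2)"
    unfolding lin
  proof (rule norm_integral_le)
    fix x
    show "norm (Z i x - \<i> * t * complex_of_real (y i x)) \<le> t\<^sup>2 / 2 * (y i x)\<^sup>2"
      using norm_iexp_approx_linear[of "t * y i x"] by (simp add: Z_def e_def power_mult_distrib mult_ac)
  qed (use i in simp)
  also have "\<dots> = t\<^sup>2 / 2 * v i" by (simp add: v_def)
  also have "\<dots> \<le> t\<^sup>2 / 2 * lam\<^sup>2" using moment2[OF i] by (intro mult_left_mono) (auto simp: v_def)
  also have "\<dots> \<le> u\<^sup>2" by (simp add: u_def power_mult_distrib)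
  finally show "norm (c i 1) \<le> u\<^sup>2" .
  have "c i 1 + t\<^sup>2 * v i / 2 = expectation (\<lambda>x. Z i x - \<i> * t * complex_of_real (y i x) + t\<^sup>2 / 2 * complex_of_real ((y i x)\<^sup>2))"
    unfolding c1 using iZ iy iy2 by (simp del: of_real_power)
  also have "norm \<dots> \<le> expectation (\<lambda>x. \<bar>t\<bar> ^ 3 / 6 * \<bar>y i x\<bar> ^ 3)"
  proof (rule norm_integral_le)
    fix x
    show "norm (Z i x - \<i> * t * complex_of_real (y i x) + t\<^sup>2 / 2 * complex_of_real ((y i x)\<^sup>2)) \<le> \<bar>t\<bar> ^ 3 / 6 * \<bar>y i x\<bar> ^ 3"
      using norm_iexp_approx_quadratic[of "t * y i x"] by (simp add: Z_def e_def power_mult_distrib abs_mult mult_ac)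
  qed (use i in simp)
  also have "\<dots> = \<bar>t\<bar> ^ 3 / 6 * expectation (\<lambda>x. \<bar>y i x\<bar> ^ 3)" by simp
  also have "\<dots> \<le> \<bar>t\<bar> ^ 3 / 6 * lam ^ 3" by (intro mult_left_mono moment3 i) simp
  finally show "norm (c i 1 + t\<^sup>2 * v i / 2) \<le> u ^ 3 / 6" by (simp add: u_def power_mult_distrib)
qed

text \<open>The linear parts of the two factors multiply to \<open>- t^2 * y i * y (i - 1)\<close>,
  whose mean is the adjacent covariance up to the factor \<open>- t^2\<close>. Replacing one factor
  after the other by its linear part costs third order.\<close>

lemma c2_approx: "i \<le> k \<Longrightarrow> norm (c i 2 + t\<^sup>2 * cv i) \<le> 2 * u ^ 3"
  and norm_c2: "i \<le> k \<Longrightarrow> norm (c i 2) \<le> u\<^sup>2"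
proof -
  assume i: "i \<le> k"
  then have i': "i - 1 \<le> k" by simp
  have ZP2: "ZP i 2 x = Z i x * Z (i - 1) x" for x by (simp add: ZP_def eval_nat_numeral)
  have iZ: "integrable M (ZP i 2)" by (rule integrable_bounded_complex[OF ZP_M[OF i] norm_ZP_le])
  have iyy: "integrable M (\<lambda>x. complex_of_real (y (i - 1) x * y i x))"
     "expectation (\<lambda>x. complex_of_real (y (i - 1) x * y i x)) = cv i"
    using integrable_yy[OF i' i] by (auto simp: integral_complex_of_real cv_def simp del: of_real_mult)
  have "norm (c i 2) \<le> expectation (\<lambda>x. t\<^sup>2 * (\<bar>y i x\<bar> * \<bar>y (i - 1) x\<bar>))"
    unfolding c_def
  proof (rule norm_integral_le)
    fix x
    have "norm (ZP i 2 x) \<le> (\<bar>t\<bar> * \<bar>y i x\<bar>) * (\<bar>t\<bar> * \<bar>y (i - 1) x\<bar>)"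
      unfolding ZP2 norm_mult by (intro mult_mono norm_Z1) auto
    then show "norm (ZP i 2 x) \<le> t\<^sup>2 * (\<bar>y i x\<bar> * \<bar>y (i - 1) x\<bar>)"
      by (simp add: power2_eq_square mult_ac)
  qed (use expectation_abs_mult_le(1)[OF i i'] in simp)
  also have "\<dots> = t\<^sup>2 * expectation (\<lambda>x. \<bar>y i x\<bar> * \<bar>y (i - 1) x\<bar>)" by simp
  also have "\<dots> \<le> t\<^sup>2 * lam\<^sup>2" by (intro mult_left_mono expectation_abs_mult_le i i') auto
  also have "\<dots> = u\<^sup>2" by (simp add: u_def power_mult_distrib)
  finally show "norm (c i 2) \<le> u\<^sup>2" .
  have "c i 2 + t\<^sup>2 * cv i = expectation (\<lambda>x. ZP i 2 x + t\<^sup>2 * complex_of_real (y (i - 1) x * y i x))"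
    unfolding c_def using iZ iyy by (simp del: of_real_mult) simp
  also have "norm \<dots> \<le> expectation (\<lambda>x. \<bar>t\<bar> ^ 3 * (\<bar>y i x\<bar> ^ 3 + \<bar>y (i - 1) x\<bar> ^ 3))"
  proof (rule norm_integral_le)
    fix x
    define p where "p = y i x"
    define q where "q = y (i - 1) x"
    have Zp: "norm (Z i x - \<i> * t * p) \<le> t\<^sup>2 * p\<^sup>2 / 2" "norm (Z (i - 1) x - \<i> * t * q) \<le> t\<^sup>2 * q\<^sup>2 / 2"
      using norm_iexp_approx_linear[of "t * p"] norm_iexp_approx_linear[of "t * q"]
      by (simp_all add: Z_def e_def p_def q_def power_mult_distrib mult_ac)
    have Zq: "norm (Z (i - 1) x) \<le> \<bar>t\<bar> * \<bar>q\<bar>" unfolding q_def by (rule norm_Z1)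
    have "ZP i 2 x + t\<^sup>2 * complex_of_real (q * p)
        = (Z i x - \<i> * t * p) * Z (i - 1) x + \<i> * t * p * (Z (i - 1) x - \<i> * t * q)"
      by (simp add: ZP2 algebra_simps power2_eq_square)
    also have "norm \<dots> \<le> (t\<^sup>2 * p\<^sup>2 / 2) * (\<bar>t\<bar> * \<bar>q\<bar>) + (\<bar>t\<bar> * \<bar>p\<bar>) * (t\<^sup>2 * q\<^sup>2 / 2)"
    proof (intro order_trans[OF norm_triangle_ineq] add_mono)
      show "norm ((Z i x - \<i> * t * p) * Z (i - 1) x) \<le> (t\<^sup>2 * p\<^sup>2 / 2) * (\<bar>t\<bar> * \<bar>q\<bar>)"
        unfolding norm_mult[of "Z i x - \<i> * t * p"] by (intro mult_mono Zp Zq) auto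
      have "norm (\<i> * t * p) = \<bar>t\<bar> * \<bar>p\<bar>" by (simp add: norm_mult)
      then show "norm (\<i> * t * p * (Z (i - 1) x - \<i> * t * q)) \<le> (\<bar>t\<bar> * \<bar>p\<bar>) * (t\<^sup>2 * q\<^sup>2 / 2)"
        unfolding norm_mult[of "\<i> * t * p"] by (simp only:) (intro mult_left_mono Zp, simp)
    qed
    also have "\<dots> = \<bar>t\<bar> ^ 3 * ((\<bar>p\<bar> ^ 2 * \<bar>q\<bar> + \<bar>p\<bar> * \<bar>q\<bar>\<^sup>2) / 2)"
    proof -
      have "t\<^sup>2 = \<bar>t\<bar>\<^sup>2" "p\<^sup>2 = \<bar>p\<bar>\<^sup>2" "q\<^sup>2 = \<bar>q\<bar>\<^sup>2" by auto
      then show ?thesis by (simp only: power3_eq_cube power2_eq_square) (simp add: algebra_simps del: abs_mult_self_eq)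
    qed
    also have "\<dots> \<le> \<bar>t\<bar> ^ 3 * (\<bar>p\<bar> ^ 3 + \<bar>q\<bar> ^ 3)"
    proof (intro mult_left_mono)
      define m where "m = max \<bar>p\<bar> \<bar>q\<bar>"
      have "\<bar>p\<bar> ^ 2 * \<bar>q\<bar> \<le> m ^ 2 * m" "\<bar>p\<bar> * \<bar>q\<bar>\<^sup>2 \<le> m * m\<^sup>2"
        unfolding m_def by (intro mult_mono power_mono; simp)+
      then have "(\<bar>p\<bar> ^ 2 * \<bar>q\<bar> + \<bar>p\<bar> * \<bar>q\<bar>\<^sup>2) / 2 \<le> (m ^ 2 * m + m * m\<^sup>2) / 2"
        by (intro divide_right_mono add_mono) simp_all
      also have "\<dots> = m ^ 3" by (simp add: power3_eq_cube power2_eq_square)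
      also have "m ^ 3 \<le> \<bar>p\<bar> ^ 3 + \<bar>q\<bar> ^ 3" by (auto simp: m_def max_def)
      finally show "(\<bar>p\<bar> ^ 2 * \<bar>q\<bar> + \<bar>p\<bar> * \<bar>q\<bar>\<^sup>2) / 2 \<le> \<bar>p\<bar> ^ 3 + \<bar>q\<bar> ^ 3" .
    qed simp
    finally show "norm (ZP i 2 x + t\<^sup>2 * complex_of_real (y (i - 1) x * y i x)) \<le> \<bar>t\<bar> ^ 3 * (\<bar>y i x\<bar> ^ 3 + \<bar>y (i - 1) x\<bar> ^ 3)"
      by (simp add: p_def q_def)
  qed (use i i' in simp)
  also have "\<dots> = \<bar>t\<bar> ^ 3 * (expectation (\<lambda>x. \<bar>y i x\<bar> ^ 3) + expectation (\<lambda>x. \<bar>y (i - 1) x\<bar> ^ 3))"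
    using i i' by simp
  also have "\<dots> \<le> \<bar>t\<bar> ^ 3 * (lam ^ 3 + lam ^ 3)" by (intro mult_left_mono add_mono moment3 i i') simp
  finally show "norm (c i 2 + t\<^sup>2 * cv i) \<le> 2 * u ^ 3" by (simp add: u_def power_mult_distrib)
qed

section \<open>Comparison with a Gaussian\<close>

definition "A i = (\<Sum>j\<in>{1..i}. a j)"
definition "G i = exp (- t\<^sup>2 * A i)"

text \<open>By \<open>a_lower\<close> every block adds a fixed fraction of \<open>lam^2\<close>,
  which gives the contraction. The relative increment \<open>- t^2 * a i\<close> of G agrees with
  \<open>c i 1 + c i 2\<close> up to order \<open>u^3\<close>, so \<open>F - G\<close> obeys the
  stable recursion. The bound on u is its smallness condition
  \<open>(4 + 2 * 2048) * u \<le> c0 / 8\<close>.\<close>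

lemma char_approx:
  assumes c0: "0 < c0" "c0 \<le> 3 / 4" and a_lower: "\<And>i. 1 \<le> i \<Longrightarrow> i \<le> k \<Longrightarrow> 2 * c0 * lam\<^sup>2 \<le> a i"
    and u: "0 < u" "u \<le> c0 / 32800" and \<nu>: "2 \<le> \<nu>"
  shows "norm (F k - G k) \<le> 50000 / c0 * u * exp (- (c0 * u\<^sup>2 / 2) * k)
      + 10 * (96 * 2 ^ \<nu> * \<delta> + 2 * (2 * u) ^ (Suc \<nu> div 2)) * k"
proof -
  have u1: "u \<le> 1 / 40000" using u c0 by simp
  have u3: "u ^ 3 \<ge> 0" "u\<^sup>2 \<ge> 0" using u by auto
  have u4: "u\<^sup>2 * u\<^sup>2 \<le> u ^ 3 / 40000"
    using mult_left_mono[OF u1 u3(1)] by (simp add: eval_nat_numeral mult_ac)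
  have u2: "u\<^sup>2 \<le> 1 / 40000"
    using mult_mono[OF u1 u1] u by (simp add: power2_eq_square)
  have u32: "3 * u ^ 3 \<le> c0 * u\<^sup>2"
  proof -
    have "3 * u ^ 3 = 3 * u * u\<^sup>2" by (simp add: eval_nat_numeral)
    also have "\<dots> \<le> c0 * u\<^sup>2" using u c0 by (intro mult_right_mono) auto
    finally show ?thesis .
  qed
  have tl: "t\<^sup>2 * lam\<^sup>2 = u\<^sup>2" by (simp add: u_def power_mult_distrib)
  have ta: "2 * c0 * u\<^sup>2 \<le> t\<^sup>2 * a i" "t\<^sup>2 * a i \<le> 3 / 2 * u\<^sup>2" if "1 \<le> i" "i \<le> k" for i
  proof -
    have "t\<^sup>2 * (2 * c0 * lam\<^sup>2) \<le> t\<^sup>2 * a i" by (intro mult_left_mono a_lower that) simp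
    then show "2 * c0 * u\<^sup>2 \<le> t\<^sup>2 * a i" using tl by (simp add: mult_ac)
    have "t\<^sup>2 * a i \<le> t\<^sup>2 * (3 / 2 * lam\<^sup>2)" by (intro mult_left_mono a_le that) simp
    then show "t\<^sup>2 * a i \<le> 3 / 2 * u\<^sup>2" using tl by (simp add: mult_ac)
  qed
  have G0: "0 < G i" for i by (simp add: G_def)
  have G_Suc: "G i = G (i - 1) * exp (- (t\<^sup>2 * a i))" if "1 \<le> i" for i
  proof -
    have "{1..i} = insert i {1..i - 1}" using that by auto
    then have "A i = A (i - 1) + a i" using that by (simp add: A_def)
    then show ?thesis by (simp add: G_def exp_add[symmetric] algebra_simps)
  qed
  have G_decay: "G i \<le> exp (- (2 * c0 * u\<^sup>2) * i)" if "i \<le> k" for i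
    using that
  proof (induction i)
    case (Suc i)
    have "G (Suc i) = G i * exp (- (t\<^sup>2 * a (Suc i)))" using G_Suc[of "Suc i"] by simp
    also have "\<dots> \<le> exp (- (2 * c0 * u\<^sup>2) * i) * exp (- (2 * c0 * u\<^sup>2))"
      using Suc ta(1)[of "Suc i"] by (intro mult_mono) auto
    finally show ?case by (simp add: exp_add[symmetric] algebra_simps)
  qed (simp add: G_def A_def)
  have G1: "G i \<le> 1" if "i \<le> k" for i
  proof -
    have "- (2 * c0 * u\<^sup>2) * i \<le> 0" using c0 by simp
    then have "exp (- (2 * c0 * u\<^sup>2) * i) \<le> 1" by (simp only: exp_le_one_iff)
    with G_decay[OF that] show ?thesis by (rule order_trans)
  qed
  have Grat: "G (i - (r + 1)) \<le> G (i - 1) * exp (3 / 2 * u\<^sup>2 * r)" "G (i - 1) \<le> G (i - (r + 1))"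
    if "i \<le> k" for i r
    using that
  proof (induction r)
    case (Suc r)
    have step: "G (m - 1) \<le> G m * exp (3 / 2 * u\<^sup>2) \<and> G m \<le> G (m - 1)" if m: "m \<le> k" for m
    proof (cases "m = 0")
      case True
      then show ?thesis using G0[of 0] by simp
    next
      case False
      define z where "z = 3 / 2 * u\<^sup>2"
      define X where "X = t\<^sup>2 * a m"
      have Gm: "G m = G (m - 1) * exp (- X)" using G_Suc[of m] False by (simp add: X_def)
      have X: "0 \<le> X" "X \<le> z"
        using ta[of m] m False c0 by (auto simp: X_def z_def intro: order_trans[of _ "2 * c0 * u\<^sup>2"])
      have "G m * exp z = G (m - 1) * exp (z - X)"
        unfolding Gm mult.assoc mult_exp_exp by (simp add: algebra_simps)
      moreover have "G (m - 1) * 1 \<le> G (m - 1) * exp (z - X)" "G (m - 1) * exp (- X) \<le> G (m - 1) * 1"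
        using X G0[of "m - 1"] by (intro mult_left_mono; simp)+
      ultimately show ?thesis unfolding z_def[symmetric] using Gm by linarith
    qed
    {
      case 1
      have "i - (Suc r + 1) = i - (r + 1) - 1" by simp
      then have "G (i - (Suc r + 1)) \<le> G (i - (r + 1)) * exp (3 / 2 * u\<^sup>2)"
        using step[of "i - (r + 1)"] 1 by simp
      also have "\<dots> \<le> G (i - 1) * exp (3 / 2 * u\<^sup>2 * r) * exp (3 / 2 * u\<^sup>2)"
        using Suc.IH 1 by (intro mult_right_mono) auto
      also have "\<dots> = G (i - 1) * exp (3 / 2 * u\<^sup>2 * Suc r)"
        by (simp add: exp_add[symmetric] mult.assoc distrib_left)
      finally show ?case .
    next
      case 2
      have "i - (Suc r + 1) = i - (r + 1) - 1" by simp
      moreover have "i - (r + 1) \<le> k" using 2 by linarith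
      ultimately show ?case using step[of "i - (r + 1)"] Suc.IH(2) 2 by simp
    }
  qed auto
  define E where "E i = F i - G i" for i
  define \<tau> where "\<tau> i = E i - (E (i - 1) + c i 1 * E (i - 2) + c i 2 * E (i - 3))" for i
  \<comment> \<open>The 96 consists of 32 and 16 from the coefficients with \<open>r \<ge> 3\<close>
    applied to E and to G, and of 32 and 16 from the remainder of the expansion.\<close>
  define \<eta> where "\<eta> = 96 * 2 ^ \<nu> * \<delta> + 2 * (2 * u) ^ (Suc \<nu> div 2)"
  have \<eta>0: "0 \<le> \<eta>" using \<delta>_nonneg u by (simp add: \<eta>_def)
  have sum2: "(\<Sum>r\<in>{3..\<nu>}. (2::real) ^ r) \<le> 2 * 2 ^ \<nu>"
  proof -
    have "(\<Sum>r\<in>{3..\<nu>}. (2::real) ^ r) \<le> (\<Sum>r<Suc \<nu>. 2 ^ r)" by (intro sum_mono2) auto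
    also have "\<dots> \<le> 2 ^ Suc \<nu>" by (subst sum_gp_strict) simp
    finally show ?thesis by simp
  qed
  have C3: "norm (c i r) \<le> 2048 * u ^ 3 * (1 / 2) ^ r + 8 * 2 ^ r * \<delta>" if "i \<le> k" "3 \<le> r" for i r
    using norm_c_le_C[of i r] C_le_geometric[OF _ that] u1 by simp
  have \<tau>_bound: "norm (\<tau> i) \<le> 2048 * u ^ 3 * (\<Sum>r\<in>{3..\<nu>}. (1 / 2) ^ r * norm (E (i - (r + 1))))
      + 4108 * u ^ 3 * exp (- (c0 * u\<^sup>2 / 2) * i) + \<eta>" if i: "1 \<le> i" "i \<le> k" for i
  proof -
    have E2: "norm (E j) \<le> 2" if "j \<le> k" for j
      using norm_triangle_ineq4[of "F j" "complex_of_real (G j)"] norm_F[of j] G1[OF that] G0[of j] by (simp add: E_def)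
    define rem where "rem = F i - F (i - 1) - (\<Sum>r\<in>{1..\<nu>}. c i r * F (i - (r + 1)))"
    have s12: "(\<Sum>r\<in>{1..\<nu>}. f r) = f 1 + f 2 + (\<Sum>r\<in>{3..\<nu>}. f r)" for f :: "nat \<Rightarrow> complex"
    proof -
      have "{1..\<nu>} = insert 1 (insert 2 {3..\<nu>})" using \<nu> by auto
      then show ?thesis by (simp add: add.assoc)
    qed
    \<comment> \<open>The defect of the Gaussian in the recursion cut after its first two
      coefficients.\<close>
    define Gp where "Gp = G i - G (i - 1) - c i 1 * G (i - 2) - c i 2 * G (i - 3)"
    have dec: "\<tau> i = (\<Sum>r\<in>{3..\<nu>}. c i r * E (i - (r + 1))) + (\<Sum>r\<in>{3..\<nu>}. c i r * G (i - (r + 1))) + rem - Gp"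
    proof -
      have "(\<Sum>r\<in>{3..\<nu>}. c i r * E (i - (r + 1))) + (\<Sum>r\<in>{3..\<nu>}. c i r * G (i - (r + 1)))
         = (\<Sum>r\<in>{3..\<nu>}. c i r * F (i - (r + 1)))"
        by (simp add: sum.distrib[symmetric] E_def algebra_simps)
      moreover have "(\<Sum>r\<in>{1..\<nu>}. c i r * F (i - (r + 1)))
         = c i 1 * F (i - 2) + c i 2 * F (i - 3) + (\<Sum>r\<in>{3..\<nu>}. c i r * F (i - (r + 1)))"
        using s12[of "\<lambda>r. c i r * F (i - (r + 1))"] by (simp add: numeral_2_eq_2 numeral_3_eq_3)
      ultimately show ?thesis
        unfolding rem_def Gp_def \<tau>_def by (simp only:) (simp add: E_def algebra_simps)
    qed
    have b1: "norm (\<Sum>r\<in>{3..\<nu>}. c i r * E (i - (r + 1)))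
        \<le> 2048 * u ^ 3 * (\<Sum>r\<in>{3..\<nu>}. (1 / 2) ^ r * norm (E (i - (r + 1)))) + 32 * 2 ^ \<nu> * \<delta>"
    proof -
      have "norm (\<Sum>r\<in>{3..\<nu>}. c i r * E (i - (r + 1)))
          \<le> (\<Sum>r\<in>{3..\<nu>}. 2048 * u ^ 3 * ((1 / 2) ^ r * norm (E (i - (r + 1)))) + 16 * \<delta> * 2 ^ r)"
      proof (rule sum_norm_le)
        fix r assume r: "r \<in> {3..\<nu>}"
        have "norm (c i r * E (i - (r + 1))) \<le> (2048 * u ^ 3 * (1 / 2) ^ r + 8 * 2 ^ r * \<delta>) * norm (E (i - (r + 1)))"
          unfolding norm_mult using r i by (intro mult_right_mono C3) auto
        moreover have "8 * 2 ^ r * \<delta> * norm (E (i - (r + 1))) \<le> 8 * 2 ^ r * \<delta> * 2"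
          using \<delta>_nonneg i by (intro mult_left_mono E2) auto
        ultimately show "norm (c i r * E (i - (r + 1)))
           \<le> 2048 * u ^ 3 * ((1 / 2) ^ r * norm (E (i - (r + 1)))) + 16 * \<delta> * 2 ^ r"
          by (simp add: algebra_simps)
      qed
      also have "\<dots> = 2048 * u ^ 3 * (\<Sum>r\<in>{3..\<nu>}. (1 / 2) ^ r * norm (E (i - (r + 1)))) + 16 * \<delta> * (\<Sum>r\<in>{3..\<nu>}. 2 ^ r)"
        by (simp add: sum.distrib sum_distrib_left)
      also have "16 * \<delta> * (\<Sum>r\<in>{3..\<nu>}. 2 ^ r) \<le> 16 * \<delta> * (2 * 2 ^ \<nu>)"
        using \<delta>_nonneg by (intro mult_left_mono sum2) auto
      finally show ?thesis by (simp add: mult_ac)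
    qed
    have b2: "norm (\<Sum>r\<in>{3..\<nu>}. c i r * G (i - (r + 1))) \<le> 2048 * u ^ 3 * G (i - 1) + 16 * 2 ^ \<nu> * \<delta>"
    proof -
      have "norm (\<Sum>r\<in>{3..\<nu>}. c i r * G (i - (r + 1)))
          \<le> (\<Sum>r\<in>{3..\<nu>}. 2048 * u ^ 3 * G (i - 1) * ((1 / 2) ^ r * (5 / 4) ^ (r + 1)) + 8 * \<delta> * 2 ^ r)"
      proof (rule sum_norm_le)
        fix r assume r: "r \<in> {3..\<nu>}"
        have "exp (3 / 2 * u\<^sup>2 * r) = exp (3 / 2 * u\<^sup>2) ^ r" by (rule exp_of_nat2_mult)
        also have "\<dots> \<le> (5 / 4) ^ r"
        proof (rule power_mono)
          have "exp (3 / 2 * u\<^sup>2) \<le> 1 + 3 / 2 * u\<^sup>2 + (3 / 2 * u\<^sup>2)\<^sup>2" using u2 u by (intro exp_bound) auto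
          also have "(3 / 2 * u\<^sup>2)\<^sup>2 \<le> 3 / 2 * u\<^sup>2 * 1"
            unfolding power2_eq_square[of "3 / 2 * u\<^sup>2"] using u2 by (intro mult_left_mono) auto
          finally show "exp (3 / 2 * u\<^sup>2) \<le> 5 / 4" using u2 by linarith
        qed simp
        also have "\<dots> \<le> (5 / 4) ^ (r + 1)" by simp
        finally have "G (i - (r + 1)) \<le> G (i - 1) * (5 / 4) ^ (r + 1)"
          using Grat(1)[OF i(2), of r] G0[of "i - 1"] by (meson less_imp_le mult_left_mono order_trans)
        then have "2048 * u ^ 3 * (1 / 2) ^ r * G (i - (r + 1)) \<le> 2048 * u ^ 3 * (1 / 2) ^ r * (G (i - 1) * (5 / 4) ^ (r + 1))"
          using u by (intro mult_left_mono) auto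
        moreover have "8 * 2 ^ r * \<delta> * G (i - (r + 1)) \<le> 8 * 2 ^ r * \<delta> * 1"
          using \<delta>_nonneg i by (intro mult_left_mono G1) auto
        moreover have "norm (c i r * G (i - (r + 1))) \<le> (2048 * u ^ 3 * (1 / 2) ^ r + 8 * 2 ^ r * \<delta>) * G (i - (r + 1))"
          using C3[OF i(2), of r] r G0[of "i - (r + 1)"] by (simp add: norm_mult mult_right_mono)
        ultimately show "norm (c i r * G (i - (r + 1)))
           \<le> 2048 * u ^ 3 * G (i - 1) * ((1 / 2) ^ r * (5 / 4) ^ (r + 1)) + 8 * \<delta> * 2 ^ r"
          by (simp add: algebra_simps)
      qed
      also have "\<dots> = 2048 * u ^ 3 * G (i - 1) * (\<Sum>r\<in>{3..\<nu>}. (1 / 2) ^ r * (5 / 4) ^ (r + 1)) + 8 * \<delta> * (\<Sum>r\<in>{3..\<nu>}. 2 ^ r)"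
        by (simp add: sum.distrib sum_distrib_left)
      also have "\<dots> \<le> 2048 * u ^ 3 * G (i - 1) * 1 + 8 * \<delta> * (2 * 2 ^ \<nu>)"
        using \<delta>_nonneg u G0[of "i - 1"] by (intro add_mono mult_left_mono sum2 geometric_tail_le) auto
      finally show ?thesis by (simp add: mult_ac)
    qed
    have b3: "norm rem \<le> 32 * 2 ^ \<nu> * \<delta> + (2 * (2 * u) ^ (Suc \<nu> div 2) + 8 * 2 ^ Suc \<nu> * \<delta>)"
      using norm_recursion_remainder[OF i, of \<nu>] C_le[OF _ i(2), of "Suc \<nu>"] u1
      unfolding rem_def Suc_eq_plus1[symmetric] by linarith
    have b4: "norm Gp \<le> 6 * u ^ 3 * G (i - 1)"
    proof -
      define x where "x = t\<^sup>2 * a i"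
      have x: "0 \<le> x" "x \<le> 3 / 2 * u\<^sup>2" using ta[OF i] c0 by (auto simp: x_def intro: order_trans[of _ "2 * c0 * u\<^sup>2"])
      have G2: "\<bar>G (i - (r + 1)) - G (i - 1)\<bar> \<le> G (i - 1) * (3 * u\<^sup>2 * r)" if "r \<le> 2" for r
      proof -
        have z: "3 / 2 * u\<^sup>2 * r \<le> 1" "0 \<le> 3 / 2 * u\<^sup>2 * r"
          using mult_mono[of "3 / 2 * u\<^sup>2" "1 / 2" "real r" 2] u2 that by auto
        have "exp (3 / 2 * u\<^sup>2 * r) \<le> 1 + 3 / 2 * u\<^sup>2 * r + (3 / 2 * u\<^sup>2 * r)\<^sup>2"
          using z by (intro exp_bound) auto
        also have "(3 / 2 * u\<^sup>2 * r)\<^sup>2 \<le> 3 / 2 * u\<^sup>2 * r * 1"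
          unfolding power2_eq_square[of "3 / 2 * u\<^sup>2 * r"] using z by (intro mult_left_mono) auto
        finally have "exp (3 / 2 * u\<^sup>2 * r) - 1 \<le> 3 * u\<^sup>2 * r" by (simp add: mult_ac)
        then have "G (i - 1) * (exp (3 / 2 * u\<^sup>2 * r) - 1) \<le> G (i - 1) * (3 * u\<^sup>2 * r)"
          using G0[of "i - 1"] by (intro mult_left_mono) auto
        then show ?thesis using Grat[OF i(2), of r] by (simp add: right_diff_distrib)
      qed
      have e1: "\<bar>exp (- x) - 1 + x\<bar> \<le> x\<^sup>2"
      proof -
        have "1 \<le> (1 - x + x\<^sup>2) * (1 + x)" using x by (simp add: algebra_simps power2_eq_square)
        also have "\<dots> \<le> (1 - x + x\<^sup>2) * exp x"
          using x u2 exp_ge_add_one_self[of x] by (intro mult_left_mono) auto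
        finally have "exp (- x) \<le> 1 - x + x\<^sup>2" by (simp add: exp_minus field_simps)
        then show ?thesis using exp_ge_add_one_self[of "- x"] by simp
      qed
      have x2: "x\<^sup>2 \<le> 9 / 4 * (u\<^sup>2 * u\<^sup>2)"
        using mult_mono[OF x(2) x(2)] x by (simp add: power2_eq_square mult_ac)
      have "i - (1 + 1) = i - 2" "i - (2 + 1) = i - 3" by auto
      then have g1: "\<bar>G (i - 2) - G (i - 1)\<bar> \<le> G (i - 1) * (3 * u\<^sup>2)"
        and g2: "\<bar>G (i - 3) - G (i - 1)\<bar> \<le> G (i - 1) * (6 * u\<^sup>2)"
        using G2[of 1] G2[of 2] by simp_all
      have ring: "g * p + r / 6 * g + 2 * r * g + s * (g * (3 * s)) + s * (g * (6 * s))
          = g * (p + r / 6 + 2 * r + 9 * (s * s))" for g p r s :: real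
        by (simp add: algebra_simps)
      \<comment> \<open>The second order terms have cancelled: each summand carries a third order
        factor or a product of two second order ones.\<close>
      have Gp_eq: "Gp = complex_of_real (G (i - 1) * (exp (- x) - 1 + x)) - (c i 1 + t\<^sup>2 * v i / 2) * G (i - 1)
          - (c i 2 + t\<^sup>2 * cv i) * G (i - 1) - c i 1 * complex_of_real (G (i - 2) - G (i - 1)) - c i 2 * complex_of_real (G (i - 3) - G (i - 1))"
        using G_Suc[OF i(1)] by (simp add: Gp_def x_def a_def algebra_simps)
      have "norm Gp \<le> G (i - 1) * x\<^sup>2 + u ^ 3 / 6 * G (i - 1) + 2 * u ^ 3 * G (i - 1)
          + u\<^sup>2 * (G (i - 1) * (3 * u\<^sup>2)) + u\<^sup>2 * (G (i - 1) * (6 * u\<^sup>2))"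
        unfolding Gp_eq
      proof (rule norm_diff5_le)
        show "norm (complex_of_real (G (i - 1) * (exp (- x) - 1 + x))) \<le> G (i - 1) * x\<^sup>2"
          unfolding norm_of_real abs_mult using e1 G0[of "i - 1"] by (intro mult_mono) auto
        show "norm ((c i 1 + t\<^sup>2 * v i / 2) * G (i - 1)) \<le> u ^ 3 / 6 * G (i - 1)"
          unfolding norm_mult using c1_approx[OF i(2)] G0[of "i - 1"] u by (intro mult_mono) auto
        show "norm ((c i 2 + t\<^sup>2 * cv i) * G (i - 1)) \<le> 2 * u ^ 3 * G (i - 1)"
          unfolding norm_mult using c2_approx[OF i(2)] G0[of "i - 1"] u by (intro mult_mono) auto
        show "norm (c i 1 * complex_of_real (G (i - 2) - G (i - 1))) \<le> u\<^sup>2 * (G (i - 1) * (3 * u\<^sup>2))"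
          unfolding norm_mult norm_of_real using norm_c1[OF i(2)] g1 by (intro mult_mono) auto
        show "norm (c i 2 * complex_of_real (G (i - 3) - G (i - 1))) \<le> u\<^sup>2 * (G (i - 1) * (6 * u\<^sup>2))"
          unfolding norm_mult norm_of_real using norm_c2[OF i(2)] g2 by (intro mult_mono) auto
      qed
      also have "\<dots> = G (i - 1) * (x\<^sup>2 + u ^ 3 / 6 + 2 * u ^ 3 + 9 * (u\<^sup>2 * u\<^sup>2))" by (rule ring)
      also have "\<dots> \<le> G (i - 1) * (6 * u ^ 3)"
      proof (rule mult_left_mono)
        show "x\<^sup>2 + u ^ 3 / 6 + 2 * u ^ 3 + 9 * (u\<^sup>2 * u\<^sup>2) \<le> 6 * u ^ 3" using x2 u4 u3(1) by linarith
      qed (use G0[of "i - 1"] in simp)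
      finally show ?thesis by (simp add: mult_ac)
    qed
    \<comment> \<open>The Gaussian even decays at four times this rate; the shift from
      \<open>i - 1\<close> to i costs \<open>exp (c0 * u^2 / 2)\<close>, which is at most 2.\<close>
    have Gi: "G (i - 1) \<le> 2 * exp (- (c0 * u\<^sup>2 / 2) * i)"
    proof -
      have "G (i - 1) \<le> exp (- (2 * c0 * u\<^sup>2) * (i - 1))" using i by (intro G_decay) auto
      also have "\<dots> \<le> exp (c0 * u\<^sup>2 / 2 - (c0 * u\<^sup>2 / 2) * i)"
      proof -
        define z where "z = c0 * u\<^sup>2 / 2"
        have z: "0 \<le> z" using c0 by (simp add: z_def)
        have e: "- (2 * c0 * u\<^sup>2) * (i - 1) = - (4 * z * (real i - 1))"
          "c0 * u\<^sup>2 / 2 - (c0 * u\<^sup>2 / 2) * i = - (z * (real i - 1))"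
          using i by (simp_all add: z_def of_nat_diff field_simps)
        have "0 \<le> z * (real i - 1)" using z i by simp
        then show ?thesis unfolding e exp_le_cancel_iff by linarith
      qed
      also have "\<dots> = exp (c0 * u\<^sup>2 / 2) * exp (- (c0 * u\<^sup>2 / 2) * i)" by (simp add: exp_add[symmetric])
      also have "exp (c0 * u\<^sup>2 / 2) \<le> 2"
      proof -
        have "c0 * u\<^sup>2 / 2 \<le> 1 * (1 / 40000) / 2"
          using c0 u2 by (intro divide_right_mono mult_mono) auto
        then have "exp (c0 * u\<^sup>2 / 2) \<le> exp (1 / 2)" by simp
        also have "\<dots> \<le> 1 + 1 / 2 + (1 / 2)\<^sup>2" by (rule exp_bound) auto
        finally show ?thesis by (simp add: power2_eq_square)
      qed
      finally show ?thesis by simp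
    qed
    have "norm (\<tau> i) \<le> norm (\<Sum>r\<in>{3..\<nu>}. c i r * E (i - (r + 1))) + norm (\<Sum>r\<in>{3..\<nu>}. c i r * G (i - (r + 1))) + norm rem + norm Gp"
      unfolding dec by (intro order_trans[OF norm_triangle_ineq4] order_trans[OF norm_triangle_ineq] add_mono order_refl)
    moreover have "2054 * u ^ 3 * G (i - 1) \<le> 2054 * u ^ 3 * (2 * exp (- (c0 * u\<^sup>2 / 2) * i))"
      using Gi u by (intro mult_left_mono) auto
    ultimately show ?thesis using b1 b2 b3 b4 by (simp add: \<eta>_def algebra_simps)
  qed
  \<comment> \<open>The 4108 is \<open>2 * (2048 + 6)\<close>: the coefficients with
    \<open>r \<ge> 3\<close> and the defect of the Gaussian, doubled by the shift of the
    index.\<close>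
  have "norm (E k) \<le> 12 * 4108 / c0 * u * exp (- (c0 * u\<^sup>2 / 2) * k) + 10 * \<eta> * k"
  proof (rule recursion_stability[where E=E and \<tau>=\<tau> and k=k and ?c1.0="\<lambda>i. c i 1" and ?c2.0="\<lambda>i. c i 2" and Q=2048 and m=\<nu>])
    show "E 0 = 0" using prob_space by (simp add: E_def F_def G_def A_def)
    show "E i = E (i - 1) + c i 1 * E (i - 2) + c i 2 * E (i - 3) + \<tau> i" for i by (simp add: \<tau>_def)
    show "norm (c i 1) \<le> u\<^sup>2" "norm (c i 2) \<le> u\<^sup>2" if "i \<le> k" for i using norm_c1 norm_c2 that by auto
    show "norm (1 + c i 1 + c i 2) \<le> 1 - c0 * u\<^sup>2" if i: "1 \<le> i" "i \<le> k" for i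
    proof -
      have "1 + c i 1 + c i 2 = complex_of_real (1 - t\<^sup>2 * a i) + (c i 1 + t\<^sup>2 * v i / 2) + (c i 2 + t\<^sup>2 * cv i)"
        by (simp add: a_def algebra_simps)
      also have "norm \<dots> \<le> (1 - 2 * c0 * u\<^sup>2) + u ^ 3 / 6 + 2 * u ^ 3"
      proof (rule norm_triangle_mono[OF norm_triangle_mono[OF _ c1_approx[OF i(2)]] c2_approx[OF i(2)]])
        show "norm (complex_of_real (1 - t\<^sup>2 * a i)) \<le> 1 - 2 * c0 * u\<^sup>2"
          unfolding norm_of_real using ta[OF i] u2 by linarith
      qed
      finally show ?thesis using u32 u3 by linarith
    qed
    show "c0 * u\<^sup>2 \<le> 2 / 5" using mult_mono[OF c0(2) u2] c0 by simp
    show "(4 + 2 * 2048) * u \<le> c0 / 8" using u by simp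
  qed (use \<tau>_bound u u1 c0 \<eta>0 in auto)
  also have "12 * 4108 / c0 * u * exp (- (c0 * u\<^sup>2 / 2) * k) \<le> 50000 / c0 * u * exp (- (c0 * u\<^sup>2 / 2) * k)"
    using c0 u by (intro mult_right_mono divide_right_mono) auto
  finally show ?thesis by (simp add: E_def \<eta>_def)
qed

end

section \<open>Blocks of comparable variance\<close>

definition moment_const :: "nat \<Rightarrow> nat \<Rightarrow> real" where
  "moment_const d m = (2 * d + 9) * geometric_moment m"

lemma moment_const_ge: "9 \<le> moment_const d m"
  using mult_mono[of 9 "real (2 * d + 9)" 1 "geometric_moment m"] geometric_moment_ge_1[of m]
  by (simp add: moment_const_def)

definition moment_max :: "nat \<Rightarrow> real" where
  "moment_max d = Max {moment_const d 1, moment_const d 2, moment_const d 3}"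

lemma moment_max_ge: "moment_const d 1 \<le> moment_max d" "moment_const d 2 \<le> moment_max d"
    "moment_const d 3 \<le> moment_max d" "9 \<le> moment_max d"
  using moment_const_ge[of d 1] by (auto simp: moment_max_def)

text \<open>The Riemann zeta function at b, for \<open>1 < b\<close>.\<close>

definition zeta_sum :: "real \<Rightarrow> real" where
  "zeta_sum b = (\<Sum>r. real (Suc r) powr (- b))"

lemma summable_zeta: "1 < b \<Longrightarrow> summable (\<lambda>r. real (Suc r) powr (- b))"
  using summable_real_powr_iff[of "- b"] by (subst summable_Suc_iff) simp

lemma zeta_sum_nonneg: "1 < b \<Longrightarrow> 0 \<le> zeta_sum b"
  unfolding zeta_sum_def by (intro suminf_nonneg summable_zeta) auto

lemma sum_powr_le_zeta:
  assumes "1 < b" "finite I" "inj_on f I" "\<And>i. i \<in> I \<Longrightarrow> 1 \<le> f i"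
  shows "(\<Sum>i\<in>I. real (f i) powr (- b)) \<le> zeta_sum b"
proof -
  have inj: "inj_on (\<lambda>i. f i - 1) I"
  proof (rule inj_onI)
    fix x y assume xy: "x \<in> I" "y \<in> I" "f x - 1 = f y - 1"
    then have "f x = f y" using assms(4)[of x] assms(4)[of y] by linarith
    then show "x = y" using assms(3) xy by (auto dest: inj_onD)
  qed
  have "(\<Sum>i\<in>I. real (f i) powr (- b)) = (\<Sum>i\<in>I. real (Suc (f i - 1)) powr (- b))"
    using assms(4) by (intro sum.cong) auto
  also have "\<dots> = (\<Sum>r\<in>(\<lambda>i. f i - 1) ` I. real (Suc r) powr (- b))"
    by (subst sum.reindex[OF inj]) (simp add: o_def)
  also have "\<dots> \<le> zeta_sum b"
    unfolding zeta_sum_def using assms(2) by (intro sum_le_suminf summable_zeta assms(1)) auto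
  finally show ?thesis .
qed

text \<open>Bounds what one more term adds to the variance: its own square and twice its covariances
  with all earlier terms, each at most \<open>4 * K^2\<close> times a mixing coefficient.\<close>

definition variance_const :: "real \<Rightarrow> real \<Rightarrow> real \<Rightarrow> real" where
  "variance_const K B a = K\<^sup>2 + 8 * K\<^sup>2 * B * zeta_sum a"

text \<open>\<open>V\<close> is 40 times the target variance of a block.\<close>

definition large_variance :: "real \<Rightarrow> nat \<Rightarrow> real \<Rightarrow> real \<Rightarrow> nat \<Rightarrow> real \<Rightarrow> bool" where
  "large_variance K d B a p V \<longleftrightarrow> 40 * K\<^sup>2 \<le> V \<and>
     (\<exists>m\<ge>1. moment_const d 1 * sqrt V * (m * K)
        + 9 * ((moment_const d p)\<^sup>2 * V) * (B * real m powr (- a)) powr (1 - 2 / p) \<le> V / 640) \<and>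
     9 * (moment_const d p)\<^sup>2 * (B * (V / (80 * variance_const K B a)) powr (- a)) powr (1 - 2 / p)
        * zeta_sum (a * (1 - 2 / p)) \<le> 1 / 640"

text \<open>\<open>al\<close> is a majorant of the mixing coefficients. Positivity suits real
  powers, and monotonicity allows a distance to be replaced by a smaller one.\<close>

locale alpha_mixing_row = mixing_row +
  fixes al :: "nat \<Rightarrow> real" and B a :: real
  assumes alpha: "1 \<le> m \<Longrightarrow> s + m \<le> n \<Longrightarrow> mixing_le M (Pa s) (Fu (s + m)) (al m)"
    and al_pos: "0 < al m" and al_antimono: "1 \<le> i \<Longrightarrow> i \<le> j \<Longrightarrow> al j \<le> al i"
    and al_le: "1 \<le> m \<Longrightarrow> al m \<le> B * real m powr (- a)"
    and a: "1 < a" and B: "0 < B"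
begin

section \<open>Variances and covariances of sums\<close>

lemma SS_integrable: "q \<le> n \<Longrightarrow> q' \<le> n \<Longrightarrow> integrable M (\<lambda>x. S p q x * S p' q' x)"
proof (rule integrable_bounded_real[where c="(real n * K) * (real n * K)"])
  assume q: "q \<le> n" "q' \<le> n"
  then show "(\<lambda>x. S p q x * S p' q' x) \<in> borel_measurable M"
    by (intro borel_measurable_times S_measurable)
  show "\<bar>S p q x * S p' q' x\<bar> \<le> (real n * K) * (real n * K)" if "x \<in> space M" for x
    unfolding abs_mult using K_pos that q by (intro mult_mono S_bound') auto
qed

lemma S2_integrable: "q \<le> n \<Longrightarrow> integrable M (\<lambda>x. (S p q x)\<^sup>2)"
  using SS_integrable[of q q p p] by (simp add: power2_eq_square)

lemma S_single: "S j (Suc j) x = X (Suc j) x"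
proof -
  have "{j<..Suc j} = {Suc j}" by auto
  then show ?thesis by (simp add: S_def)
qed

lemma S_abs_le: "q \<le> n \<Longrightarrow> x \<in> space M \<Longrightarrow> \<bar>S p q x\<bar> \<le> real n * K"
  by (rule S_bound') auto

lemma covariance_single:
  assumes "1 \<le> i" "i < j" "j \<le> n"
  shows "\<bar>expectation (\<lambda>x. X i x * X j x)\<bar> \<le> 4 * K\<^sup>2 * al (j - i)"
proof -
  have m: "mixing_le M (Pa i) (Fu (i + (j - i))) (al (j - i))" using assms by (intro alpha) auto
  have "\<bar>expectation (\<lambda>x. X i x * X j x) - expectation (X i) * expectation (X j)\<bar> \<le> 4 * K * K * al (j - i)"
    using assms K_pos by (intro covariance_le[OF m] X_past X_future X_bound) auto
  then show ?thesis using assms by (simp add: X_mean power2_eq_square)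
qed

text \<open>Serves as a lower bound for the length of a block with given variance.\<close>

lemma variance_linear: "p \<le> q \<Longrightarrow> q \<le> n \<Longrightarrow> expectation (\<lambda>x. (S p q x)\<^sup>2) \<le> variance_const K B a * real (q - p)"
proof (induction q)
  case (Suc q)
  show ?case
  proof (cases "p = Suc q")
    case False
    then have pq: "p \<le> q" "q \<le> n" using Suc.prems by auto
    have Xi: "integrable M (\<lambda>x. X j x * X (Suc q) x)" if "j \<in> {p<..q}" for j
      using SS_integrable[of j "Suc q" "j - 1" q] that Suc.prems by (cases j) (auto simp: S_single)
    have sx: "S p (Suc q) x = S p q x + X (Suc q) x" for x
      using S_split[of p q "Suc q"] pq by (simp add: S_single)
    have "expectation (\<lambda>x. (S p (Suc q) x)\<^sup>2)
        = expectation (\<lambda>x. (S p q x)\<^sup>2 + 2 * (\<Sum>j\<in>{p<..q}. X j x * X (Suc q) x) + (S q (Suc q) x)\<^sup>2)"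
    proof -
      have "S p q x * X (Suc q) x = (\<Sum>j\<in>{p<..q}. X j x * X (Suc q) x)" for x
        by (simp add: S_def sum_distrib_right)
      then have "(S p q x + X (Suc q) x)\<^sup>2 = (S p q x)\<^sup>2 + 2 * (\<Sum>j\<in>{p<..q}. X j x * X (Suc q) x) + (X (Suc q) x)\<^sup>2" for x
        by (simp only: power2_sum mult.assoc)
      then show ?thesis unfolding sx S_single by simp
    qed
    also have "\<dots> = expectation (\<lambda>x. (S p q x)\<^sup>2) + 2 * (\<Sum>j\<in>{p<..q}. expectation (\<lambda>x. X j x * X (Suc q) x))
        + expectation (\<lambda>x. (S q (Suc q) x)\<^sup>2)"
    proof -
      define T where "T x = (\<Sum>j\<in>{p<..q}. X j x * X (Suc q) x)" for x
      have "integrable M T" unfolding T_def by (intro Bochner_Integration.integrable_sum Xi)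
      moreover have "expectation T = (\<Sum>j\<in>{p<..q}. expectation (\<lambda>x. X j x * X (Suc q) x))"
        unfolding T_def by (intro Bochner_Integration.integral_sum Xi)
      ultimately show ?thesis
        unfolding T_def[symmetric] using S2_integrable[of q p] S2_integrable[of "Suc q" q] Suc.prems pq by simp
    qed
    also have "(\<Sum>j\<in>{p<..q}. expectation (\<lambda>x. X j x * X (Suc q) x)) \<le> (\<Sum>j\<in>{p<..q}. 4 * K\<^sup>2 * B * real (Suc q - j) powr (- a))"
    proof (rule sum_mono)
      fix j assume j: "j \<in> {p<..q}"
      have "expectation (\<lambda>x. X j x * X (Suc q) x) \<le> 4 * K\<^sup>2 * al (Suc q - j)"
        using covariance_single[of j "Suc q"] j Suc.prems by auto
      also have "\<dots> \<le> 4 * K\<^sup>2 * (B * real (Suc q - j) powr (- a))"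
        using j by (intro mult_left_mono al_le) auto
      finally show "expectation (\<lambda>x. X j x * X (Suc q) x) \<le> 4 * K\<^sup>2 * B * real (Suc q - j) powr (- a)" by simp
    qed
    also have "\<dots> = 4 * K\<^sup>2 * B * (\<Sum>j\<in>{p<..q}. real (Suc q - j) powr (- a))" by (simp add: sum_distrib_left)
    also have "\<dots> \<le> 4 * K\<^sup>2 * B * zeta_sum a"
      using B by (intro mult_left_mono sum_powr_le_zeta a) (auto simp: inj_on_def)
    also have "expectation (\<lambda>x. (S q (Suc q) x)\<^sup>2) \<le> expectation (\<lambda>x. K\<^sup>2)"
    proof (intro integral_mono S2_integrable)
      fix x assume "x \<in> space M"
      then have "\<bar>S q (Suc q) x\<bar> \<le> K" using X_bound[of "Suc q" x] Suc.prems by (simp add: S_single)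
      then show "(S q (Suc q) x)\<^sup>2 \<le> K\<^sup>2" using power_mono[of "\<bar>S q (Suc q) x\<bar>" K 2] by simp
    qed (use Suc.prems in auto)
    also have "expectation (\<lambda>x. K\<^sup>2) = K\<^sup>2" using prob_space by simp
    finally have "expectation (\<lambda>x. (S p (Suc q) x)\<^sup>2) \<le> expectation (\<lambda>x. (S p q x)\<^sup>2) + variance_const K B a"
      by (simp add: variance_const_def)
    then show ?thesis using Suc.IH[OF pq] pq by (simp add: of_nat_diff algebra_simps)
  qed simp
qed simp

lemma variance_const_pos: "0 < variance_const K B a"
  using K_pos B zeta_sum_nonneg[OF a] by (simp add: variance_const_def add_pos_nonneg)

lemma tame_moment':
  assumes "tame V p q" "K\<^sup>2 \<le> V" "p \<le> q" "1 \<le> m"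
  shows "expectation (\<lambda>x. \<bar>S p q x\<bar> ^ m) \<le> (moment_const d m * sqrt V) ^ m"
  using tame_moment[OF assms] by (simp add: moment_const_def)

text \<open>Davydov's inequality with the moments of tame sums. The order m is free; large m brings
  the exponent close to 1.\<close>

lemma covariance_tame:
  assumes t: "tame V p r" "tame V r' q" and pq: "p \<le> r" "r \<le> r'" "r' \<le> q" and V: "K\<^sup>2 \<le> V" and m: "2 \<le> m"
  shows "\<bar>expectation (\<lambda>x. S p r x * S r' q x)\<bar>
    \<le> 9 * ((moment_const d m)\<^sup>2 * V) * al (r' + 1 - r) powr (1 - 2 / m)"
proof (cases "r' = q")
  case True
  then have "(\<lambda>x. S p r x * S r' q x) = (\<lambda>x. 0)" by auto
  then show ?thesis using V K_pos al_pos[of "r' + 1 - r"] by (simp add: order_trans[OF zero_le_power2 V])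
next
  case False
  have V0: "V > 0" using V K_pos by (meson less_le_trans zero_less_power)
  have q: "q \<le> n" using t by (simp add: tame_def)
  have "mixing_le M (Pa r) (Fu (r + (r' + 1 - r))) (al (r' + 1 - r))"
    using pq False q by (intro alpha) auto
  then have mix: "mixing_le M (Pa r) (Fu (r' + 1)) (al (r' + 1 - r))" using pq by simp
  have "\<bar>expectation (\<lambda>x. S p r x * S r' q x)\<bar>
    \<le> 9 * (moment_const d m * sqrt V)\<^sup>2 * al (r' + 1 - r) powr (1 - 2 / m)"
  proof (rule covariance_moment_le[OF mix])
    show "S p r \<in> borel_measurable (Pa r)" using pq q by (intro S_past) auto
    show "S r' q \<in> borel_measurable (Fu (r' + 1))" using pq q by (intro S_future) auto
    show "\<bar>S p r x\<bar> \<le> real n * K" "\<bar>S r' q x\<bar> \<le> real n * K" if "x \<in> space M" for x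
      using that pq q by (intro S_abs_le; simp)+
    show "expectation (S p r) = 0" using pq q by (intro S_mean) auto
    show "expectation (\<lambda>x. \<bar>S p r x\<bar> ^ m) \<le> (moment_const d m * sqrt V) ^ m"
      "expectation (\<lambda>x. \<bar>S r' q x\<bar> ^ m) \<le> (moment_const d m * sqrt V) ^ m"
      using m pq by (intro tame_moment' t V; simp)+
    show "0 < moment_const d m * sqrt V" using moment_const_ge[of d m] V0 by simp
  qed (use m al_pos in auto)
  then show ?thesis using V0 by (simp add: power_mult_distrib)
qed

text \<open>Cauchy-Schwarz gives only V. Detach the first l terms of the second sum: they contribute
  order \<open>sqrt V\<close>, and the rest is at distance l, where mixing gives V times a small
  number.\<close>

lemma covariance_adjacent:
  assumes t: "tame V p r" "tame V r q" and pq: "p \<le> r" "r \<le> q" and L: "large_variance K d B a m V" and m: "2 \<le> m"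
  shows "\<bar>expectation (\<lambda>x. S p r x * S r q x)\<bar> \<le> V / 640"
proof -
  have "40 * K\<^sup>2 \<le> V" using L by (simp add: large_variance_def)
  then have V: "K\<^sup>2 \<le> V" using zero_le_power2[of K] by linarith
  have V0: "V > 0" using V K_pos by (meson less_le_trans zero_less_power)
  obtain l where l: "1 \<le> l" and le: "moment_const d 1 * sqrt V * (l * K)
        + 9 * ((moment_const d m)\<^sup>2 * V) * (B * real l powr (- a)) powr (1 - 2 / m) \<le> V / 640"
    using L by (auto simp: large_variance_def)
  have q: "q \<le> n" using t by (simp add: tame_def)
  have m1: "0 \<le> 1 - 2 / real m" using m by simp
  define h where "h = min q (r + l - 1)"
  have h: "r \<le> h" "h \<le> q" "h \<le> n" using pq q l by (auto simp: h_def)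
  have sp: "S r q x = S r h x + S h q x" for x by (rule S_split) (use h in auto)
  have 1: "\<bar>expectation (\<lambda>x. S p r x * S r h x)\<bar> \<le> moment_const d 1 * sqrt V * (l * K)"
  proof -
    have "norm (expectation (\<lambda>x. S p r x * S r h x)) \<le> expectation (\<lambda>x. \<bar>S p r x\<bar> ^ 1 * (l * K))"
    proof (rule norm_integral_le)
      show "integrable M (\<lambda>x. \<bar>S p r x\<bar> ^ 1 * (l * K))"
        using S_power_integrable[of r p 1] pq q by simp
      fix x assume x: "x \<in> space M"
      have "\<bar>S r h x\<bar> \<le> real l * K" by (rule S_bound') (use h x in \<open>auto simp: h_def\<close>)
      then show "norm (S p r x * S r h x) \<le> \<bar>S p r x\<bar> ^ 1 * (l * K)" by (simp add: abs_mult mult_left_mono)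
    qed
    also have "\<dots> = expectation (\<lambda>x. \<bar>S p r x\<bar> ^ 1) * (l * K)" by simp
    also have "\<dots> \<le> (moment_const d 1 * sqrt V) ^ 1 * (l * K)"
      using K_pos by (intro mult_right_mono tame_moment' t V pq) auto
    finally show ?thesis by simp
  qed
  have 2: "\<bar>expectation (\<lambda>x. S p r x * S h q x)\<bar>
      \<le> 9 * ((moment_const d m)\<^sup>2 * V) * (B * real l powr (- a)) powr (1 - 2 / m)"
  proof (cases "h = q")
    case True
    then have "(\<lambda>x. S p r x * S h q x) = (\<lambda>x. 0)" by auto
    then show ?thesis using V0 by simp
  next
    case False
    then have hl: "h + 1 - r = l" using l by (simp add: h_def)
    have "\<bar>expectation (\<lambda>x. S p r x * S h q x)\<bar> \<le> 9 * ((moment_const d m)\<^sup>2 * V) * al (h + 1 - r) powr (1 - 2 / m)"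
      using h by (intro covariance_tame t pq V m tame_sub[OF t(2)]) auto
    also have "\<dots> \<le> 9 * ((moment_const d m)\<^sup>2 * V) * (B * real l powr (- a)) powr (1 - 2 / m)"
      unfolding hl using V0 al_le[OF l] al_pos[of l] m1 by (intro mult_left_mono powr_mono2) auto
    finally show ?thesis .
  qed
  have "expectation (\<lambda>x. S p r x * S r q x) = expectation (\<lambda>x. S p r x * S r h x + S p r x * S h q x)"
    by (simp add: sp distrib_left)
  also have "\<dots> = expectation (\<lambda>x. S p r x * S r h x) + expectation (\<lambda>x. S p r x * S h q x)"
    using pq h q by (intro Bochner_Integration.integral_add SS_integrable) auto
  finally show ?thesis using 1 2 le by linarith
qed

lemma second_moment_add_le:
  assumes "p \<le> r" "r \<le> q" "q \<le> n"
  shows "expectation (\<lambda>x. (S p q x)\<^sup>2) \<le> 2 * expectation (\<lambda>x. (S p r x)\<^sup>2) + 2 * expectation (\<lambda>x. (S r q x)\<^sup>2)"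
    and "expectation (\<lambda>x. (S r q x)\<^sup>2) \<le> 2 * expectation (\<lambda>x. (S p r x)\<^sup>2) + 2 * expectation (\<lambda>x. (S p q x)\<^sup>2)"
proof -
  have i: "integrable M (\<lambda>x. (S p r x)\<^sup>2)" "integrable M (\<lambda>x. (S r q x)\<^sup>2)" "integrable M (\<lambda>x. (S p q x)\<^sup>2)"
    using assms by (intro S2_integrable; simp)+
  have 1: "(b + c)\<^sup>2 \<le> 2 * b\<^sup>2 + 2 * c\<^sup>2" for b c :: real
    using zero_le_power2[of "b - c"] by (simp add: power2_sum power2_diff)
  have 2: "c\<^sup>2 \<le> 2 * b\<^sup>2 + 2 * (b + c)\<^sup>2" for b c :: real
    using 1[of "- b" "b + c"] by simp
  have s: "S p q x = S p r x + S r q x" for x by (rule S_split) (use assms in auto)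
  have "expectation (\<lambda>x. (S p q x)\<^sup>2) \<le> expectation (\<lambda>x. 2 * (S p r x)\<^sup>2 + 2 * (S r q x)\<^sup>2)"
    using i 1 by (intro integral_mono) (simp_all add: s)
  then show "expectation (\<lambda>x. (S p q x)\<^sup>2) \<le> 2 * expectation (\<lambda>x. (S p r x)\<^sup>2) + 2 * expectation (\<lambda>x. (S r q x)\<^sup>2)"
    using i by simp
  have "expectation (\<lambda>x. (S r q x)\<^sup>2) \<le> expectation (\<lambda>x. 2 * (S p r x)\<^sup>2 + 2 * (S p q x)\<^sup>2)"
    using i 2 by (intro integral_mono) (simp_all add: s)
  then show "expectation (\<lambda>x. (S r q x)\<^sup>2) \<le> 2 * expectation (\<lambda>x. (S p r x)\<^sup>2) + 2 * expectation (\<lambda>x. (S p q x)\<^sup>2)"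
    using i by simp
qed

text \<open>\<open>S i j\<close> is the difference of two sums started at p, and the square of a
  difference is at most twice the sum of the squares: hence the factor 4.\<close>

lemma tameI:
  assumes q: "q \<le> n" and le: "\<And>j. p \<le> j \<Longrightarrow> j \<le> q \<Longrightarrow> expectation (\<lambda>x. (S p j x)\<^sup>2) \<le> V / 4"
  shows "tame V p q"
  unfolding tame_def
proof (intro conjI allI impI q)
  fix i j assume ij: "p \<le> i" "i \<le> j" "j \<le> q"
  then show "expectation (\<lambda>x. (S i j x)\<^sup>2) \<le> V"
    using second_moment_add_le(2)[of p i j] le[of i] le[of j] q by simp
qed

section \<open>The greedy partition\<close>

definition good_block :: "real \<Rightarrow> nat \<Rightarrow> nat \<Rightarrow> bool" where
  "good_block V p q \<longleftrightarrow> p < q \<and> q \<le> n \<and> tame V p q \<and> V / 80 \<le> expectation (\<lambda>x. (S p q x)\<^sup>2)"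

text \<open>Cut as soon as the second moment of the running sum reaches V / 40; the last term, with
  square at most V / 40, leaves it below V / 10. A rest that never reaches V / 40 is merged into the
  block before it. Their covariance is at most V / 640, so the merged block keeps at least
  \<open>V / 40 - V / 320\<close>, more than V / 80.\<close>

lemma exists_partition:
  assumes L: "large_variance K d B a m V" and m: "2 \<le> m"
    and p: "p \<le> j" "j \<le> n" "V / 40 \<le> expectation (\<lambda>x. (S p j x)\<^sup>2)"
  shows "\<exists>k e. 1 \<le> k \<and> e 0 = p \<and> e k = n \<and> (\<forall>i<k. good_block V (e i) (e (Suc i)))"
  using p
proof (induction "n - p" arbitrary: p j rule: less_induct)
  case less
  have V: "40 * K\<^sup>2 \<le> V" using L by (simp add: large_variance_def)
  have V0: "V > 0" using V K_pos zero_less_power[of K 2] by linarith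
  define e where "e = (LEAST j. p \<le> j \<and> j \<le> n \<and> V / 40 \<le> expectation (\<lambda>x. (S p j x)\<^sup>2))"
  have e: "p \<le> e" "e \<le> n" "V / 40 \<le> expectation (\<lambda>x. (S p e x)\<^sup>2)"
    using LeastI[of "\<lambda>j. p \<le> j \<and> j \<le> n \<and> V / 40 \<le> expectation (\<lambda>x. (S p j x)\<^sup>2)" j] less.prems
    unfolding e_def by auto
  have before: "expectation (\<lambda>x. (S p i x)\<^sup>2) < V / 40" if "p \<le> i" "i < e" for i
    using not_less_Least[of i "\<lambda>j. p \<le> j \<and> j \<le> n \<and> V / 40 \<le> expectation (\<lambda>x. (S p j x)\<^sup>2)"] that e
    unfolding e_def[symmetric] by auto
  have pe: "p < e"
  proof (rule ccontr)
    assume "\<not> p < e"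
    then have "p = e" using e by simp
    then show False using e(3) V0 by simp
  qed
  have Se: "expectation (\<lambda>x. (S p e x)\<^sup>2) \<le> V / 10"
  proof -
    have "expectation (\<lambda>x. (S (e - 1) e x)\<^sup>2) \<le> expectation (\<lambda>x. K\<^sup>2)"
    proof (intro integral_mono S2_integrable e)
      fix x assume x: "x \<in> space M"
      have "\<bar>S (e - 1) e x\<bar> \<le> real 1 * K" by (rule S_bound') (use x e in auto)
      then show "(S (e - 1) e x)\<^sup>2 \<le> K\<^sup>2" using power_mono[of "\<bar>S (e - 1) e x\<bar>" K 2] by simp
    qed auto
    then have "expectation (\<lambda>x. (S (e - 1) e x)\<^sup>2) \<le> V / 40" using V prob_space by simp
    moreover have "p \<le> e - 1" "e - 1 < e" using pe by auto
    ultimately show ?thesis using second_moment_add_le(1)[of p "e - 1" e] before[of "e - 1"] e by simp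
  qed
  have tpe: "tame V p e"
  proof (rule tameI[OF e(2)])
    fix i assume "p \<le> i" "i \<le> e"
    then show "expectation (\<lambda>x. (S p i x)\<^sup>2) \<le> V / 4"
      using before[of i] Se V0 by (cases "i = e") auto
  qed
  show ?case
  proof (cases "\<exists>j. e \<le> j \<and> j \<le> n \<and> V / 40 \<le> expectation (\<lambda>x. (S e j x)\<^sup>2)")
    case True
    then obtain j where j: "e \<le> j" "j \<le> n" "V / 40 \<le> expectation (\<lambda>x. (S e j x)\<^sup>2)" by auto
    obtain k f where k: "1 \<le> k" "f 0 = e" "f k = n" "\<forall>i<k. good_block V (f i) (f (Suc i))"
    proof -
      have "n - e < n - p" using pe e by linarith
      from less.hyps[OF this j] show thesis using that by blast
    qed
    have "good_block V p e" using pe e tpe V0 by (simp add: good_block_def)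
    then have "\<forall>i<Suc k. good_block V (case_nat p f i) (case_nat p f (Suc i))"
      using k by (auto simp: less_Suc_eq_0_disj)
    then show ?thesis using k by (intro exI[of _ "Suc k"] exI[of _ "case_nat p f"]) auto
  next
    case False
    then have after: "expectation (\<lambda>x. (S e j x)\<^sup>2) < V / 40" if "e \<le> j" "j \<le> n" for j
      using False that by (meson not_le)
    have ten: "tame V e n"
    proof (rule tameI[OF order_refl])
      fix j assume "e \<le> j" "j \<le> n"
      from after[OF this] show "expectation (\<lambda>x. (S e j x)\<^sup>2) \<le> V / 4" using V0 by simp
    qed
    \<comment> \<open>Beyond e the bound is \<open>2 * V / 10 + 2 * V / 40 = V / 4\<close>, exactly
      what \<open>tameI\<close> allows.\<close>
    have tpn: "tame V p n"
    proof (rule tameI[OF order_refl])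
      fix i assume i: "p \<le> i" "i \<le> n"
      show "expectation (\<lambda>x. (S p i x)\<^sup>2) \<le> V / 4"
      proof (cases "i \<le> e")
        case True
        then show ?thesis using before[of i] Se V0 i by (cases "i = e") auto
      next
        case False
        then show ?thesis using second_moment_add_le(1)[of p e i] after[of i] Se i pe by simp
      qed
    qed
    have "\<bar>expectation (\<lambda>x. S p e x * S e n x)\<bar> \<le> V / 640"
      using e by (intro covariance_adjacent[OF tpe ten _ _ L m]) auto
    moreover have "expectation (\<lambda>x. (S p n x)\<^sup>2)
        = expectation (\<lambda>x. (S p e x)\<^sup>2 + (S e n x)\<^sup>2 + 2 * (S p e x * S e n x))"
      using S_split[of p e n] e by (simp add: power2_sum mult.assoc)
    moreover have "\<dots> = expectation (\<lambda>x. (S p e x)\<^sup>2) + expectation (\<lambda>x. (S e n x)\<^sup>2) + 2 * expectation (\<lambda>x. S p e x * S e n x)"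
      using S2_integrable[OF e(2), of p] S2_integrable[of n e] SS_integrable[OF e(2), of n p e] by simp
    moreover have "0 \<le> expectation (\<lambda>x. (S e n x)\<^sup>2)" by simp
    ultimately have "V / 80 \<le> expectation (\<lambda>x. (S p n x)\<^sup>2)" using e(3) V0 by linarith
    then have "good_block V p n" using pe e tpn by (simp add: good_block_def)
    then show ?thesis by (intro exI[of _ 1] exI[of _ "case_nat p (\<lambda>_. n)"]) auto
  qed
qed

end

section \<open>Covariances between the blocks of a row\<close>

locale blocked_row = alpha_mixing_row +
  fixes V :: real and m k :: nat and e :: "nat \<Rightarrow> nat"
  assumes large: "large_variance K d B a m V" and m: "2 \<le> m" and am: "1 < a * (1 - 2 / m)"
    and k: "1 \<le> k" and e_0: "e 0 = 0" and e_k: "e k = n"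
    and good: "i < k \<Longrightarrow> good_block V (e i) (e (Suc i))"
begin

lemma V_ge: "K\<^sup>2 \<le> V" and V_pos: "0 < V"
proof -
  have "40 * K\<^sup>2 \<le> V" using large by (simp add: large_variance_def)
  moreover have "0 < K\<^sup>2" using K_pos by simp
  ultimately show "K\<^sup>2 \<le> V" "0 < V" by linarith+
qed

lemma e_mono: "i \<le> j \<Longrightarrow> j \<le> k \<Longrightarrow> e i \<le> e j"
proof (induction j rule: dec_induct)
  case (step j)
  then show ?case using good[of j] by (auto simp: good_block_def)
qed simp

lemma e_le_n: "i \<le> k \<Longrightarrow> e i \<le> n"
  using e_mono[of i k] e_k by simp

text \<open>Every block has at least this length, because its variance is at least V / 80 and grows
  at most linearly.\<close>

definition blen :: real where "blen = V / (80 * variance_const K B a)"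

lemma blen_pos: "0 < blen" using V_pos variance_const_pos by (simp add: blen_def)

lemma e_gap: "i \<le> j \<Longrightarrow> j \<le> k \<Longrightarrow> real (j - i) * blen \<le> real (e j - e i)"
proof (induction j rule: dec_induct)
  case (step j)
  have g: "good_block V (e j) (e (Suc j))" using good step by simp
  have "V / 80 \<le> variance_const K B a * real (e (Suc j) - e j)"
    using g variance_linear[of "e j" "e (Suc j)"] by (simp add: good_block_def)
  then have "blen \<le> real (e (Suc j) - e j)"
    using variance_const_pos by (simp add: blen_def field_simps)
  moreover have "e i \<le> e j" "e j \<le> e (Suc j)" using e_mono step by auto
  ultimately show ?case using step by (simp add: Suc_diff_le distrib_right of_nat_diff)
qed simp

text \<open>Since \<open>0 - 1 = 0\<close>, the sum \<open>Y 0\<close> is empty and serves as the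
  sentinel of the block recursion.\<close>

definition Y :: "nat \<Rightarrow> _ \<Rightarrow> real" where "Y i = S (e (i - 1)) (e i)"

lemma Y_0 [simp]: "Y 0 x = 0" by (simp add: Y_def)

lemma Y_tame: "i \<le> k \<Longrightarrow> tame V (e (i - 1)) (e i)"
proof (cases i)
  case 0
  then show ?thesis using V_pos by (auto simp: tame_def e_0 )
next
  case (Suc j)
  then show "i \<le> k \<Longrightarrow> ?thesis" using good[of j] by (simp add: good_block_def)
qed

definition cov :: "nat \<Rightarrow> nat \<Rightarrow> real" where "cov i j = expectation (\<lambda>x. Y i x * Y j x)"

lemma cov_0 [simp]: "cov 0 j = 0" by (simp add: cov_def)

lemma YY_integrable: "i \<le> k \<Longrightarrow> j \<le> k \<Longrightarrow> integrable M (\<lambda>x. Y i x * Y j x)"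
  unfolding Y_def by (intro SS_integrable e_le_n)

lemma cov_diag: "1 \<le> i \<Longrightarrow> i \<le> k \<Longrightarrow> V / 80 \<le> cov i i" "i \<le> k \<Longrightarrow> cov i i \<le> V"
proof -
  show "V / 80 \<le> cov i i" if "1 \<le> i" "i \<le> k"
    using good[of "i - 1"] that by (simp add: good_block_def cov_def Y_def power2_eq_square)
  show "cov i i \<le> V" if "i \<le> k"
    using Y_tame[OF that] e_mono[of "i - 1" i] that by (simp add: tame_def cov_def Y_def power2_eq_square)
qed

lemma cov_adjacent: "i \<le> k \<Longrightarrow> \<bar>cov (i - 1) i\<bar> \<le> V / 640"
proof (cases "i = 0")
  case True
  then show ?thesis using V_pos by (simp add: cov_def)
next
  case False
  assume i: "i \<le> k"
  then show ?thesis unfolding cov_def Y_def using i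
    by (intro covariance_adjacent[OF _ _ _ _ large m] Y_tame e_mono) auto
qed

lemma cov_far:
  assumes "1 \<le> i" "i + 2 \<le> j" "j \<le> k" "2 \<le> r"
  shows "\<bar>cov i j\<bar> \<le> 9 * ((moment_const d r)\<^sup>2 * V) * al (e (j - 1) + 1 - e i) powr (1 - 2 / r)"
  unfolding cov_def Y_def using assms
  by (intro covariance_tame Y_tame e_mono V_ge) auto

text \<open>The distance from block i to block j is at least \<open>blen\<close> times the number of
  blocks in between, so the covariances are summable as \<open>a * (1 - 2 / m) > 1\<close>. The last
  condition in \<open>large_variance\<close> makes the sum small.\<close>

lemma sum_cov_far:
  assumes j: "j \<le> k"
  shows "(\<Sum>i\<in>{1..j - 2}. \<bar>cov i j\<bar>) \<le> V / 640"
proof -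
  define c2 where "c2 = 1 - 2 / real m"
  have c2: "0 \<le> c2" using m by (simp add: c2_def)
  define D where "D = 9 * ((moment_const d m)\<^sup>2 * V) * (B * blen powr (- a)) powr c2"
  have D: "0 \<le> D" using V_pos by (simp add: D_def)
  have "(\<Sum>i\<in>{1..j - 2}. \<bar>cov i j\<bar>) \<le> (\<Sum>i\<in>{1..j - 2}. D * real (j - 1 - i) powr (- (a * c2)))"
  proof (rule sum_mono)
    fix i assume i: "i \<in> {1..j - 2}"
    then have ij: "1 \<le> i" "i + 2 \<le> j" by auto
    define g where "g = e (j - 1) + 1 - e i"
    have "e i \<le> e (j - 1)" using ij j by (intro e_mono) auto
    then have g1: "1 \<le> g" and gg: "real (e (j - 1) - e i) \<le> real g" by (auto simp: g_def)
    have r: "0 < real (j - 1 - i)" using ij by auto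
    have "i \<le> j - 1" "j - 1 \<le> k" using ij j by linarith+
    from e_gap[OF this] gg have gl: "real (j - 1 - i) * blen \<le> real g" by linarith
    have "al g \<le> B * real g powr (- a)" using g1 by (rule al_le)
    also have "\<dots> \<le> B * (real (j - 1 - i) * blen) powr (- a)"
      using gl r blen_pos B a by (intro mult_left_mono powr_mono2') auto
    finally have "al g powr c2 \<le> (B * (real (j - 1 - i) * blen) powr (- a)) powr c2"
      using al_pos[of g] c2 by (intro powr_mono2) auto
    also have "\<dots> = (B * blen powr (- a)) powr c2 * real (j - 1 - i) powr (- (a * c2))"
      using B blen_pos r by (simp add: powr_mult powr_powr mult_ac)
    finally have "9 * ((moment_const d m)\<^sup>2 * V) * al g powr c2
        \<le> 9 * ((moment_const d m)\<^sup>2 * V) * ((B * blen powr (- a)) powr c2 * real (j - 1 - i) powr (- (a * c2)))"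
      using V_pos by (intro mult_left_mono) auto
    then show "\<bar>cov i j\<bar> \<le> D * real (j - 1 - i) powr (- (a * c2))"
      using cov_far[OF ij j m] unfolding D_def g_def c2_def by (simp add: mult_ac)
  qed
  also have "\<dots> = D * (\<Sum>i\<in>{1..j - 2}. real (j - 1 - i) powr (- (a * c2)))" by (simp add: sum_distrib_left)
  also have "\<dots> \<le> D * zeta_sum (a * c2)"
    using am D by (intro mult_left_mono sum_powr_le_zeta) (auto simp: c2_def inj_on_def)
  also have "\<dots> = V * (9 * (moment_const d m)\<^sup>2 * (B * (V / (80 * variance_const K B a)) powr (- a)) powr (1 - 2 / m)
        * zeta_sum (a * (1 - 2 / m)))"
    by (simp add: D_def blen_def c2_def mult_ac)
  also have "\<dots> \<le> V * (1 / 640)" using large V_pos by (intro mult_left_mono) (auto simp: large_variance_def)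
  finally show ?thesis by simp
qed

lemma S_eq_sum_Y: "j \<le> k \<Longrightarrow> S 0 (e j) x = (\<Sum>i\<in>{1..j}. Y i x)"
proof (induction j)
  case 0
  then show ?case by (simp add: e_0)
next
  case (Suc j)
  have "S 0 (e (Suc j)) x = S 0 (e j) x + S (e j) (e (Suc j)) x"
    using Suc.prems e_mono[of j "Suc j"] by (intro S_split) auto
  then show ?case using Suc by (simp add: Y_def)
qed

definition "s2 = expectation (\<lambda>x. (S 0 n x)\<^sup>2)"
text \<open>Divided by \<open>s2\<close>, this is the quantity \<open>a i\<close> of the block
  recursion.\<close>

definition "half i = cov i i / 2 + cov (i - 1) i"

lemma variance_decomposition:
  "j \<le> k \<Longrightarrow> \<bar>expectation (\<lambda>x. (S 0 (e j) x)\<^sup>2) - 2 * (\<Sum>i\<in>{1..j}. half i)\<bar>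
    \<le> 2 * (\<Sum>i\<in>{1..j}. \<Sum>l\<in>{1..i - 2}. \<bar>cov l i\<bar>)"
proof (induction j)
  case 0
  then show ?case by (simp add: e_0)
next
  case (Suc j)
  have jk: "j \<le> k" "Suc j \<le> k" "e j \<le> n" "e (Suc j) \<le> n" using Suc.prems e_le_n by auto
  have sp: "S 0 (e (Suc j)) x = S 0 (e j) x + Y (Suc j) x" for x
    using S_eq_sum_Y[of j x] S_eq_sum_Y[of "Suc j" x] jk by simp
  have SY: "expectation (\<lambda>x. S 0 (e j) x * Y (Suc j) x) = (\<Sum>l\<in>{1..j}. cov l (Suc j))"
    unfolding S_eq_sum_Y[OF jk(1)] sum_distrib_right cov_def
    using jk by (intro Bochner_Integration.integral_sum YY_integrable) auto
  have last: "(\<Sum>l\<in>{1..j}. cov l (Suc j)) = cov j (Suc j) + (\<Sum>l\<in>{1..Suc j - 2}. cov l (Suc j))"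
    by (cases j) auto
  have "expectation (\<lambda>x. (S 0 (e (Suc j)) x)\<^sup>2)
      = expectation (\<lambda>x. (S 0 (e j) x)\<^sup>2 + 2 * (S 0 (e j) x * Y (Suc j) x) + Y (Suc j) x * Y (Suc j) x)"
    unfolding sp by (simp add: power2_sum power2_eq_square algebra_simps)
  also have "\<dots> = expectation (\<lambda>x. (S 0 (e j) x)\<^sup>2) + 2 * expectation (\<lambda>x. S 0 (e j) x * Y (Suc j) x) + cov (Suc j) (Suc j)"
    using S2_integrable[OF jk(3), of 0] SS_integrable[OF jk(3,4), of 0 "e j"] YY_integrable[OF jk(2,2)]
    by (simp add: cov_def Y_def)
  finally have eq: "expectation (\<lambda>x. (S 0 (e (Suc j)) x)\<^sup>2)
      = expectation (\<lambda>x. (S 0 (e j) x)\<^sup>2) + 2 * half (Suc j) + 2 * (\<Sum>l\<in>{1..Suc j - 2}. cov l (Suc j))"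
    unfolding SY last by (simp add: half_def)
  have "\<bar>\<Sum>l\<in>{1..Suc j - 2}. cov l (Suc j)\<bar> \<le> (\<Sum>l\<in>{1..Suc j - 2}. \<bar>cov l (Suc j)\<bar>)" by (rule sum_abs)
  moreover have "(\<Sum>i\<in>{1..Suc j}. half i) = (\<Sum>i\<in>{1..j}. half i) + half (Suc j)"
    "(\<Sum>i\<in>{1..Suc j}. \<Sum>l\<in>{1..i - 2}. \<bar>cov l i\<bar>)
      = (\<Sum>i\<in>{1..j}. \<Sum>l\<in>{1..i - 2}. \<bar>cov l i\<bar>) + (\<Sum>l\<in>{1..Suc j - 2}. \<bar>cov l (Suc j)\<bar>)"
    by simp_all
  ultimately show ?case using Suc.IH[OF jk(1)] unfolding eq by linarith
qed

lemma half_bounds: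
  assumes "1 \<le> i" "i \<le> k"
  shows "3 * V / 640 \<le> half i" "half i \<le> 321 * V / 640"
  using cov_diag[of i] cov_adjacent[of i] assms by (auto simp: half_def)

text \<open>So k is comparable to \<open>s2 / V\<close>. The 160 comes from
  \<open>2 * 3 / 640 - 2 / 640 = 1 / 160\<close>, the bound for \<open>half\<close> less the
  contribution of distant pairs; the upper bound is rounded.\<close>

lemma s2_bounds: "real k * V \<le> 160 * s2" "s2 \<le> 41 / 40 * (real k * V)"
proof -
  have s: "\<bar>s2 - 2 * (\<Sum>i\<in>{1..k}. half i)\<bar> \<le> 2 * (\<Sum>i\<in>{1..k}. V / 640)"
  proof -
    have "(\<Sum>i\<in>{1..k}. \<Sum>l\<in>{1..i - 2}. \<bar>cov l i\<bar>) \<le> (\<Sum>i\<in>{1..k}. V / 640)"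
      by (intro sum_mono sum_cov_far) auto
    then show ?thesis using variance_decomposition[OF order_refl] unfolding s2_def e_k by linarith
  qed
  have "(\<Sum>i\<in>{1..k}. 3 * V / 640) \<le> (\<Sum>i\<in>{1..k}. half i)" "(\<Sum>i\<in>{1..k}. half i) \<le> (\<Sum>i\<in>{1..k}. 321 * V / 640)"
    using half_bounds by (intro sum_mono; simp)+
  then have "3 / 640 * (real k * V) \<le> (\<Sum>i\<in>{1..k}. half i)" "(\<Sum>i\<in>{1..k}. half i) \<le> 321 / 640 * (real k * V)"
    by (simp_all add: mult_ac)
  moreover have "\<bar>s2 - 2 * (\<Sum>i\<in>{1..k}. half i)\<bar> \<le> 1 / 320 * (real k * V)" using s by (simp add: mult_ac)
  moreover have "0 \<le> real k * V" using V_pos by simp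
  ultimately show "real k * V \<le> 160 * s2" "s2 \<le> 41 / 40 * (real k * V)" unfolding abs_le_iff by linarith+
qed

lemma s2_pos: "0 < s2" using s2_bounds(1) k V_pos by (smt (verit) mult_pos_pos of_nat_0_less_iff less_le_trans zero_less_one)

section \<open>Normalisation and the mixing error of the blocks\<close>

definition gap :: nat where "gap = nat \<lceil>blen\<rceil>"
definition \<delta> :: real where "\<delta> = al gap"

lemma gap_ge: "1 \<le> gap" "blen \<le> real gap"
  using blen_pos by (auto simp: gap_def le_nat_iff real_nat_ceiling_ge)

lemma block_gap': "i < j \<Longrightarrow> j \<le> k \<Longrightarrow> gap \<le> e j + 1 - e i"
proof -
  assume ij: "i < j" "j \<le> k"
  have "1 * blen \<le> real (j - i) * blen" using ij blen_pos by (intro mult_right_mono) auto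
  also have "\<dots> \<le> real (e j - e i)" using ij by (intro e_gap) auto
  finally have "\<lceil>blen\<rceil> \<le> int (e j - e i)" by (simp add: ceiling_le_iff)
  then have "gap \<le> e j - e i" unfolding gap_def by linarith
  then show ?thesis by linarith
qed

text \<open>The exponent \<open>1 - 2 / 4\<close> of fourth moments produces
  \<open>sqrt \<delta>\<close>. There are at most \<open>k^2\<close> distant pairs, and one factor
  \<open>k * V\<close> is traded for \<open>160 * s2\<close>, which gives
  \<open>1440 = 9 * 160\<close>. The value 1/2 is the coefficient of \<open>t^2\<close> in the
  standard Gaussian.\<close>

lemma half_sum_approx:
  "\<bar>(\<Sum>i\<in>{1..k}. half i) / s2 - 1 / 2\<bar> \<le> 1440 * (moment_const d 4)\<^sup>2 * real k * sqrt \<delta>"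
proof -
  have cf: "\<bar>cov l i\<bar> \<le> 9 * ((moment_const d 4)\<^sup>2 * V) * sqrt \<delta>" if "l \<in> {1..i - 2}" "i \<in> {1..k}" for l i
  proof -
    have li: "1 \<le> l" "l + 2 \<le> i" "i \<le> k" using that by auto
    have "\<bar>cov l i\<bar> \<le> 9 * ((moment_const d 4)\<^sup>2 * V) * al (e (i - 1) + 1 - e l) powr (1 - 2 / real 4)"
      using li by (intro cov_far) auto
    also have "al (e (i - 1) + 1 - e l) powr (1 - 2 / real 4) = sqrt (al (e (i - 1) + 1 - e l))"
      using al_pos[of "e (i - 1) + 1 - e l"] by (simp add: powr_half_sqrt)
    also have "9 * ((moment_const d 4)\<^sup>2 * V) * sqrt (al (e (i - 1) + 1 - e l)) \<le> 9 * ((moment_const d 4)\<^sup>2 * V) * sqrt \<delta>"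
      unfolding \<delta>_def using V_pos li block_gap'[of l "i - 1"] gap_ge(1)
      by (intro mult_left_mono real_sqrt_le_mono al_antimono) auto
    finally show ?thesis .
  qed
  define D where "D = 9 * ((moment_const d 4)\<^sup>2 * V) * sqrt \<delta>"
  have D0: "0 \<le> D" using V_pos al_pos[of gap] by (simp add: D_def \<delta>_def)
  have "\<bar>s2 - 2 * (\<Sum>i\<in>{1..k}. half i)\<bar> \<le> 2 * (\<Sum>i\<in>{1..k}. \<Sum>l\<in>{1..i - 2}. \<bar>cov l i\<bar>)"
    using variance_decomposition[of k] by (simp add: s2_def e_k)
  also have "(\<Sum>i\<in>{1..k}. \<Sum>l\<in>{1..i - 2}. \<bar>cov l i\<bar>) \<le> (\<Sum>i\<in>{1..k}. \<Sum>l\<in>{1..i - 2}. D)"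
    unfolding D_def by (intro sum_mono cf)
  also have "\<dots> \<le> (\<Sum>i\<in>{1..k}. real k * D)" using D0 by (intro sum_mono) (auto intro!: mult_right_mono)
  also have "\<dots> = real k * (real k * D)" by simp
  finally have "\<bar>s2 - 2 * (\<Sum>i\<in>{1..k}. half i)\<bar> \<le> 2 * (real k * (real k * D))" by simp
  also have "real k * (real k * D) = (real k * V) * (9 * (moment_const d 4)\<^sup>2 * real k * sqrt \<delta>)"
    by (simp add: D_def)
  also have "2 * \<dots> \<le> 2 * ((160 * s2) * (9 * (moment_const d 4)\<^sup>2 * real k * sqrt \<delta>))"
    using s2_bounds(1) al_pos[of gap] by (intro mult_left_mono mult_right_mono) (auto simp: \<delta>_def)
  finally have "\<bar>s2 - 2 * (\<Sum>i\<in>{1..k}. half i)\<bar> / (2 * s2) \<le> 2 * ((160 * s2) * (9 * (moment_const d 4)\<^sup>2 * real k * sqrt \<delta>)) / (2 * s2)"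
    using s2_pos by (intro divide_right_mono) auto
  moreover have "\<bar>s2 - 2 * (\<Sum>i\<in>{1..k}. half i)\<bar> / (2 * s2) = \<bar>(\<Sum>i\<in>{1..k}. half i) / s2 - 1 / 2\<bar>"
  proof -
    have "\<bar>s2 - 2 * (\<Sum>i\<in>{1..k}. half i)\<bar> / (2 * s2) = \<bar>(s2 - 2 * (\<Sum>i\<in>{1..k}. half i)) / (2 * s2)\<bar>"
      using s2_pos by (simp add: abs_div)
    also have "(s2 - 2 * (\<Sum>i\<in>{1..k}. half i)) / (2 * s2) = - ((\<Sum>i\<in>{1..k}. half i) / s2 - 1 / 2)"
      using s2_pos by (simp add: field_simps)
    finally show ?thesis by (simp only: abs_minus_cancel)
  qed
  ultimately show ?thesis using s2_pos by (simp add: mult_ac)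
qed

text \<open>\<open>c0\<close> makes \<open>2 * c0 * lam^2\<close> equal to the lower bound
  \<open>3 * V / 640\<close> of \<open>half\<close> over \<open>s2\<close>. The term with
  \<open>sqrt \<delta>\<close> comes from correcting the variance of the comparison Gaussian to 1;
  1/2000 is a common lower bound of the decay rates involved.\<close>

lemma char_sum_approx:
  fixes t :: real
  defines "u \<equiv> \<bar>t\<bar> * (moment_max d * sqrt V / sqrt s2)" and "c0 \<equiv> 3 / (1280 * (moment_max d)\<^sup>2)"
  assumes t: "t \<noteq> 0" and u: "u \<le> c0 / 32800" and \<nu>: "2 \<le> \<nu>"
  shows "norm (expectation (\<lambda>x. iexp (t * (S 0 n x / sqrt s2))) - exp (- t\<^sup>2 / 2))
    \<le> exp (- t\<^sup>2 / 2000) * (50000 / c0 * u + 1440 * (moment_const d 4)\<^sup>2 * t\<^sup>2 * k * sqrt \<delta>)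
      + 10 * (96 * 2 ^ \<nu> * \<delta> + 2 * (2 * u) ^ (Suc \<nu> div 2)) * k"
proof -
  define \<sigma> where "\<sigma> = sqrt s2"
  define lam where "lam = moment_max d * sqrt V / \<sigma>"
  have \<sigma>: "0 < \<sigma>" "\<sigma>\<^sup>2 = s2" using s2_pos by (auto simp: \<sigma>_def)
  have \<delta>0: "0 \<le> \<delta>" using al_pos[of gap] by (simp add: \<delta>_def)
  have lam: "0 < lam" using moment_max_ge(4)[of d] V_pos \<sigma> by (simp add: lam_def)
  define y where "y i x = Y i x / \<sigma>" for i x
  have mom: "expectation (\<lambda>x. \<bar>y j x\<bar> ^ r) \<le> lam ^ r"
    if j: "j \<le> k" and r: "1 \<le> r" "moment_const d r \<le> moment_max d" for j r
  proof -
    have "expectation (\<lambda>x. \<bar>y j x\<bar> ^ r) = expectation (\<lambda>x. \<bar>Y j x\<bar> ^ r) / \<sigma> ^ r"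
      using \<sigma> by (simp add: y_def power_divide)
    also have "\<dots> \<le> (moment_const d r * sqrt V) ^ r / \<sigma> ^ r"
      unfolding Y_def using \<sigma> j r by (intro divide_right_mono tame_moment' Y_tame V_ge e_mono) auto
    also have "\<dots> \<le> (moment_max d * sqrt V) ^ r / \<sigma> ^ r"
      using \<sigma> r(2) V_pos moment_const_ge[of d r] by (intro divide_right_mono power_mono mult_right_mono) auto
    finally show ?thesis by (simp add: lam_def power_divide)
  qed
  \<comment> \<open>The future of block i starts right after \<open>e (i - 1)\<close>, so the past
    of block s and the future of block \<open>s + 2\<close> are separated by a whole block, hence by
    at least \<open>gap\<close>.\<close>
  interpret b: block_row M k y "\<lambda>i. Pa (e i)" "\<lambda>i. Fu (e (i - 1) + 1)" \<delta> lam "real n * K / \<sigma>" t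
  proof
    show "y 0 x = 0" for x by (simp add: y_def)
    show "y j \<in> borel_measurable (Pa (e s))" if "j \<le> s" "s \<le> k" for j s
      unfolding y_def[abs_def] Y_def using that
      by (intro borel_measurable_divide S_past e_mono e_le_n) auto
    show "y j \<in> borel_measurable (Fu (e (s - 1) + 1))" if "s \<le> j" "j \<le> k" for j s
    proof -
      have "e (s - 1) \<le> e (j - 1)" using that by (intro e_mono) auto
      then show ?thesis
        unfolding y_def[abs_def] Y_def using that
        by (intro borel_measurable_divide S_future e_le_n) auto
    qed
    show "subalgebra M (Pa (e s))" for s by (rule subalgebra_past)
    show "mixing_le M (Pa (e s)) (Fu (e (s + 2 - 1) + 1)) \<delta>" if s: "s + 2 \<le> k" for s
    proof -
      have le: "e s \<le> e (s + 1)" using s by (intro e_mono) auto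
      have lt: "e (s + 1) < e (Suc (s + 1))" "e (Suc (s + 1)) \<le> n"
        using good[of "s + 1"] s by (auto simp: good_block_def)
      define g where "g = e (s + 1) + 1 - e s"
      have g: "gap \<le> g" unfolding g_def using s by (intro block_gap') auto
      have "mixing_le M (Pa (e s)) (Fu (e s + g)) (al g)"
        using lt g gap_ge le by (intro alpha) (auto simp: g_def)
      moreover have "e s + g = e (s + 2 - 1) + 1" using le by (simp add: g_def)
      moreover have "al g \<le> \<delta>" unfolding \<delta>_def using gap_ge g by (intro al_antimono) auto
      ultimately show ?thesis unfolding mixing_le_def by (metis order_trans)
    qed
    show "\<bar>y j x\<bar> \<le> real n * K / \<sigma>" if "j \<le> k" "x \<in> space M" for j x
      using S_abs_le[OF e_le_n[OF that(1)] that(2)] \<sigma> by (simp add: y_def Y_def divide_right_mono)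
    show "expectation (y j) = 0" if "j \<le> k" for j
      using S_mean[OF e_le_n[OF that]] by (simp add: y_def[abs_def] Y_def)
    show "expectation (\<lambda>x. \<bar>y j x\<bar>) \<le> lam" if "j \<le> k" for j
      using mom[OF that, of 1] moment_max_ge[of d] by simp
    show "expectation (\<lambda>x. (y j x)\<^sup>2) \<le> lam\<^sup>2" if "j \<le> k" for j
      using mom[OF that, of 2] moment_max_ge[of d] by simp
    show "expectation (\<lambda>x. \<bar>y j x\<bar> ^ 3) \<le> lam ^ 3" if "j \<le> k" for j
      using mom[OF that, of 3] moment_max_ge[of d] by simp
  qed (use \<delta>0 lam in auto)
  have bu: "b.u = u" by (subst b.u_def) (simp add: u_def lam_def \<sigma>_def)
  have ba: "b.a i = half i / s2" for i
    using \<sigma> by (simp add: b.a_def b.v_def b.cv_def half_def cov_def y_def power2_eq_square add_divide_distrib)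
  have c0: "0 < c0" "c0 \<le> 3 / 4"
  proof -
    have "81 \<le> (moment_max d)\<^sup>2" using power_mono[OF moment_max_ge(4)[of d], of 2] by simp
    then have "0 < (moment_max d)\<^sup>2" "3 \<le> 3 / 4 * (1280 * (moment_max d)\<^sup>2)" by linarith+
    then show "0 < c0" "c0 \<le> 3 / 4" unfolding c0_def by (simp_all add: pos_divide_le_eq)
  qed
  have c0lam: "2 * c0 * lam\<^sup>2 = 3 * V / 640 / s2"
    using V_pos \<sigma> moment_max_ge(4)[of d] by (simp add: c0_def lam_def power_divide power_mult_distrib)
  have F: "b.F k = expectation (\<lambda>x. iexp (t * (S 0 n x / sqrt s2)))"
  proof -
    have "(\<Prod>j\<in>{1..k}. b.e j x) = iexp (t * (S 0 n x / sqrt s2))" for x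
    proof -
      have "(\<Prod>j\<in>{1..k}. b.e j x) = exp (\<Sum>j\<in>{1..k}. \<i> * complex_of_real (t * y j x))"
        by (simp add: b.e_def exp_sum)
      also have "(\<Sum>j\<in>{1..k}. \<i> * complex_of_real (t * y j x)) = \<i> * complex_of_real (t * (S 0 n x / sqrt s2))"
        using S_eq_sum_Y[of k x]
        by (simp add: e_k y_def \<sigma>_def sum_distrib_left sum_divide_distrib)
      finally show ?thesis .
    qed
    then show ?thesis by (simp add: b.F_def)
  qed
  define Ak where "Ak = (\<Sum>i\<in>{1..k}. half i) / s2"
  have Ak: "b.A k = Ak" by (simp add: b.A_def ba Ak_def sum_divide_distrib)
  have u0: "0 < u" unfolding u_def lam_def[unfolded \<sigma>_def, symmetric] using t lam by simp
  have main: "norm (b.F k - b.G k) \<le> 50000 / c0 * u * exp (- (c0 * u\<^sup>2 / 2) * k)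
      + 10 * (96 * 2 ^ \<nu> * \<delta> + 2 * (2 * u) ^ (Suc \<nu> div 2)) * k"
  proof -
    have "2 * c0 * lam\<^sup>2 \<le> b.a i" if "1 \<le> i" "i \<le> k" for i
      unfolding ba c0lam using half_bounds(1)[OF that] s2_pos by (intro divide_right_mono) auto
    from b.char_approx[OF c0 this _ _ \<nu>] show ?thesis using u0 u unfolding bu by blast
  qed
  have kV: "40 / 41 \<le> real k * V / s2" using s2_bounds(2) s2_pos by (simp add: field_simps)
  have decay: "exp (- (c0 * u\<^sup>2 / 2) * k) \<le> exp (- t\<^sup>2 / 2000)"
  proof -
    have "c0 * u\<^sup>2 / 2 * k = (2 * c0 * lam\<^sup>2) / 4 * t\<^sup>2 * k"
      by (simp add: u_def lam_def[unfolded \<sigma>_def, symmetric] power_mult_distrib)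
    also have "\<dots> = 3 / 2560 * t\<^sup>2 * (real k * V / s2)" unfolding c0lam by simp
    also have "\<dots> \<ge> 3 / 2560 * t\<^sup>2 * (40 / 41)" using kV by (intro mult_left_mono) auto
    finally have "t\<^sup>2 / 2000 \<le> c0 * u\<^sup>2 / 2 * k" using zero_le_power2[of t] by linarith
    then show ?thesis by simp
  qed
  have Ak_ge: "1 / 2000 \<le> Ak"
  proof -
    have "(\<Sum>i\<in>{1..k}. 3 * V / 640) \<le> (\<Sum>i\<in>{1..k}. half i)" using half_bounds by (intro sum_mono) simp
    then have "3 / 640 * (real k * V / s2) \<le> Ak" using s2_pos by (simp add: Ak_def divide_right_mono field_simps)
    moreover have "3 / 640 * (40 / 41) \<le> 3 / 640 * (real k * V / s2)" using kV by (intro mult_left_mono) auto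
    ultimately have "3 / 640 * (40 / 41) \<le> Ak" by (rule order_trans[rotated])
    then show ?thesis by simp
  qed
  have G: "norm (complex_of_real (b.G k) - exp (- t\<^sup>2 / 2)) \<le> exp (- t\<^sup>2 / 2000) * (1440 * (moment_const d 4)\<^sup>2 * t\<^sup>2 * k * sqrt \<delta>)"
  proof -
    have ed: "\<bar>exp (- x) - exp (- y)\<bar> \<le> \<bar>x - y\<bar> * exp (- z)" if "z \<le> x" "z \<le> y" for x y z :: real
    proof -
      have *: "exp (- x) - exp (- y) \<le> (y - x) * exp (- z)" if "x \<le> y" "z \<le> x" for x y
      proof -
        have "exp (- x) - exp (- y) = exp (- x) * (1 - exp (- (y - x)))"
          by (simp add: right_diff_distrib mult_exp_exp)
        also have "\<dots> \<le> exp (- x) * (y - x)"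
          using exp_ge_add_one_self[of "- (y - x)"] by (intro mult_left_mono) (auto simp: algebra_simps)
        also have "\<dots> \<le> exp (- z) * (y - x)" using that by (intro mult_right_mono) auto
        finally show ?thesis by (simp add: mult.commute)
      qed
      show ?thesis
      proof (cases "x \<le> y")
        case True
        then show ?thesis using *[OF True that(1)] by simp
      next
        case False
        then show ?thesis using *[of y x] that(2) by simp
      qed
    qed
    have "\<bar>exp (- (t\<^sup>2 * Ak)) - exp (- (t\<^sup>2 / 2))\<bar> \<le> \<bar>t\<^sup>2 * Ak - t\<^sup>2 / 2\<bar> * exp (- (t\<^sup>2 / 2000))"
      using mult_left_mono[OF Ak_ge, of "t\<^sup>2"] by (intro ed) auto
    also have "\<bar>t\<^sup>2 * Ak - t\<^sup>2 / 2\<bar> = t\<^sup>2 * \<bar>Ak - 1 / 2\<bar>"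
    proof -
      have "t\<^sup>2 * Ak - t\<^sup>2 / 2 = t\<^sup>2 * (Ak - 1 / 2)" by (simp add: right_diff_distrib)
      then show ?thesis by (simp only: abs_mult abs_power2)
    qed
    also have "\<dots> \<le> t\<^sup>2 * (1440 * (moment_const d 4)\<^sup>2 * real k * sqrt \<delta>)"
      unfolding Ak_def by (intro mult_left_mono half_sum_approx) auto
    finally have "\<bar>exp (- (t\<^sup>2 * Ak)) - exp (- (t\<^sup>2 / 2))\<bar>
      \<le> t\<^sup>2 * (1440 * (moment_const d 4)\<^sup>2 * real k * sqrt \<delta>) * exp (- (t\<^sup>2 / 2000))" by simp
    moreover have "norm (complex_of_real (b.G k) - exp (- t\<^sup>2 / 2)) = \<bar>exp (- (t\<^sup>2 * Ak)) - exp (- (t\<^sup>2 / 2))\<bar>"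
      unfolding of_real_diff[symmetric] norm_of_real b.G_def Ak by simp
    ultimately show ?thesis by (simp add: mult_ac)
  qed
  have "norm (b.F k - exp (- t\<^sup>2 / 2)) \<le> norm (b.F k - b.G k) + norm (complex_of_real (b.G k) - exp (- t\<^sup>2 / 2))"
    using norm_triangle_ineq[of "b.F k - b.G k" "complex_of_real (b.G k) - exp (- t\<^sup>2 / 2)"] by simp
  moreover have "50000 / c0 * u * exp (- (c0 * u\<^sup>2 / 2) * k) \<le> 50000 / c0 * u * exp (- t\<^sup>2 / 2000)"
    using c0 u0 decay by (intro mult_left_mono) auto
  ultimately show ?thesis using main G unfolding F by (simp add: algebra_simps)
qed

end

section \<open>From characteristic functions to the Kolmogorov distance\<close>

lemma std_normal_expectation_le:
  assumes g: "integrable lborel g" and nonneg: "\<And>z. 0 \<le> (g z :: real)"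
  shows "integrable std_normal_distribution g" "(LINT z|std_normal_distribution. g z) \<le> (LINT z|lborel. g z) / 2"
proof -
  have d: "std_normal_density z \<le> 1 / 2" "0 \<le> std_normal_density z" for z
  proof -
    have "4 \<le> 2 * pi" using pi_gt3 by simp
    then have "sqrt 4 \<le> sqrt (2 * pi)" by (rule real_sqrt_le_mono)
    then have "1 / sqrt (2 * pi) \<le> 1 / 2" by (intro divide_left_mono) auto
    then have "1 / sqrt (2 * pi) * exp (- z\<^sup>2 / 2) \<le> 1 / 2 * 1" by (intro mult_mono) auto
    then show "std_normal_density z \<le> 1 / 2" by (simp add: std_normal_density_def)
  qed auto
  have [measurable]: "g \<in> borel_measurable lborel" using g by auto
  have gi: "integrable lborel (\<lambda>z. std_normal_density z * g z)"
  proof (rule Bochner_Integration.integrable_bound[OF g])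
    show "AE z in lborel. norm (std_normal_density z * g z) \<le> norm (g z)"
    proof (rule AE_I2)
      fix z
      have "std_normal_density z * g z \<le> 1 * g z" using d[of z] nonneg[of z] by (intro mult_right_mono) linarith+
      then show "norm (std_normal_density z * g z) \<le> norm (g z)" using d[of z] nonneg[of z] by simp
    qed
  qed measurable
  then show "integrable std_normal_distribution g"
    by (subst integrable_density) auto
  have "(LINT z|std_normal_distribution. g z) = (LINT z|lborel. std_normal_density z * g z)"
    by (subst integral_density) auto
  also have "\<dots> \<le> (LINT z|lborel. 1 / 2 * g z)"
    using gi g d nonneg by (intro integral_mono mult_right_mono) auto
  finally show "(LINT z|std_normal_distribution. g z) \<le> (LINT z|lborel. g z) / 2" by simp
qed

text \<open>The density is at most 1/2, and the Lebesgue integral is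
  \<open>sqrt (2 * pi) * sqrt 2000 * s\<close>, at most \<open>3 * 45 * s\<close>.\<close>

lemma std_normal_expectation_gaussian:
  assumes s: "0 < (s::real)"
  shows "integrable std_normal_distribution (\<lambda>z. exp (- (z / s)\<^sup>2 / 4000))"
    "(LINT z|std_normal_distribution. exp (- (z / s)\<^sup>2 / 4000)) \<le> 68 * s"
proof -
  define r where "r = sqrt 2000 * s"
  have r: "0 < r" "r\<^sup>2 = 2000 * s\<^sup>2" using s by (auto simp: r_def power_mult_distrib)
  have eq: "exp (- (z / s)\<^sup>2 / 4000) = sqrt (2 * pi) * r * normal_density 0 r z" for z
  proof -
    have "sqrt (2 * pi * r\<^sup>2) = sqrt (2 * pi) * sqrt (r\<^sup>2)" by (rule real_sqrt_mult)
    also have "sqrt (r\<^sup>2) = r" using r(1) by simp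
    finally have "sqrt (2 * pi * r\<^sup>2) = sqrt (2 * pi) * r" .
    moreover have "- (z / s)\<^sup>2 / 4000 = - (z - 0)\<^sup>2 / (2 * r\<^sup>2)" using s r by (simp add: power_divide)
    ultimately show ?thesis using r by (simp add: normal_density_def)
  qed
  have i: "integrable lborel (\<lambda>z. exp (- (z / s)\<^sup>2 / 4000))"
    unfolding eq using r by (intro integrable_mult_right) simp
  show "integrable std_normal_distribution (\<lambda>z. exp (- (z / s)\<^sup>2 / 4000))"
    by (rule std_normal_expectation_le[OF i]) simp
  have "(LINT z|std_normal_distribution. exp (- (z / s)\<^sup>2 / 4000)) \<le> (LINT z|lborel. exp (- (z / s)\<^sup>2 / 4000)) / 2"
    by (rule std_normal_expectation_le[OF i]) simp
  also have "(LINT z|lborel. exp (- (z / s)\<^sup>2 / 4000)) = sqrt (2 * pi) * r"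
    unfolding eq using r by simp
  also have "sqrt (2 * pi) * r \<le> 3 * (45 * s)"
  proof (intro mult_mono)
    have "2 * pi \<le> 3\<^sup>2" using pi_less_4 by simp
    then show "sqrt (2 * pi) \<le> 3" by (intro real_le_lsqrt) auto
    have "sqrt 2000 \<le> 45" by (intro real_le_lsqrt) auto
    then show "r \<le> 45 * s" using s by (simp add: r_def)
  qed (use r in auto)
  finally show "(LINT z|std_normal_distribution. exp (- (z / s)\<^sup>2 / 4000)) \<le> 68 * s" using s by simp
qed

lemma std_normal_expectation_inverse:
  assumes ab: "0 < a" "a \<le> (b::real)"
  shows "integrable std_normal_distribution (\<lambda>z. indicator {z. a \<le> \<bar>z\<bar> \<and> \<bar>z\<bar> \<le> b} z / \<bar>z\<bar>)"
    "(LINT z|std_normal_distribution. indicator {z. a \<le> \<bar>z\<bar> \<and> \<bar>z\<bar> \<le> b} z / \<bar>z\<bar>) \<le> ln (b / a)"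
proof -
  have p: "has_bochner_integral lborel (\<lambda>z. inverse z * indicator {a..b} z) (ln b - ln a)"
    using ab by (intro has_bochner_integral_FTC_Icc_real[where F=ln])
      (auto intro!: derivative_eq_intros continuous_intros simp: has_real_derivative_iff_has_vector_derivative[symmetric] divide_inverse)
  have m: "has_bochner_integral lborel (\<lambda>z. (- inverse z) * indicator {- b..- a} z) (- ln (- (- a)) - (- ln (- (- b))))"
    using ab by (intro has_bochner_integral_FTC_Icc_real[where F="\<lambda>z. - ln (- z)"])
      (auto intro!: derivative_eq_intros continuous_intros simp: has_real_derivative_iff_has_vector_derivative[symmetric] divide_inverse)
  have eq: "indicator {z. a \<le> \<bar>z\<bar> \<and> \<bar>z\<bar> \<le> b} z / \<bar>z\<bar>
      = inverse z * indicator {a..b} z + (- inverse z) * indicator {- b..- a} z" for z :: real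
    using ab by (auto simp: indicator_def divide_inverse)
  have s: "has_bochner_integral lborel (\<lambda>z. indicator {z. a \<le> \<bar>z\<bar> \<and> \<bar>z\<bar> \<le> b} z / \<bar>z\<bar>) (2 * (ln b - ln a))"
    unfolding eq using has_bochner_integral_add[OF p m] by simp
  then have i: "integrable lborel (\<lambda>z. indicator {z. a \<le> \<bar>z\<bar> \<and> \<bar>z\<bar> \<le> b} z / \<bar>z\<bar> :: real)"
    by (rule integrable.intros)
  show "integrable std_normal_distribution (\<lambda>z. indicator {z. a \<le> \<bar>z\<bar> \<and> \<bar>z\<bar> \<le> b} z / \<bar>z\<bar> :: real)"
    by (rule std_normal_expectation_le[OF i]) (auto simp: indicator_def)
  have "(LINT z|std_normal_distribution. indicator {z. a \<le> \<bar>z\<bar> \<and> \<bar>z\<bar> \<le> b} z / \<bar>z\<bar>)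
      \<le> (LINT z|lborel. indicator {z. a \<le> \<bar>z\<bar> \<and> \<bar>z\<bar> \<le> b} z / \<bar>z\<bar>) / 2"
    by (rule std_normal_expectation_le[OF i]) (auto simp: indicator_def)
  then show "(LINT z|std_normal_distribution. indicator {z. a \<le> \<bar>z\<bar> \<and> \<bar>z\<bar> \<le> b} z / \<bar>z\<bar>) \<le> ln (b / a)"
    using has_bochner_integral_integral_eq[OF s] ab by (simp add: ln_div)
qed

lemma std_normal_tail_le:
  assumes a: "0 \<le> a"
  shows "integrable std_normal_distribution (\<lambda>z. indicator {z. a < \<bar>z\<bar>} z :: real)"
    "(LINT z|std_normal_distribution. indicator {z. a < \<bar>z\<bar>} z) \<le> 2 * exp (- a\<^sup>2 / 4)"
proof -
  interpret N: real_distribution std_normal_distribution by (rule real_dist_normal_dist)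
  show i: "integrable std_normal_distribution (\<lambda>z. indicator {z. a < \<bar>z\<bar>} z :: real)"
    by (rule N.integrable_const_bound[where B=1]) (auto simp: indicator_def)
  have pw: "std_normal_density z * indicator {z. a < \<bar>z\<bar>} z \<le> exp (- a\<^sup>2 / 4) * sqrt 2 * normal_density 0 (sqrt 2) z" for z
  proof (cases "a < \<bar>z\<bar>")
    case True
    then have "a\<^sup>2 \<le> z\<^sup>2" using a by (metis abs_le_square_iff abs_of_nonneg less_imp_le)
    then have "exp (- z\<^sup>2 / 2) \<le> exp (- a\<^sup>2 / 4) * exp (- z\<^sup>2 / 4)"
      unfolding mult_exp_exp by simp
    moreover have "exp (- a\<^sup>2 / 4) * sqrt 2 * normal_density 0 (sqrt 2) z = exp (- a\<^sup>2 / 4) * exp (- z\<^sup>2 / 4) * (1 / sqrt (2 * pi))"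
    proof -
      have "sqrt (2 * pi * (sqrt 2)\<^sup>2) = sqrt 2 * sqrt (2 * pi)" by (simp add: real_sqrt_mult)
      then have "sqrt 2 * normal_density 0 (sqrt 2) z = exp (- z\<^sup>2 / 4) * (1 / sqrt (2 * pi))"
        by (simp only: normal_density_def) simp
      then show ?thesis by (simp only: mult.assoc)
    qed
    ultimately show ?thesis using True by (simp add: std_normal_density_def divide_right_mono)
  qed simp
  have "(LINT z|std_normal_distribution. indicator {z. a < \<bar>z\<bar>} z)
      = (LINT z|lborel. std_normal_density z * indicator {z. a < \<bar>z\<bar>} z)"
    by (subst integral_density) auto
  also have "\<dots> \<le> (LINT z|lborel. exp (- a\<^sup>2 / 4) * sqrt 2 * normal_density 0 (sqrt 2) z)"
    by (rule integral_mono_AE') (use pw in \<open>auto intro!: integrable_mult_right\<close>)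
  also have "\<dots> = exp (- a\<^sup>2 / 4) * sqrt 2" by simp
  also have "\<dots> \<le> exp (- a\<^sup>2 / 4) * 2" by (intro mult_left_mono real_le_lsqrt) auto
  finally show "(LINT z|std_normal_distribution. indicator {z. a < \<bar>z\<bar>} z) \<le> 2 * exp (- a\<^sup>2 / 4)" by simp
qed

text \<open>For use near the origin, where the block estimate has an error without a factor t and
  the weight \<open>1 / t\<close> is not integrable.\<close>

lemma (in real_distribution) char_diff_quadratic:
  assumes i1: "integrable M (\<lambda>x. x)" and i2: "integrable M (\<lambda>x. x\<^sup>2)"
    and m1: "expectation (\<lambda>x. x) = 0" and m2: "expectation (\<lambda>x. x\<^sup>2) = 1"
  shows "norm (char M t - exp (- t\<^sup>2 / 2)) \<le> t\<^sup>2"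
proof -
  have iy: "integrable M (\<lambda>x. complex_of_real x)" "expectation (\<lambda>x. complex_of_real x) = 0"
    using i1 m1 by (auto simp: integral_complex_of_real)
  have ie: "integrable M (\<lambda>x. iexp (t * x))" by (intro integrable_iexp) auto
  have "char M t - 1 = expectation (\<lambda>x. iexp (t * x) - 1 - \<i> * t * complex_of_real x)"
    unfolding char_def using ie iy prob_space by simp
  also have "norm \<dots> \<le> expectation (\<lambda>x. norm (iexp (t * x) - 1 - \<i> * t * complex_of_real x))"
    by (rule integral_norm_bound)
  also have "\<dots> \<le> expectation (\<lambda>x. t\<^sup>2 / 2 * x\<^sup>2)"
  proof (intro integral_mono)
    fix x
    show "norm (iexp (t * x) - 1 - \<i> * t * complex_of_real x) \<le> t\<^sup>2 / 2 * x\<^sup>2"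
      using iexp_approx1[of "t * x" 1] by (simp add: diff_diff_eq power2_eq_square mult_ac abs_mult)
  qed (use ie iy i2 in auto)
  also have "\<dots> = t\<^sup>2 / 2" using m2 by simp
  finally have 1: "norm (char M t - 1) \<le> t\<^sup>2 / 2" .
  have "norm (1 - complex_of_real (exp (- t\<^sup>2 / 2))) = \<bar>1 - exp (- t\<^sup>2 / 2)\<bar>"
    by (metis norm_of_real of_real_1 of_real_diff)
  also have "\<dots> \<le> t\<^sup>2 / 2" using exp_ge_add_one_self[of "- t\<^sup>2 / 2"] by simp
  finally have 2: "norm (1 - complex_of_real (exp (- t\<^sup>2 / 2))) \<le> t\<^sup>2 / 2" .
  have "char M t - exp (- t\<^sup>2 / 2) = (char M t - 1) + (1 - complex_of_real (exp (- t\<^sup>2 / 2)))"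
    by (simp add: exp_of_real)
  then show ?thesis using norm_triangle_ineq[of "char M t - 1" "1 - complex_of_real (exp (- t\<^sup>2 / 2))"] 1 2 by simp
qed

text \<open>Three ranges of t: below \<rho> the quadratic bound, up to T the hypothesis, beyond T
  the trivial bound 2, made harmless by the Gaussian tail of the smoothing. The part H has no factor
  t and is integrated against \<open>1 / t\<close>, whence the logarithm.\<close>

lemma (in real_distribution) kolmogorov_le_of_char:
  assumes i1: "integrable M (\<lambda>x. x)" and i2: "integrable M (\<lambda>x. x\<^sup>2)"
    and m1: "expectation (\<lambda>x. x) = 0" and m2: "expectation (\<lambda>x. x\<^sup>2) = 1"
    and \<rho>: "0 < \<rho>" "\<rho> \<le> T" and s: "0 < s" and R: "0 \<le> R" and H: "0 \<le> H"
    and mid: "\<And>t. \<rho> \<le> \<bar>t\<bar> \<Longrightarrow> \<bar>t\<bar> \<le> T \<Longrightarrow>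
        norm (char M t - exp (- t\<^sup>2 / 2)) \<le> \<bar>t\<bar> * (R * exp (- t\<^sup>2 / 4000)) + H"
  shows "\<bar>cdf M x - cdf std_normal_distribution x\<bar>
    \<le> 2 * (\<rho>\<^sup>2 + 68 * R + H * ln (T / \<rho>) + 4 / (T * s) * exp (- (T * s)\<^sup>2 / 4)) + 2 * s"
proof -
  interpret N: real_distribution std_normal_distribution by (rule real_dist_normal_dist)
  have T: "0 < T" using \<rho> by simp
  define h where "h t = \<rho> * indicator {t. \<bar>t\<bar> \<le> \<rho>} t + R * exp (- t\<^sup>2 / 4000)
      + H * (indicator {t. \<rho> \<le> \<bar>t\<bar> \<and> \<bar>t\<bar> \<le> T} t / \<bar>t\<bar>) + 2 / T * indicator {t. T < \<bar>t\<bar>} t" for t :: real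
  have h0: "0 \<le> h t" for t using \<rho> T R H by (simp add: h_def indicator_def)
  have le_h: "norm (char M t - char std_normal_distribution t) \<le> \<bar>t\<bar> * h t" for t
  proof -
    have cN: "char std_normal_distribution t = exp (- t\<^sup>2 / 2)"
      by (simp add: char_std_normal_distribution exp_of_real)
    consider "\<bar>t\<bar> < \<rho>" | "\<rho> \<le> \<bar>t\<bar>" "\<bar>t\<bar> \<le> T" | "T < \<bar>t\<bar>" by linarith
    then show ?thesis
    proof cases
      case 1
      have "norm (char M t - exp (- t\<^sup>2 / 2)) \<le> t\<^sup>2" by (rule char_diff_quadratic[OF i1 i2 m1 m2])
      also have "t\<^sup>2 = \<bar>t\<bar> * \<bar>t\<bar>" by (simp add: power2_eq_square)
      also have "\<dots> \<le> \<bar>t\<bar> * h t" using 1 \<rho> R by (intro mult_left_mono) (auto simp: h_def indicator_def intro: order_trans[OF less_imp_le] add_increasing2)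
      finally show ?thesis unfolding cN .
    next
      case 2
      have "\<bar>t\<bar> * (R * exp (- t\<^sup>2 / 4000)) + H = \<bar>t\<bar> * (R * exp (- t\<^sup>2 / 4000) + H * (1 / \<bar>t\<bar>))"
        using 2 \<rho> by (simp add: distrib_left)
      also have "\<dots> \<le> \<bar>t\<bar> * h t" using 2 \<rho> by (intro mult_left_mono) (auto simp: h_def indicator_def)
      finally show ?thesis using mid[OF 2] unfolding cN by linarith
    next
      case 3
      have "norm (char M t - char std_normal_distribution t) \<le> 1 + 1"
        by (intro order_trans[OF norm_triangle_ineq4] add_mono cmod_char_le_1 N.cmod_char_le_1)
      also have "\<dots> = T * (2 / T)" using T by simp
      also have "\<dots> \<le> \<bar>t\<bar> * (2 / T)" using 3 T by (intro mult_right_mono) auto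
      also have "\<dots> \<le> \<bar>t\<bar> * h t" using 3 \<rho> R by (intro mult_left_mono) (auto simp: h_def indicator_def)
      finally show ?thesis .
    qed
  qed
  have p1: "integrable std_normal_distribution (\<lambda>z. indicator {- (\<rho> * s)..\<rho> * s} z :: real)"
    "(LINT z|std_normal_distribution. indicator {- (\<rho> * s)..\<rho> * s} z :: real) \<le> \<rho> * s"
  proof -
    have i: "integrable lborel (\<lambda>z. indicator {- (\<rho> * s)..\<rho> * s} z :: real)"
      using \<rho> s by (intro integrable_real_indicator) (auto simp: emeasure_lborel_Icc_eq)
    show "integrable std_normal_distribution (\<lambda>z. indicator {- (\<rho> * s)..\<rho> * s} z :: real)"
      by (rule std_normal_expectation_le[OF i]) simp
    have "(LINT z|std_normal_distribution. indicator {- (\<rho> * s)..\<rho> * s} z :: real) \<le> (LINT z|lborel. indicator {- (\<rho> * s)..\<rho> * s} z :: real) / 2"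
      by (rule std_normal_expectation_le[OF i]) simp
    then show "(LINT z|std_normal_distribution. indicator {- (\<rho> * s)..\<rho> * s} z :: real) \<le> \<rho> * s"
      using \<rho> s by simp
  qed
  note p2 = std_normal_expectation_gaussian[OF s]
  note p3 = std_normal_expectation_inverse[of "\<rho> * s" "T * s"]
  note p4 = std_normal_tail_le[of "T * s"]
  have hz: "h (- z / s) = \<rho> * indicator {- (\<rho> * s)..\<rho> * s} z + R * exp (- (z / s)\<^sup>2 / 4000)
      + H * s * (indicator {z. \<rho> * s \<le> \<bar>z\<bar> \<and> \<bar>z\<bar> \<le> T * s} z / \<bar>z\<bar>) + 2 / T * indicator {z. T * s < \<bar>z\<bar>} z" for z
  proof -
    have "indicator {t. \<bar>t\<bar> \<le> \<rho>} (- z / s) = (indicator {- (\<rho> * s)..\<rho> * s} z :: real)"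
      using s by (auto simp: indicator_def abs_le_iff field_simps)
    moreover have "indicator {t. \<rho> \<le> \<bar>t\<bar> \<and> \<bar>t\<bar> \<le> T} (- z / s) = (indicator {z. \<rho> * s \<le> \<bar>z\<bar> \<and> \<bar>z\<bar> \<le> T * s} z :: real)"
      "indicator {t. T < \<bar>t\<bar>} (- z / s) = (indicator {z. T * s < \<bar>z\<bar>} z :: real)"
      using s by (auto simp: indicator_def abs_div field_simps)
    ultimately show ?thesis using s by (simp add: h_def power_divide)
  qed
  have q: "0 < \<rho> * s" "\<rho> * s \<le> T * s" "0 \<le> T * s" using \<rho> s T by auto
  note p3 = p3[OF q(1,2)] and p4 = p4[OF q(3)]
  have ih: "integrable std_normal_distribution (\<lambda>z. h (- z / s))"
    unfolding hz by (intro Bochner_Integration.integrable_add integrable_mult_right p1 p2 p3 p4)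
  have "(LINT z|std_normal_distribution. h (- z / s))
      = \<rho> * (LINT z|std_normal_distribution. indicator {- (\<rho> * s)..\<rho> * s} z)
        + R * (LINT z|std_normal_distribution. exp (- (z / s)\<^sup>2 / 4000))
        + H * s * (LINT z|std_normal_distribution. indicator {z. \<rho> * s \<le> \<bar>z\<bar> \<and> \<bar>z\<bar> \<le> T * s} z / \<bar>z\<bar>)
        + 2 / T * (LINT z|std_normal_distribution. indicator {z. T * s < \<bar>z\<bar>} z)"
    unfolding hz using p1(1) p2(1) p3(1) p4(1)
    by (simp only: Bochner_Integration.integral_add Bochner_Integration.integrable_add integrable_mult_right
        integral_mult_right_zero)
  also have "\<dots> \<le> \<rho> * (\<rho> * s) + R * (68 * s) + H * s * ln ((T * s) / (\<rho> * s)) + 2 / T * (2 * exp (- (T * s)\<^sup>2 / 4))"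
    using \<rho> R H s T by (intro add_mono mult_left_mono p1 p2 p3 p4) auto
  also have "\<dots> = (\<rho>\<^sup>2 + 68 * R + H * ln (T / \<rho>) + 4 / (T * s) * exp (- (T * s)\<^sup>2 / 4)) * s"
    using s T by (simp add: field_simps power2_eq_square)
  finally have eps: "(LINT z|std_normal_distribution. h (- z / s)) / s
      \<le> \<rho>\<^sup>2 + 68 * R + H * ln (T / \<rho>) + 4 / (T * s) * exp (- (T * s)\<^sup>2 / 4)"
    using s by (simp add: pos_divide_le_eq)
  show ?thesis
  proof (rule cdf_dist_std_normal_le[OF s])
    fix x
    show "\<bar>(LINT z|std_normal_distribution. cdf M (x - s * z) - cdf std_normal_distribution (x - s * z))\<bar>
       \<le> \<rho>\<^sup>2 + 68 * R + H * ln (T / \<rho>) + 4 / (T * s) * exp (- (T * s)\<^sup>2 / 4)"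
      by (rule order_trans[OF smoothed_cdf_diff_le[OF i1 s le_h h0 ih] eps])
  qed
qed

section \<open>Choice of the parameters for one row\<close>

definition char_scale :: "nat \<Rightarrow> real" where "char_scale d = 3 / (1280 * (moment_max d)\<^sup>2)"
definition freq_bound :: "nat \<Rightarrow> real" where "freq_bound d = char_scale d / 32800"

text \<open>The sum of the constants in front of the four error terms of a row, so that it dominates
  each of them.\<close>

definition rate_const :: "nat \<Rightarrow> real" where
  "rate_const d = 136 * (50000 / char_scale d * moment_max d) + 8 * moment_max d / freq_bound d
     + 136 * 32 * 1440 * (moment_const d 4)\<^sup>2 * 160 + 4 * 10 * 160 * 768 + 4"

text \<open>The exponent 18 brings the truncation error below \<open>\<sigma> powr (- 4)\<close>: at
  least \<open>ln \<sigma> / 4\<close> factors \<open>2 * freq_bound d\<close> are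
  available.\<close>

lemma char_scale_pos: "0 < char_scale d" and freq_bound_pos: "0 < freq_bound d"
  and freq_bound_small: "2 * freq_bound d \<le> exp (- 18)"
proof -
  have m: "81 \<le> (moment_max d)\<^sup>2" using power_mono[OF moment_max_ge(4)[of d], of 2] by simp
  then have m0: "0 < (moment_max d)\<^sup>2" by linarith
  then show "0 < char_scale d" by (simp add: char_scale_def)
  then show "0 < freq_bound d" by (simp add: freq_bound_def)
  have "char_scale d \<le> 3 / (1280 * 81)" unfolding char_scale_def using m by (intro divide_left_mono) auto
  then have "2 * freq_bound d \<le> 1 / 3 ^ 18" by (simp add: freq_bound_def)
  also have "\<dots> \<le> 1 / exp 18"
  proof (intro divide_left_mono)
    have "exp (18 :: real) = exp 1 ^ 18" by (simp add: exp_of_nat_mult[symmetric])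
    also have "\<dots> \<le> 3 ^ 18" by (intro power_mono exp_le) auto
    finally show "exp (18 :: real) \<le> 3 ^ 18" .
  qed auto
  finally show "2 * freq_bound d \<le> exp (- 18)" by (simp add: exp_minus field_simps)
qed

text \<open>Trades a surplus factor t for half of the Gaussian decay of the block estimate.\<close>

lemma abs_le_exp_quadratic: "\<bar>t :: real\<bar> \<le> 32 * exp (t\<^sup>2 / 4000)"
proof -
  have "0 \<le> (\<bar>t\<bar> - 125 / 2)\<^sup>2" by simp
  then have "\<bar>t\<bar> \<le> 32 * (1 + t\<^sup>2 / 4000)" by (simp add: power2_diff power_divide)
  also have "\<dots> \<le> 32 * exp (t\<^sup>2 / 4000)" by (intro mult_left_mono exp_ge_add_one_self) simp
  finally show ?thesis .
qed

context blocked_row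
begin

text \<open>The width s is such that \<open>T * s = 4 * sqrt (ln \<sigma>)\<close>, which makes the
  smoothing tail beyond T of order \<open>\<sigma> powr (- 4)\<close>. With the chosen \<nu> the
  factor \<open>2^\<nu>\<close> in the mixing error is at most
  \<open>8 * sqrt \<sigma>\<close>.\<close>

lemma kolmogorov_row:
  defines "\<sigma> \<equiv> sqrt s2"
  assumes ln1: "1 \<le> ln \<sigma>" and large_\<sigma>: "moment_max d / freq_bound d \<le> \<sigma>" and V1: "1 \<le> V" "V \<le> \<sigma>\<^sup>2"
  shows "\<bar>measure M {x \<in> space M. S 0 n x / \<sigma> \<le> x0} - cdf std_normal_distribution x0\<bar>
    \<le> rate_const d * (sqrt (ln \<sigma>) * sqrt V / \<sigma> + \<sigma>\<^sup>2 / V * sqrt \<delta>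
        + ln \<sigma> * (\<sigma>\<^sup>2 / V) * (sqrt \<sigma> * \<delta> + \<sigma> powr (- 4)) + \<sigma> powr (- 2))"
proof -
  define mm where "mm = moment_max d"
  define c0 where "c0 = char_scale d"
  define u0 where "u0 = freq_bound d"
  have mm: "9 \<le> mm" using moment_max_ge(4) by (simp add: mm_def)
  have c0: "0 < c0" and u0: "0 < u0" "2 * u0 \<le> exp (- 18)" "u0 = c0 / 32800"
    using char_scale_pos freq_bound_pos freq_bound_small by (auto simp: c0_def u0_def freq_bound_def)
  have \<sigma>0: "0 < \<sigma>" "\<sigma>\<^sup>2 = s2" using s2_pos by (auto simp: \<sigma>_def)
  have \<sigma>1: "1 < \<sigma>" using ln1 \<sigma>0 by (metis ln_gt_zero_iff less_le_trans zero_less_one)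
  have \<delta>0: "0 \<le> \<delta>" using al_pos[of gap] by (simp add: \<delta>_def)
  define \<Lambda> where "\<Lambda> = mm * sqrt V / \<sigma>"
  have \<Lambda>: "0 < \<Lambda>" using mm V1 \<sigma>0 by (simp add: \<Lambda>_def)
  \<comment> \<open>The frequency at which \<open>\<bar>t\<bar> * \<Lambda>\<close> reaches the
    admissible bound \<open>u0\<close>.\<close>
  define T where "T = u0 / \<Lambda>"
  \<comment> \<open>Small enough for \<open>\<rho>^2\<close> to be negligible, yet
    \<open>ln (T / \<rho>)\<close> stays below \<open>2 * ln \<sigma>\<close>.\<close>
  define \<rho> where "\<rho> = 1 / \<sigma>"
  define s where "s = 4 * sqrt (ln \<sigma>) / T"
  define \<nu> where "\<nu> = nat \<lceil>ln \<sigma> / 2\<rceil> + 2"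
  define C4 where "C4 = 1440 * (moment_const d 4)\<^sup>2"
  define R where "R = 50000 / c0 * \<Lambda> + 32 * C4 * k * sqrt \<delta>"
  define H where "H = 10 * (96 * 2 ^ \<nu> * \<delta> + 2 * (2 * u0) ^ (Suc \<nu> div 2)) * k"
  have T: "0 < T" using u0 \<Lambda> by (simp add: T_def)
  have \<rho>: "0 < \<rho>" using \<sigma>0 by (simp add: \<rho>_def)
  have s: "0 < s" using T ln1 by (simp add: s_def)
  have Ts: "T * s = 4 * sqrt (ln \<sigma>)" using T by (simp add: s_def)
  have C4: "0 \<le> C4" by (simp add: C4_def)
  have R: "0 \<le> R" using c0 \<Lambda> C4 \<delta>0 by (simp add: R_def)
  have H: "0 \<le> H" using u0 \<delta>0 by (simp add: H_def)
  have sV: "1 \<le> sqrt V" "sqrt V \<le> \<sigma>" using V1 \<sigma>0 by (auto simp: real_le_lsqrt)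
  have \<rho>T: "\<rho> \<le> T"
  proof -
    have "\<Lambda> \<le> mm" using sV mm \<sigma>0 by (simp add: \<Lambda>_def divide_le_eq)
    also have "mm \<le> u0 * \<sigma>" using large_\<sigma> u0 by (simp add: mm_def u0_def field_simps)
    finally show ?thesis using \<sigma>0 \<Lambda> by (simp add: \<rho>_def T_def field_simps)
  qed
  interpret D: real_distribution "distr M borel (\<lambda>x. S 0 n x / \<sigma>)"
    by (rule real_distribution_distr) (use S_measurable[of n 0] in simp)
  have SM[measurable]: "S 0 n \<in> borel_measurable M" by (rule S_measurable) simp
  have i1: "integrable (distr M borel (\<lambda>x. S 0 n x / \<sigma>)) (\<lambda>x. x)"
    using S_integrable[of n 0] by (simp add: integrable_distr_eq)
  have i2: "integrable (distr M borel (\<lambda>x. S 0 n x / \<sigma>)) (\<lambda>x. x\<^sup>2)"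
    using S2_integrable[of n 0] by (simp add: integrable_distr_eq power_divide)
  have m1: "D.expectation (\<lambda>x. x) = 0"
    using S_mean[of n 0] by (simp add: integral_distr)
  have m2: "D.expectation (\<lambda>x. x\<^sup>2) = 1"
    using \<sigma>0 s2_pos by (simp add: integral_distr power_divide s2_def[symmetric])
  have ch: "char (distr M borel (\<lambda>x. S 0 n x / \<sigma>)) t = expectation (\<lambda>x. iexp (t * (S 0 n x / sqrt s2)))" for t
    unfolding char_def by (subst integral_distr) (auto simp: \<sigma>_def)
  have mid: "norm (char (distr M borel (\<lambda>x. S 0 n x / \<sigma>)) t - exp (- t\<^sup>2 / 2)) \<le> \<bar>t\<bar> * (R * exp (- t\<^sup>2 / 4000)) + H"
    if t: "\<rho> \<le> \<bar>t\<bar>" "\<bar>t\<bar> \<le> T" for t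
  proof -
    have t0: "t \<noteq> 0" using t \<rho> by auto
    define u where "u = \<bar>t\<bar> * \<Lambda>"
    have u: "u \<le> u0" using t(2) \<Lambda> by (simp add: u_def T_def pos_le_divide_eq)
    have u_nn: "0 \<le> u" using \<Lambda> by (simp add: u_def)
    have "norm (char (distr M borel (\<lambda>x. S 0 n x / \<sigma>)) t - exp (- t\<^sup>2 / 2))
      \<le> exp (- t\<^sup>2 / 2000) * (50000 / c0 * u + C4 * t\<^sup>2 * k * sqrt \<delta>)
         + 10 * (96 * 2 ^ \<nu> * \<delta> + 2 * (2 * u) ^ (Suc \<nu> div 2)) * k"
      using char_sum_approx[OF t0, of \<nu>] u unfolding ch
      by (simp add: u_def \<Lambda>_def \<sigma>_def mm_def c0_def char_scale_def u0 C4_def \<nu>_def)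
    also have "10 * (96 * 2 ^ \<nu> * \<delta> + 2 * (2 * u) ^ (Suc \<nu> div 2)) * k \<le> H"
      unfolding H_def using u u_nn by (intro mult_right_mono mult_left_mono add_left_mono power_mono) auto
    also have "exp (- t\<^sup>2 / 2000) * (50000 / c0 * u + C4 * t\<^sup>2 * k * sqrt \<delta>) \<le> \<bar>t\<bar> * (R * exp (- t\<^sup>2 / 4000))"
    proof -
      \<comment> \<open>The decay is split into two equal factors: one is kept, the other absorbs
        the surplus factor t of the second term.\<close>
      define E where "E = exp (- t\<^sup>2 / 4000)"
      have E: "0 < E" "E \<le> 1" "exp (- t\<^sup>2 / 2000) = E * E" by (auto simp: E_def mult_exp_exp)
      have tE: "\<bar>t\<bar> * E \<le> 32"
      proof -
        have "exp (t\<^sup>2 / 4000) * E = 1" by (simp add: E_def exp_minus)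
        then show ?thesis using mult_right_mono[OF abs_le_exp_quadratic[of t], of E] E(1) by (simp add: mult.assoc)
      qed
      have "t\<^sup>2 = \<bar>t\<bar> * \<bar>t\<bar>" by (simp add: power2_eq_square)
      then have "E * E * (50000 / c0 * u + C4 * t\<^sup>2 * k * sqrt \<delta>)
          = \<bar>t\<bar> * E * (E * (50000 / c0 * \<Lambda>) + (\<bar>t\<bar> * E) * (C4 * k * sqrt \<delta>))"
        by (simp add: u_def algebra_simps)
      also have "\<dots> \<le> \<bar>t\<bar> * E * (1 * (50000 / c0 * \<Lambda>) + 32 * (C4 * k * sqrt \<delta>))"
        using E tE c0 \<Lambda> C4 \<delta>0 by (intro mult_left_mono add_mono mult_right_mono) auto
      finally show ?thesis unfolding E(3) by (simp add: R_def E_def mult_ac)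
    qed
    finally show ?thesis by simp
  qed
  have main: "\<bar>cdf (distr M borel (\<lambda>x. S 0 n x / \<sigma>)) x0 - cdf std_normal_distribution x0\<bar>
    \<le> 2 * (\<rho>\<^sup>2 + 68 * R + H * ln (T / \<rho>) + 4 / (T * s) * exp (- (T * s)\<^sup>2 / 4)) + 2 * s"
    by (rule D.kolmogorov_le_of_char[OF i1 i2 m1 m2 \<rho> \<rho>T s R H mid])
  have cdf: "cdf (distr M borel (\<lambda>x. S 0 n x / \<sigma>)) x0 = measure M {x \<in> space M. S 0 n x / \<sigma> \<le> x0}"
    by (subst cdf_def, subst measure_distr) (auto intro!: arg_cong[where f="measure M"])
  have kk: "real k \<le> 160 * (\<sigma>\<^sup>2 / V)"
    using s2_bounds(1) \<sigma>0 V1 by (simp add: pos_le_divide_eq)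
  have kV0: "0 \<le> \<sigma>\<^sup>2 / V" using V1 by simp
  have p4: "\<sigma> powr (- 4) = exp (- 4 * ln \<sigma>)" using \<sigma>0 by (simp add: powr_def)
  have \<sigma>4: "\<sigma> powr (- 4) \<le> \<sigma> powr (- 2)" using \<sigma>1 by (intro powr_mono) auto
  have b\<rho>: "\<rho>\<^sup>2 = \<sigma> powr (- 2)" using \<sigma>0(1) by (simp add: \<rho>_def powr_minus power_inverse divide_inverse powr_numeral)
  have bR: "R \<le> 50000 / c0 * mm * (sqrt V / \<sigma>) + 32 * C4 * 160 * (\<sigma>\<^sup>2 / V * sqrt \<delta>)"
  proof -
    have "32 * C4 * real k * sqrt \<delta> \<le> 32 * C4 * (160 * (\<sigma>\<^sup>2 / V)) * sqrt \<delta>"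
      using kk C4 \<delta>0 by (intro mult_right_mono mult_left_mono) auto
    then show ?thesis by (simp add: R_def \<Lambda>_def mult_ac)
  qed
  have bH: "H \<le> 10 * 160 * 768 * ((\<sigma>\<^sup>2 / V) * (sqrt \<sigma> * \<delta> + \<sigma> powr (- 4)))"
  proof -
    have x: "0 \<le> ln \<sigma> / 2" using ln1 by simp
    have "(2::real) ^ \<nu> = 4 * 2 powr real (nat \<lceil>ln \<sigma> / 2\<rceil>)"
      by (simp add: \<nu>_def power_add powr_realpow)
    also have "\<dots> \<le> 4 * 2 powr (1 + ln \<sigma> / 2)" using x by (intro mult_left_mono powr_mono) linarith+
    also have "\<dots> = 8 * 2 powr (ln \<sigma> / 2)" by (simp add: powr_add)
    also have "2 powr (ln \<sigma> / 2) \<le> exp 1 powr (ln \<sigma> / 2)"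
      using x exp_ge_add_one_self[of 1] by (intro powr_mono2) auto
    also have "exp 1 powr (ln \<sigma> / 2) = sqrt \<sigma>"
      using \<sigma>0 by (simp add: powr_def powr_half_sqrt[symmetric])
    finally have n1: "(2::real) ^ \<nu> \<le> 8 * sqrt \<sigma>" by simp
    have "(2 * u0) ^ (Suc \<nu> div 2) \<le> exp (- 18) ^ (Suc \<nu> div 2)" using u0 by (intro power_mono) auto
    also have "\<dots> = exp (- 18 * real (Suc \<nu> div 2))" by (simp add: exp_of_nat2_mult[symmetric])
    also have "\<dots> \<le> exp (- 4 * ln \<sigma>)"
    proof -
      have "ln \<sigma> / 2 \<le> real \<nu>" using x by (simp add: \<nu>_def) linarith
      moreover have "real \<nu> \<le> 2 * real (Suc \<nu> div 2)" by linarith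
      ultimately have "4 * ln \<sigma> \<le> 18 * real (Suc \<nu> div 2)" using ln1 by linarith
      then show ?thesis by simp
    qed
    finally have n2: "(2 * u0) ^ (Suc \<nu> div 2) \<le> \<sigma> powr (- 4)" unfolding p4 .
    have "96 * 2 ^ \<nu> * \<delta> + 2 * (2 * u0) ^ (Suc \<nu> div 2) \<le> 96 * (8 * sqrt \<sigma>) * \<delta> + 2 * \<sigma> powr (- 4)"
      using n1 n2 \<delta>0 by (intro add_mono mult_right_mono mult_left_mono) auto
    also have "\<dots> \<le> 768 * (sqrt \<sigma> * \<delta> + \<sigma> powr (- 4))" by (simp add: algebra_simps)
    finally have "96 * 2 ^ \<nu> * \<delta> + 2 * (2 * u0) ^ (Suc \<nu> div 2) \<le> \<dots>" .
    then have "H \<le> 10 * (768 * (sqrt \<sigma> * \<delta> + \<sigma> powr (- 4))) * (160 * (\<sigma>\<^sup>2 / V))"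
      unfolding H_def using kk \<delta>0 \<sigma>0 by (intro mult_mono mult_left_mono) auto
    then show ?thesis by (simp add: mult_ac)
  qed
  have bT: "0 \<le> ln (T / \<rho>)" "ln (T / \<rho>) \<le> 2 * ln \<sigma>"
  proof -
    show "0 \<le> ln (T / \<rho>)" using \<rho> \<rho>T by (intro ln_ge_zero) (simp add: pos_le_divide_eq)
    have "exp (- 18 :: real) \<le> 1" by simp
    then have "u0 \<le> 1" using u0 by linarith
    moreover have "1 \<le> mm * sqrt V" using mult_mono[of 1 mm 1 "sqrt V"] mm sV by simp
    ultimately have q: "u0 / (mm * sqrt V) \<le> 1" using u0 by (simp add: divide_le_eq)
    have "T / \<rho> = u0 / (mm * sqrt V) * \<sigma>\<^sup>2" using \<sigma>0 by (simp add: T_def \<rho>_def \<Lambda>_def power2_eq_square)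
    also have "\<dots> \<le> 1 * \<sigma>\<^sup>2" using q by (intro mult_right_mono) auto
    finally have "ln (T / \<rho>) \<le> ln (\<sigma>\<^sup>2)" using T \<rho> by (intro ln_mono) auto
    also have "ln (\<sigma>\<^sup>2) = 2 * ln \<sigma>" using \<sigma>0(1) by (simp add: ln_realpow)
    finally show "ln (T / \<rho>) \<le> 2 * ln \<sigma>" .
  qed
  have bHT: "H * ln (T / \<rho>) \<le> 2 * (10 * 160 * 768) * (ln \<sigma> * (\<sigma>\<^sup>2 / V) * (sqrt \<sigma> * \<delta> + \<sigma> powr (- 4)))"
  proof -
    have "H * ln (T / \<rho>) \<le> 10 * 160 * 768 * ((\<sigma>\<^sup>2 / V) * (sqrt \<sigma> * \<delta> + \<sigma> powr (- 4))) * (2 * ln \<sigma>)"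
      using bH bT H \<delta>0 \<sigma>0 kV0 by (intro mult_mono) auto
    then show ?thesis by (simp add: mult_ac)
  qed
  have bE: "4 / (T * s) * exp (- (T * s)\<^sup>2 / 4) \<le> \<sigma> powr (- 2)"
  proof -
    have "1 \<le> sqrt (ln \<sigma>)" using ln1 by simp
    then have "4 / (T * s) \<le> 1" by (simp add: Ts divide_le_eq)
    moreover have "exp (- (T * s)\<^sup>2 / 4) = \<sigma> powr (- 4)"
      using ln1 unfolding Ts p4 by (simp add: power_mult_distrib)
    ultimately have "4 / (T * s) * exp (- (T * s)\<^sup>2 / 4) \<le> 1 * \<sigma> powr (- 4)"
      using T s by (intro mult_mono) auto
    with \<sigma>4 show ?thesis by simp
  qed
  have bs: "s = 4 * mm / u0 * (sqrt (ln \<sigma>) * sqrt V / \<sigma>)"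
    by (simp add: s_def T_def \<Lambda>_def)
  define q1 where "q1 = sqrt (ln \<sigma>) * sqrt V / \<sigma>"
  define q2 where "q2 = \<sigma>\<^sup>2 / V * sqrt \<delta>"
  define q3 where "q3 = ln \<sigma> * (\<sigma>\<^sup>2 / V) * (sqrt \<sigma> * \<delta> + \<sigma> powr (- 4))"
  define q4 where "q4 = \<sigma> powr (- 2)"
  have q: "0 \<le> q1" "0 \<le> q2" "0 \<le> q3" "0 \<le> q4"
    unfolding q1_def q2_def q3_def q4_def using \<sigma>1 V1(1) \<delta>0 kV0
    by (intro mult_nonneg_nonneg divide_nonneg_nonneg add_nonneg_nonneg; simp)+ simp
  have sq: "sqrt V / \<sigma> \<le> q1"
  proof -
    have "1 * (sqrt V / \<sigma>) \<le> sqrt (ln \<sigma>) * (sqrt V / \<sigma>)" using ln1 \<sigma>0 V1 by (intro mult_right_mono) auto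
    then show ?thesis by (simp add: q1_def)
  qed
  have R2: "R \<le> 50000 / c0 * mm * q1 + 32 * C4 * 160 * q2"
  proof -
    have "50000 / c0 * mm * (sqrt V / \<sigma>) \<le> 50000 / c0 * mm * q1" using sq c0 mm by (intro mult_left_mono) auto
    then show ?thesis using bR by (simp add: q2_def)
  qed
  have "2 * (\<rho>\<^sup>2 + 68 * R + H * ln (T / \<rho>) + 4 / (T * s) * exp (- (T * s)\<^sup>2 / 4)) + 2 * s
     \<le> 2 * (q4 + 68 * (50000 / c0 * mm * q1 + 32 * C4 * 160 * q2) + 2 * (10 * 160 * 768) * q3 + q4) + 2 * (4 * mm / u0 * q1)"
    using R2 bHT bE b\<rho> bs by (simp add: q1_def q3_def q4_def)
  also have "\<dots> = (136 * (50000 / c0 * mm) + 8 * mm / u0) * q1 + 136 * 32 * C4 * 160 * q2 + 4 * 10 * 160 * 768 * q3 + 4 * q4"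
    by (simp add: algebra_simps)
  also have "\<dots> \<le> rate_const d * q1 + rate_const d * q2 + rate_const d * q3 + rate_const d * q4"
    using q c0 u0(1) mm C4
    by (intro add_mono mult_right_mono) (auto simp: rate_const_def c0_def u0_def mm_def C4_def)
  also have "\<dots> = rate_const d * (q1 + q2 + q3 + q4)" by (simp add: distrib_left)
  finally show ?thesis using main unfolding cdf q1_def q2_def q3_def q4_def by linarith
qed

end

lemma (in alpha_mixing_row) kolmogorov_le:
  defines "\<sigma> \<equiv> sqrt (expectation (\<lambda>x. (S 0 n x)\<^sup>2))"
  assumes large: "large_variance K d B a m V" and m: "2 \<le> m" and am: "1 < a * (1 - 2 / m)"
    and ln1: "1 \<le> ln \<sigma>" and large_\<sigma>: "moment_max d / freq_bound d \<le> \<sigma>" and V1: "1 \<le> V" "V \<le> \<sigma>\<^sup>2"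
    and \<delta>: "al (nat \<lceil>V / (80 * variance_const K B a)\<rceil>) \<le> \<delta>"
  shows "\<bar>measure M {x \<in> space M. S 0 n x / \<sigma> \<le> x0} - cdf std_normal_distribution x0\<bar>
    \<le> rate_const d * (sqrt (ln \<sigma>) * sqrt V / \<sigma> + \<sigma>\<^sup>2 / V * sqrt \<delta>
        + ln \<sigma> * (\<sigma>\<^sup>2 / V) * (sqrt \<sigma> * \<delta> + \<sigma> powr (- 4)) + \<sigma> powr (- 2))"
proof -
  have "0 \<le> expectation (\<lambda>x. (S 0 n x)\<^sup>2)" by simp
  then have s2: "\<sigma>\<^sup>2 = expectation (\<lambda>x. (S 0 n x)\<^sup>2)" by (simp add: \<sigma>_def)
  have "V / 40 \<le> expectation (\<lambda>x. (S 0 n x)\<^sup>2)" using V1 s2 by linarith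
  from exists_partition[OF large m _ _ this] obtain k e
    where k: "1 \<le> k" "e 0 = 0" "e k = n" "\<forall>i<k. good_block V (e i) (e (Suc i))" by auto
  interpret b: blocked_row M n X Pa Fu K d \<phi> al B a V m k e
    by unfold_locales (use k large m am in auto)
  have \<sigma>: "sqrt b.s2 = \<sigma>" by (simp add: b.s2_def \<sigma>_def)
  have bd: "b.\<delta> \<le> \<delta>" "0 \<le> b.\<delta>"
    using \<delta> al_pos[of b.gap] by (auto simp: b.\<delta>_def b.gap_def b.blen_def)
  have \<sigma>0: "0 \<le> \<sigma>" by (simp add: \<sigma>_def)
  have rc: "0 \<le> rate_const d"
    using char_scale_pos[of d] freq_bound_pos[of d] moment_max_ge(4)[of d] by (simp add: rate_const_def)
  show ?thesis
    using b.kolmogorov_row[of x0, unfolded \<sigma>, OF ln1 large_\<sigma> V1]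
  proof (rule order_trans)
    show "rate_const d * (sqrt (ln \<sigma>) * sqrt V / \<sigma> + \<sigma>\<^sup>2 / V * sqrt b.\<delta>
        + ln \<sigma> * (\<sigma>\<^sup>2 / V) * (sqrt \<sigma> * b.\<delta> + \<sigma> powr (- 4)) + \<sigma> powr (- 2))
      \<le> rate_const d * (sqrt (ln \<sigma>) * sqrt V / \<sigma> + \<sigma>\<^sup>2 / V * sqrt \<delta>
        + ln \<sigma> * (\<sigma>\<^sup>2 / V) * (sqrt \<sigma> * \<delta> + \<sigma> powr (- 4)) + \<sigma> powr (- 2))"
      using bd rc ln1 V1 \<sigma>0 by (intro mult_left_mono add_mono order_refl) auto
  qed
qed

section \<open>Rates for arrays\<close>

text \<open>First l is fixed so that the mixing term takes at most half of the allowance V / 640 for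
  every V; then V is made large enough for the term of order \<open>sqrt V\<close> to fit into the
  other half.\<close>

lemma large_variance_eventually:
  assumes K: "0 < K" and B: "0 < B" and a: "1 < a" and am: "1 < a * (1 - 2 / real m)"
  shows "eventually (large_variance K d B a m) at_top"
proof -
  define c where "c = 1 - 2 / real m"
  have c: "0 < c"
  proof (rule ccontr)
    assume "\<not> 0 < c"
    then have "a * c \<le> 0" using a by (intro mult_nonneg_nonpos) auto
    then show False using am by (simp add: c_def)
  qed
  have vc: "0 < variance_const K B a"
    using K B zeta_sum_nonneg[OF a] by (simp add: variance_const_def add_pos_nonneg)
  define C where "C = 9 * (moment_const d m)\<^sup>2"
  have C: "0 < C" using moment_const_ge[of d m] by (simp add: C_def)
  have lim: "((\<lambda>x::real. C * (B * (x / D) powr (- a)) powr c * E) \<longlongrightarrow> 0) at_top" if "0 < D" for D E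
    using C B a c that by real_asymp
  have "eventually (\<lambda>x. C * (B * (x / 1) powr (- a)) powr c * 1 < 1 / 1280) at_top"
    by (rule order_tendstoD(2)[OF lim]) auto
  then obtain x0 where x0: "\<And>x. x0 \<le> x \<Longrightarrow> C * (B * x powr (- a)) powr c < 1 / 1280"
    by (auto simp: eventually_at_top_linorder)
  define l where "l = Suc (nat \<lceil>x0\<rceil>)"
  have l: "1 \<le> l" "C * (B * real l powr (- a)) powr c < 1 / 1280"
    using x0[of "real l"] by (auto simp: l_def) linarith
  define q where "q = moment_const d 1 * (real l * K)"
  have q: "0 < q" using moment_const_ge[of d 1] l K by (simp add: q_def)
  have e1: "eventually (\<lambda>V. q * sqrt V \<le> V / 1280) at_top" using q by real_asymp
  have "eventually (\<lambda>V. C * (B * (V / (80 * variance_const K B a)) powr (- a)) powr c * zeta_sum (a * c) < 1 / 640) at_top"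
    by (rule order_tendstoD(2)[OF lim]) (use vc in auto)
  then show ?thesis
    using e1 eventually_ge_at_top[of "40 * K\<^sup>2"] eventually_ge_at_top[of 0]
  proof eventually_elim
    case (elim V)
    have "V * (C * (B * real l powr (- a)) powr c) \<le> V * (1 / 1280)"
      using l elim by (intro mult_left_mono) auto
    then have "moment_const d 1 * sqrt V * (l * K)
        + 9 * ((moment_const d m)\<^sup>2 * V) * (B * real l powr (- a)) powr (1 - 2 / m) \<le> V / 640"
      using elim by (simp add: q_def C_def c_def mult_ac)
    then show ?case
      using elim l(1) unfolding large_variance_def C_def c_def by auto
  qed
qed

text \<open>With \<open>x = a * (q - 2) / (2 * q)\<close> the left-hand side is
  \<open>x / (x + 2 * (q - 1))\<close>. The claim reduces to
  \<open>6 * (q - 2) \<le> q * (q - 1)\<close>, which is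
  \<open>0 \<le> (3 - q) * (4 - q)\<close>.\<close>

lemma exponent_le:
  fixes a q :: real
  assumes a: "1 < a" and q: "2 < q" "q \<le> 3"
  shows "1 - 2 * ((q - 1) / (a * (q - 2) / (2 * q) + 2 * (q - 1))) \<le> a / (a + 24)"
proof -
  define x where "x = a * (q - 2) / (2 * q)"
  have x: "0 < x" using a q by (simp add: x_def)
  have d: "0 < x + 2 * (q - 1)" using x q by simp
  have "0 \<le> (3 - q) * (4 - q)" using q by (intro mult_nonneg_nonneg) auto
  then have "6 * (q - 2) \<le> q * (q - 1)" by (simp add: algebra_simps)
  then have "a * (6 * (q - 2)) \<le> a * (q * (q - 1))" using a by (intro mult_left_mono) auto
  then have "12 * x \<le> a * (q - 1)" using q by (simp add: x_def field_simps)
  then have "x * (a + 24) \<le> a * (x + 2 * (q - 1))" by (simp add: algebra_simps)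
  then have "x / (x + 2 * (q - 1)) \<le> a / (a + 24)" using d a by (simp add: frac_le_eq divide_le_eq) (simp add: field_simps)
  moreover have "1 - 2 * ((q - 1) / (x + 2 * (q - 1))) = x / (x + 2 * (q - 1))"
    using d by (simp add: field_simps)
  ultimately show ?thesis by (simp add: x_def)
qed

text \<open>The row number comes first here, so that \<open>X n\<close> is a row. All rows share K,
  d and \<phi>, which makes the constants uniform in n.\<close>

locale alpha_array = prob_space M for M :: "'w measure" +
  fixes X :: "nat \<Rightarrow> nat \<Rightarrow> 'w \<Rightarrow> real" and Pa Fu :: "nat \<Rightarrow> nat \<Rightarrow> 'w measure"
    and K :: real and d :: nat and \<phi> :: real and \<sigma> :: "nat \<Rightarrow> real"
  assumes row: "mixing_row M n (X n) (Pa n) (Fu n) K d \<phi>"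
    and \<sigma>_def: "\<sigma> n = sqrt (expectation (\<lambda>x. (\<Sum>j\<in>{1..n}. X n j x)\<^sup>2))"
    and \<sigma>_top: "filterlim \<sigma> at_top sequentially"
begin

definition "kdist n = (SUP t. \<bar>measure M {x \<in> space M. (\<Sum>j\<in>{1..n}. X n j x) / \<sigma> n \<le> t} - cdf std_normal_distribution t\<bar>)"

text \<open>V and \<delta> depend on the row through its standard deviation alone, so every
  condition is checked for large real x and then pulled back along \<sigma>.\<close>

lemma kdist_eventually_le:
  assumes B: "0 < B" and a: "1 < a" and al_pos: "\<And>m. 0 < al m"
    and al_antimono: "\<And>i j. 1 \<le> i \<Longrightarrow> i \<le> j \<Longrightarrow> al j \<le> al i"
    and al_le: "\<And>m. 1 \<le> m \<Longrightarrow> al m \<le> B * real m powr (- a)"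
    and alpha: "\<And>n s m. 1 \<le> m \<Longrightarrow> s + m \<le> n \<Longrightarrow> mixing_le M (Pa n s) (Fu n (s + m)) (al m)"
    and V: "filterlim V at_top at_top" "eventually (\<lambda>x. V x \<le> x\<^sup>2) at_top"
    and \<delta>: "eventually (\<lambda>x. al (nat \<lceil>V x / (80 * variance_const K B a)\<rceil>) \<le> \<delta> x) at_top"
  shows "kdist \<in> O[sequentially](\<lambda>n. sqrt (ln (\<sigma> n)) * sqrt (V (\<sigma> n)) / \<sigma> n + (\<sigma> n)\<^sup>2 / V (\<sigma> n) * sqrt (\<delta> (\<sigma> n))
        + ln (\<sigma> n) * ((\<sigma> n)\<^sup>2 / V (\<sigma> n)) * (sqrt (\<sigma> n) * \<delta> (\<sigma> n) + \<sigma> n powr (- 4)) + \<sigma> n powr (- 2))"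
proof -
  \<comment> \<open>Any integer above \<open>2 * a / (a - 1)\<close> satisfies
    \<open>a * (1 - 2 / m) > 1\<close>; it is large when a is close to 1.\<close>
  define m :: nat where "m = nat \<lceil>2 * a / (a - 1)\<rceil> + 2"
  have m: "2 \<le> m" by (simp add: m_def)
  have am: "1 < a * (1 - 2 / real m)"
  proof -
    have "2 * a / (a - 1) < real m" unfolding m_def by linarith
    then have "2 * a < real m * (a - 1)" using a by (simp add: pos_divide_less_eq)
    then show ?thesis using m by (simp add: field_simps)
  qed
  have K: "0 < K" using row[of 0] by (simp add: mixing_row_def mixing_row_axioms_def)
  have "eventually (\<lambda>x. large_variance K d B a m (V x)) at_top"
    using large_variance_eventually[OF K B a am, of d] V(1) by (rule eventually_compose_filterlim)
  moreover have "eventually (\<lambda>x. 1 \<le> V x) at_top"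
    using eventually_ge_at_top[of 1] V(1) by (rule eventually_compose_filterlim)
  moreover have "eventually (\<lambda>x::real. 1 \<le> ln x) at_top" by real_asymp
  ultimately have "eventually (\<lambda>x. large_variance K d B a m (V x) \<and> 1 \<le> V x \<and> V x \<le> x\<^sup>2 \<and> 1 \<le> ln x
      \<and> moment_max d / freq_bound d \<le> x \<and> al (nat \<lceil>V x / (80 * variance_const K B a)\<rceil>) \<le> \<delta> x) at_top"
    using V(2) \<delta> eventually_ge_at_top[of "moment_max d / freq_bound d"] by eventually_elim simp
  then have ev: "eventually (\<lambda>n. large_variance K d B a m (V (\<sigma> n)) \<and> 1 \<le> V (\<sigma> n) \<and> V (\<sigma> n) \<le> (\<sigma> n)\<^sup>2 \<and> 1 \<le> ln (\<sigma> n)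
      \<and> moment_max d / freq_bound d \<le> \<sigma> n \<and> al (nat \<lceil>V (\<sigma> n) / (80 * variance_const K B a)\<rceil>) \<le> \<delta> (\<sigma> n)) sequentially"
    using \<sigma>_top by (rule eventually_compose_filterlim)
  show ?thesis
  proof (rule bigoI[where c="rate_const d"])
    show "eventually (\<lambda>n. norm (kdist n) \<le> rate_const d * norm (sqrt (ln (\<sigma> n)) * sqrt (V (\<sigma> n)) / \<sigma> n + (\<sigma> n)\<^sup>2 / V (\<sigma> n) * sqrt (\<delta> (\<sigma> n))
        + ln (\<sigma> n) * ((\<sigma> n)\<^sup>2 / V (\<sigma> n)) * (sqrt (\<sigma> n) * \<delta> (\<sigma> n) + \<sigma> n powr (- 4)) + \<sigma> n powr (- 2))) sequentially"
      using ev
    proof eventually_elim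
      case (elim n)
      interpret A: alpha_mixing_row M n "X n" "Pa n" "Fu n" K d \<phi> al B a
        by (intro alpha_mixing_row.intro alpha_mixing_row_axioms.intro row) (use al_pos al_antimono al_le a B alpha in auto)
      have S: "A.S 0 n x = (\<Sum>j\<in>{1..n}. X n j x)" for x
      proof -
        have "{0<..n} = {1..n}" by auto
        then show ?thesis by (simp add: A.S_def)
      qed
      define D where "D t = \<bar>measure M {x \<in> space M. (\<Sum>j\<in>{1..n}. X n j x) / \<sigma> n \<le> t} - cdf std_normal_distribution t\<bar>" for t
      define U where "U = sqrt (ln (\<sigma> n)) * sqrt (V (\<sigma> n)) / \<sigma> n + (\<sigma> n)\<^sup>2 / V (\<sigma> n) * sqrt (\<delta> (\<sigma> n))
        + ln (\<sigma> n) * ((\<sigma> n)\<^sup>2 / V (\<sigma> n)) * (sqrt (\<sigma> n) * \<delta> (\<sigma> n) + \<sigma> n powr (- 4)) + \<sigma> n powr (- 2)"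
      have le: "D t \<le> rate_const d * U" for t
        unfolding D_def U_def
        using A.kolmogorov_le[of m "V (\<sigma> n)" "\<delta> (\<sigma> n)" t, unfolded S \<sigma>_def[symmetric]] elim m am by blast
      have rc: "0 < rate_const d"
        using char_scale_pos[of d] freq_bound_pos[of d] moment_max_ge(4)[of d] 
        unfolding rate_const_def
        by (intro add_nonneg_pos add_nonneg_nonneg mult_nonneg_nonneg divide_nonneg_nonneg) auto
      have "0 \<le> D t" for t by (simp add: D_def)
      from order_trans[OF this le] have U0: "0 \<le> U" using rc by (simp add: zero_le_mult_iff)
      have "kdist n \<le> rate_const d * U"
        unfolding kdist_def D_def[symmetric] by (rule cSUP_least) (use le in auto)
      moreover have "0 \<le> kdist n"
        unfolding kdist_def D_def[symmetric]
        by (rule cSUP_upper2[where x=0]) (use le in \<open>auto simp: D_def intro!: bdd_aboveI2[where M="rate_const d * U"]\<close>)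
      ultimately show ?case unfolding U_def[symmetric] using U0 by simp
    qed
  qed
qed

lemma kdist_polynomial:
  assumes B: "0 < B" and a: "1 < a"
    and alpha: "\<And>n s m. 1 \<le> m \<Longrightarrow> s + m \<le> n \<Longrightarrow> mixing_le M (Pa n s) (Fu n (s + m)) (B * real m powr (- a))"
  shows "kdist \<in> O[sequentially](\<lambda>n. \<sigma> n powr (- (a / (a + 24))))"
proof -
  \<comment> \<open>\<open>max 1 m\<close> keeps the majorant positive at
    \<open>m = 0\<close>.\<close>
  define al where "al m = B * real (max 1 m) powr (- a)" for m :: nat
  \<comment> \<open>Any numerator from 34 to below 48 would do: below 48 the smoothing term with its
    factor \<open>sqrt (ln \<sigma>)\<close> stays under the claimed rate, and from 34 on the mixing
    terms do so for every \<open>a > 1\<close>.\<close>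
  define b where "b = 40 / (a + 24)"
  define \<theta> where "\<theta> = a / (a + 24)"
  have vc: "0 < variance_const K B a"
    using row[of 0] B zeta_sum_nonneg[OF a]
    by (simp add: variance_const_def add_pos_nonneg mixing_row_def mixing_row_axioms_def)
  define D where "D = B * (80 * variance_const K B a) powr a"
  have D: "0 < D" using B vc by (simp add: D_def)
  have b: "0 < b" "b < 2" "b / 2 - 1 < - \<theta>" "2 - b - a * b / 2 < - \<theta>" "5 / 2 - b - a * b < - \<theta>" "\<theta> < 1"
  proof -
    define w where "w = a + 24"
    have w: "0 < w" using a by (simp add: w_def)
    have e: "b / 2 - 1 = (- 4 - a) / w" "2 - b - a * b / 2 = (8 - 18 * a) / w"
      "5 / 2 - b - a * b = (20 - 75 / 2 * a) / w" "- \<theta> = (- a) / w"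
    proof -
      have aw: "a = w - 24" by (simp add: w_def)
      show "b / 2 - 1 = (- 4 - a) / w" "2 - b - a * b / 2 = (8 - 18 * a) / w"
        "5 / 2 - b - a * b = (20 - 75 / 2 * a) / w" "- \<theta> = (- a) / w"
        unfolding b_def \<theta>_def aw using w by (simp_all add: field_simps)
    qed
    show "b / 2 - 1 < - \<theta>" "2 - b - a * b / 2 < - \<theta>" "5 / 2 - b - a * b < - \<theta>"
      unfolding e using a w by (intro divide_strict_right_mono; simp)+
    show "0 < b" "b < 2" "\<theta> < 1" using a by (simp_all add: b_def \<theta>_def pos_divide_less_eq)
  qed
  have "kdist \<in> O[sequentially](\<lambda>n. (\<lambda>x. sqrt (ln x) * sqrt (x powr b) / x + x\<^sup>2 / x powr b * sqrt (D * x powr (- (a * b)))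
        + ln x * (x\<^sup>2 / x powr b) * (sqrt x * (D * x powr (- (a * b))) + x powr (- 4)) + x powr (- 2)) (\<sigma> n))"
  proof (rule kdist_eventually_le[OF B a, where al=al])
    show "0 < al m" for m using B by (simp add: al_def)
    show "al j \<le> al i" if "1 \<le> i" "i \<le> j" for i j
      unfolding al_def using that B a by (intro mult_left_mono powr_mono2') auto
    show "al m \<le> B * real m powr (- a)" if "1 \<le> m" for m using that by (simp add: al_def max_def)
    show "mixing_le M (Pa n s) (Fu n (s + m)) (al m)" if "1 \<le> m" "s + m \<le> n" for n s m
      using alpha[OF that] that by (simp add: al_def max_def)
    show "filterlim (\<lambda>x::real. x powr b) at_top at_top" using b by real_asymp
    show "eventually (\<lambda>x::real. x powr b \<le> x\<^sup>2) at_top" using b by real_asymp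
    show "eventually (\<lambda>x. al (nat \<lceil>x powr b / (80 * variance_const K B a)\<rceil>) \<le> D * x powr (- (a * b))) at_top"
      using eventually_gt_at_top[of 0]
    proof eventually_elim
      case (elim x)
      define y where "y = x powr b / (80 * variance_const K B a)"
      have y: "0 < y" using elim vc by (simp add: y_def)
      have "y \<le> real (max 1 (nat \<lceil>y\<rceil>))" using y by linarith
      then have "al (nat \<lceil>y\<rceil>) \<le> B * y powr (- a)"
        unfolding al_def using y B a by (intro mult_left_mono powr_mono2') auto
      also have "y powr (- a) = (80 * variance_const K B a) powr a * x powr (- (a * b))"
        using vc elim by (simp add: y_def powr_divide powr_powr powr_minus field_simps)
      finally show ?case by (simp add: y_def D_def)
    qed
  qed
  moreover have "(\<lambda>n. (\<lambda>x. sqrt (ln x) * sqrt (x powr b) / x + x\<^sup>2 / x powr b * sqrt (D * x powr (- (a * b)))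
        + ln x * (x\<^sup>2 / x powr b) * (sqrt x * (D * x powr (- (a * b))) + x powr (- 4)) + x powr (- 2)) (\<sigma> n))
      \<in> O[sequentially](\<lambda>n. (\<lambda>x. x powr (- \<theta>)) (\<sigma> n))"
  proof (rule landau_o.big.compose[OF _ \<sigma>_top])
    have "(\<lambda>x::real. sqrt (ln x) * sqrt (x powr b) / x) \<in> O[at_top](\<lambda>x. x powr (- \<theta>))"
      using b(3) by real_asymp
    moreover have "(\<lambda>x::real. x\<^sup>2 / x powr b * sqrt (D * x powr (- (a * b)))) \<in> O[at_top](\<lambda>x. x powr (- \<theta>))"
      using b(4) D by real_asymp
    moreover have "(\<lambda>x::real. ln x * (x\<^sup>2 / x powr b) * (sqrt x * (D * x powr (- (a * b))))) \<in> O[at_top](\<lambda>x. x powr (- \<theta>))"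
      using b(5) D by real_asymp
    moreover have "(\<lambda>x::real. ln x * (x\<^sup>2 / x powr b) * x powr (- 4)) \<in> O[at_top](\<lambda>x. x powr (- \<theta>))"
      using b(1,6) by real_asymp
    moreover have "(\<lambda>x::real. x powr (- 2)) \<in> O[at_top](\<lambda>x. x powr (- \<theta>))"
      using b(6) by real_asymp
    ultimately show "(\<lambda>x::real. sqrt (ln x) * sqrt (x powr b) / x + x\<^sup>2 / x powr b * sqrt (D * x powr (- (a * b)))
        + ln x * (x\<^sup>2 / x powr b) * (sqrt x * (D * x powr (- (a * b))) + x powr (- 4)) + x powr (- 2))
        \<in> O[at_top](\<lambda>x. x powr (- \<theta>))"
      unfolding distrib_left by (intro sum_in_bigo)
  qed
  ultimately have "kdist \<in> O[sequentially](\<lambda>n. (\<lambda>x. x powr (- \<theta>)) (\<sigma> n))" by (rule landau_o.big_trans)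
  then show ?thesis by (simp add: \<theta>_def)
qed

text \<open>Through \<open>exp (- z) \<le> 2 / z^2\<close> the polynomial rate with exponent 2
  holds, and it meets the qualitative requirements on the blocks. The gain is that V of order
  \<open>ln \<sigma>\<close> suffices, so the leading term is of order
  \<open>ln \<sigma> / \<sigma>\<close>.\<close>

lemma kdist_exponential:
  assumes B: "0 < B" and \<kappa>: "0 < \<kappa>"
    and alpha: "\<And>n s m. 1 \<le> m \<Longrightarrow> s + m \<le> n \<Longrightarrow> mixing_le M (Pa n s) (Fu n (s + m)) (B * exp (- \<kappa> * real m))"
  shows "kdist \<in> O[sequentially](\<lambda>n. \<sigma> n powr (- 1) * ln (\<sigma> n) ^ 3)"
proof -
  define al where "al m = B * exp (- \<kappa> * real m)" for m :: nat
  define B' where "B' = 2 * B / \<kappa>\<^sup>2"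
  have B': "0 < B'" using B \<kappa> by (simp add: B'_def)
  have vc: "0 < variance_const K B' 2"
    using row[of 0] B' zeta_sum_nonneg[of 2]
    by (simp add: variance_const_def add_pos_nonneg mixing_row_def mixing_row_axioms_def)
  \<comment> \<open>Makes the guaranteed block length \<open>8 * ln \<sigma> / \<kappa>\<close> and
    thus the mixing error \<open>B * \<sigma> powr (- 8)\<close>, whose square root is small even
    after multiplication by \<open>\<sigma>^2\<close>.\<close>
  define C where "C = 640 * variance_const K B' 2 / \<kappa>"
  have C: "0 < C" using vc \<kappa> by (simp add: C_def)
  have "kdist \<in> O[sequentially](\<lambda>n. (\<lambda>x. sqrt (ln x) * sqrt (C * ln x) / x + x\<^sup>2 / (C * ln x) * sqrt (B * x powr (- 8))
        + ln x * (x\<^sup>2 / (C * ln x)) * (sqrt x * (B * x powr (- 8)) + x powr (- 4)) + x powr (- 2)) (\<sigma> n))"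
  proof (rule kdist_eventually_le[OF B', where al=al and a=2])
    show "0 < al m" for m using B by (simp add: al_def)
    show "al j \<le> al i" if "1 \<le> i" "i \<le> j" for i j
      unfolding al_def using that B \<kappa> by (intro mult_left_mono) auto
    show "al m \<le> B' * real m powr (- 2)" if "1 \<le> m" for m
    proof -
      define z where "z = \<kappa> * real m"
      have z: "0 < z" using \<kappa> that by (simp add: z_def)
      have "z\<^sup>2 / 2 \<le> exp z" using exp_lower_Taylor_quadratic[of z] z by simp
      then have "exp (- z) \<le> 2 / z\<^sup>2" using z by (simp add: exp_minus field_simps)
      then have "B * exp (- z) \<le> B * (2 / z\<^sup>2)" using B by (intro mult_left_mono) auto
      then have "al m \<le> B * (2 / z\<^sup>2)" by (simp add: al_def z_def)
      also have "\<dots> = B' * real m powr (- 2)"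
        using that \<kappa> by (simp add: B'_def z_def powr_minus powr_numeral power_mult_distrib field_simps)
      finally show ?thesis .
    qed
    show "mixing_le M (Pa n s) (Fu n (s + m)) (al m)" if "1 \<le> m" "s + m \<le> n" for n s m
      using alpha[OF that] by (simp add: al_def)
    show "filterlim (\<lambda>x::real. C * ln x) at_top at_top" using C by real_asymp
    show "eventually (\<lambda>x::real. C * ln x \<le> x\<^sup>2) at_top" using C by real_asymp
    show "eventually (\<lambda>x. al (nat \<lceil>C * ln x / (80 * variance_const K B' 2)\<rceil>) \<le> B * x powr (- 8)) at_top"
      using eventually_gt_at_top[of 1]
    proof eventually_elim
      case (elim x)
      define y where "y = C * ln x / (80 * variance_const K B' 2)"
      have y: "y = 8 * ln x / \<kappa>" using vc \<kappa> by (simp add: y_def C_def)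
      have "y \<le> real (nat \<lceil>y\<rceil>)" by linarith
      then have "exp (- \<kappa> * real (nat \<lceil>y\<rceil>)) \<le> exp (- \<kappa> * y)" using \<kappa> by simp
      also have "\<dots> = x powr (- 8)" using elim \<kappa> by (simp add: y powr_def)
      finally show ?case using B unfolding al_def y_def[symmetric] by (intro mult_left_mono) auto
    qed
  qed simp
  moreover have "(\<lambda>n. (\<lambda>x. sqrt (ln x) * sqrt (C * ln x) / x + x\<^sup>2 / (C * ln x) * sqrt (B * x powr (- 8))
        + ln x * (x\<^sup>2 / (C * ln x)) * (sqrt x * (B * x powr (- 8)) + x powr (- 4)) + x powr (- 2)) (\<sigma> n))
      \<in> O[sequentially](\<lambda>n. (\<lambda>x. x powr (- 1) * ln x ^ 3) (\<sigma> n))"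
  proof (rule landau_o.big.compose[OF _ \<sigma>_top])
    show "(\<lambda>x::real. sqrt (ln x) * sqrt (C * ln x) / x + x\<^sup>2 / (C * ln x) * sqrt (B * x powr (- 8))
        + ln x * (x\<^sup>2 / (C * ln x)) * (sqrt x * (B * x powr (- 8)) + x powr (- 4)) + x powr (- 2))
        \<in> O[at_top](\<lambda>x. x powr (- 1) * ln x ^ 3)"
      using B C by real_asymp
  qed
  ultimately show ?thesis by (rule landau_o.big_trans)
qed

end

section \<open>The mixing coefficients of a row\<close>

definition row_algebra ::
  "'w measure \<Rightarrow> (nat \<Rightarrow> nat \<Rightarrow> 'b measure) \<Rightarrow> (nat \<Rightarrow> nat \<Rightarrow> 'w \<Rightarrow> 'b) \<Rightarrow> nat \<Rightarrow> nat set \<Rightarrow> 'w measure" where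
  "row_algebra M N \<zeta> n J = sigma (space M) (\<Union>j\<in>J. {\<zeta> j n -` A \<inter> space M | A. A \<in> sets (N j n)})"

lemma sets_row_algebra: "sets (row_algebra M N \<zeta> n J) = row_sigma M N \<zeta> n J"
  unfolding row_algebra_def row_sigma_def by (rule sets_measure_of) auto

lemma space_row_algebra: "space (row_algebra M N \<zeta> n J) = space M"
  unfolding row_algebra_def by (rule space_measure_of) auto

lemma subalgebra_row_algebra:
  assumes "\<And>j. j \<in> J \<Longrightarrow> \<zeta> j n \<in> measurable M (N j n)"
  shows "subalgebra M (row_algebra M N \<zeta> n J)"
  unfolding subalgebra_def space_row_algebra sets_row_algebra row_sigma_def
  using assms by (auto intro!: sets.sigma_sets_subset measurable_sets)

lemma measurable_row_algebra:
  assumes "j \<in> J" "\<zeta> j n \<in> measurable M (N j n)" "f \<in> borel_measurable (N j n)"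
  shows "(\<lambda>\<omega>. f (\<zeta> j n \<omega>)) \<in> borel_measurable (row_algebra M N \<zeta> n J)"
proof (rule measurable_compose[OF _ assms(3)], rule measurableI)
  show "\<zeta> j n x \<in> space (N j n)" if "x \<in> space (row_algebra M N \<zeta> n J)" for x
    using that measurable_space[OF assms(2)] by (simp add: space_row_algebra)
  show "\<zeta> j n -` A \<inter> space (row_algebra M N \<zeta> n J) \<in> sets (row_algebra M N \<zeta> n J)" if "A \<in> sets (N j n)" for A
    unfolding sets_row_algebra row_sigma_def space_row_algebra
    using assms(1) that by (intro sigma_sets.Basic) auto
qed

lemma row_sigma_mono: "J \<subseteq> J' \<Longrightarrow> row_sigma M N \<zeta> n J \<subseteq> row_sigma M N \<zeta> n J'"
  unfolding row_sigma_def by (intro sigma_sets_mono') auto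

context prob_space
begin

lemma alpha_coeff_ge:
  assumes "A \<in> \<G>" "B \<in> \<H>"
  shows "\<bar>prob (A \<inter> B) - prob A * prob B\<bar> \<le> alpha_coeff M \<G> \<H>"
  unfolding alpha_coeff_def
proof (rule cSup_upper)
  have "\<bar>prob (A \<inter> B) - prob A * prob B\<bar> \<le> 1" for A B
  proof -
    have "0 \<le> prob A * prob B" "prob A * prob B \<le> 1"
      by (auto intro: mult_le_one)
    then show ?thesis using measure_nonneg[of M "A \<inter> B"] prob_le_1[of "A \<inter> B"] by linarith
  qed
  then show "bdd_above {\<bar>prob (A \<inter> B) - prob A * prob B\<bar> |A B. A \<in> \<G> \<and> B \<in> \<H>}"
    by (intro bdd_aboveI[of _ 1]) auto
qed (use assms in blast)

lemma alpha_row_ge: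
  assumes "s + k \<le> n" "A \<in> row_sigma M N \<zeta> n {j. 1 \<le> j \<and> j \<le> s}"
    "B \<in> row_sigma M N \<zeta> n {j. 1 \<le> j \<and> s + k \<le> j \<and> j \<le> n}"
  shows "\<bar>prob (A \<inter> B) - prob A * prob B\<bar> \<le> alpha_row M N \<zeta> n k"
proof -
  have "finite {s. s + k \<le> n}" by (rule finite_subset[of _ "{..n}"]) auto
  then have "alpha_coeff M (row_sigma M N \<zeta> n {j. 1 \<le> j \<and> j \<le> s}) (row_sigma M N \<zeta> n {j. 1 \<le> j \<and> s + k \<le> j \<and> j \<le> n})
      \<le> alpha_row M N \<zeta> n k"
    unfolding alpha_row_def using assms(1) by (intro cSUP_upper bdd_above_finite) auto
  with alpha_coeff_ge[OF assms(2,3)] show ?thesis by linarith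
qed

text \<open>Holds for arbitrary sets: a non-measurable set has measure 0, and a conditional
  probability given a set of measure 0 is 0 by convention.\<close>

lemma phi_term_le_1: "\<bar>\<P>(\<omega> in M. \<omega> \<in> B \<bar> \<omega> \<in> A) - prob B\<bar> \<le> 1"
proof -
  have "\<P>(\<omega> in M. \<omega> \<in> B \<bar> \<omega> \<in> A) \<le> 1"
  proof (cases "prob {\<omega> \<in> space M. \<omega> \<in> A} = 0")
    case False
    have "prob {\<omega> \<in> space M. \<omega> \<in> B \<and> \<omega> \<in> A} \<le> prob {\<omega> \<in> space M. \<omega> \<in> A}"
    proof (cases "{\<omega> \<in> space M. \<omega> \<in> A} \<in> events")
      case True
      then show ?thesis by (intro finite_measure_mono) auto
    next
      case False
      then show ?thesis using \<open>prob {\<omega> \<in> space M. \<omega> \<in> A} \<noteq> 0\<close> by (simp add: measure_notin_sets)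
    qed
    then show ?thesis by (simp add: cond_prob_def divide_le_eq_1 zero_less_measure_iff)
  qed (simp add: cond_prob_def)
  moreover have "0 \<le> \<P>(\<omega> in M. \<omega> \<in> B \<bar> \<omega> \<in> A)" by (simp add: cond_prob_def)
  ultimately show ?thesis using measure_nonneg[of M B] prob_le_1[of B] by linarith
qed

lemma phi_coeff_ge:
  assumes "A \<in> \<G>" "B \<in> \<H>" "0 < prob A"
  shows "\<bar>\<P>(\<omega> in M. \<omega> \<in> B \<bar> \<omega> \<in> A) - prob B\<bar> \<le> phi_coeff M \<G> \<H>"
  unfolding phi_coeff_def
proof (rule cSup_upper)
  show "bdd_above {\<bar>\<P>(\<omega> in M. \<omega> \<in> B \<bar> \<omega> \<in> A) - prob B\<bar> |A B. A \<in> \<G> \<and> B \<in> \<H> \<and> 0 < prob A}"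
    by (rule bdd_aboveI[of _ 1]) (use phi_term_le_1 in blast)
qed (use assms in blast)

text \<open>Makes the supremum over the rows in \<open>phi_mix\<close> bounded. Since
  \<open>k \<le> n\<close>, the shift \<open>s = 0\<close> is admissible and the inner supremum is
  over a nonempty set.\<close>

lemma phi_row_le_1:
  assumes "k \<le> n"
  shows "phi_row M N \<zeta> n k \<le> 1"
  unfolding phi_row_def
proof (rule cSUP_least)
  show "{s. s + k \<le> n} \<noteq> {}" using assms by (auto intro!: exI[of _ 0])
  fix s
  have top: "space M \<in> row_sigma M N \<zeta> n J" for J
    unfolding row_sigma_def by (rule sigma_sets_top)
  show "phi_coeff M (row_sigma M N \<zeta> n {j. 1 \<le> j \<and> j \<le> s}) (row_sigma M N \<zeta> n {j. 1 \<le> j \<and> s + k \<le> j \<and> j \<le> n}) \<le> 1"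
    unfolding phi_coeff_def
  proof (rule cSup_least)
    show "{\<bar>\<P>(\<omega> in M. \<omega> \<in> B \<bar> \<omega> \<in> A) - prob B\<bar> |A B. A \<in> row_sigma M N \<zeta> n {j. 1 \<le> j \<and> j \<le> s} \<and>
        B \<in> row_sigma M N \<zeta> n {j. 1 \<le> j \<and> s + k \<le> j \<and> j \<le> n} \<and> 0 < prob A} \<noteq> {}"
      using top prob_space by (auto intro!: exI[of _ "space M"])
  qed (use phi_term_le_1 in blast)
qed

text \<open>Multiplying the conditional form by \<open>prob A\<close> gives the one-sided inequality
  used for rows; null events, which the coefficient does not see, satisfy it trivially.\<close>

lemma phi_mix_ge:
  assumes "s + k \<le> n" "1 \<le> n" "A \<in> row_sigma M N \<zeta> n {j. 1 \<le> j \<and> j \<le> s}"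
    "B \<in> row_sigma M N \<zeta> n {j. 1 \<le> j \<and> s + k \<le> j \<and> j \<le> n}" "A \<in> events" "B \<in> events"
  shows "prob (A \<inter> B) \<le> prob A * (prob B + phi_mix M N \<zeta> k)"
proof (cases "prob A = 0")
  case True
  have "prob (A \<inter> B) \<le> prob A" using assms by (intro finite_measure_mono) auto
  then show ?thesis using True by simp
next
  case False
  then have pA: "0 < prob A" by (simp add: zero_less_measure_iff)
  have "finite {s. s + k \<le> n}" by (rule finite_subset[of _ "{..n}"]) auto
  then have "phi_coeff M (row_sigma M N \<zeta> n {j. 1 \<le> j \<and> j \<le> s}) (row_sigma M N \<zeta> n {j. 1 \<le> j \<and> s + k \<le> j \<and> j \<le> n})
      \<le> phi_row M N \<zeta> n k"
    unfolding phi_row_def using assms(1) by (intro cSUP_upper bdd_above_finite) auto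
  also have "\<dots> \<le> phi_mix M N \<zeta> k"
    unfolding phi_mix_def using assms phi_row_le_1 by (intro cSUP_upper bdd_aboveI2[where M=1]) auto
  finally have "\<bar>\<P>(\<omega> in M. \<omega> \<in> B \<bar> \<omega> \<in> A) - prob B\<bar> \<le> phi_mix M N \<zeta> k"
    using phi_coeff_ge[OF assms(3,4) pA] by linarith
  moreover have "\<P>(\<omega> in M. \<omega> \<in> B \<bar> \<omega> \<in> A) = prob (A \<inter> B) / prob A"
  proof -
    have "{\<omega> \<in> space M. \<omega> \<in> B \<and> \<omega> \<in> A} = A \<inter> B" "{\<omega> \<in> space M. \<omega> \<in> A} = A"
      using sets.sets_into_space[OF assms(5)] by auto
    then show ?thesis by (simp add: cond_prob_def)
  qed
  ultimately have "prob (A \<inter> B) / prob A \<le> prob B + phi_mix M N \<zeta> k" by linarith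
  then show ?thesis using pA by (simp add: pos_divide_le_eq mult.commute)
qed

end

section \<open>Reduction to clipped rows\<close>

lemma (in prob_space) prob_le_cong_AE:
  assumes [measurable]: "f \<in> borel_measurable M" "h \<in> borel_measurable M" and "AE x in M. f x = (h x :: real)"
  shows "prob {x \<in> space M. f x / c \<le> t} = prob {x \<in> space M. h x / c \<le> t}"
proof (rule finite_measure_eq_AE)
  show "AE x in M. (x \<in> {x \<in> space M. f x / c \<le> t}) = (x \<in> {x \<in> space M. h x / c \<le> t})"
    using assms(3) by eventually_elim simp
qed measurable

lemma clip_eq: "\<bar>x\<bar> \<le> K \<Longrightarrow> max (- K) (min K x) = (x :: real)"
  by (auto simp: max_def min_def)

theorem corollary2p10:
  fixes M :: "'w measure"
    and N :: "nat \<Rightarrow> nat \<Rightarrow> 'b measure"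
    and \<zeta> :: "nat \<Rightarrow> nat \<Rightarrow> 'w \<Rightarrow> 'b"
    and g :: "nat \<Rightarrow> nat \<Rightarrow> 'b \<Rightarrow> real"
    and \<xi> :: "nat \<Rightarrow> nat \<Rightarrow> 'w \<Rightarrow> real"
    and q :: real
  assumes "prob_space M"
    and "\<And>j n. 1 \<le> j \<Longrightarrow> j \<le> n \<Longrightarrow> \<zeta> j n \<in> measurable M (N j n)"
    and "\<And>j n. 1 \<le> j \<Longrightarrow> j \<le> n \<Longrightarrow> g j n \<in> borel_measurable (N j n)"
    and "\<And>j n. 1 \<le> j \<Longrightarrow> j \<le> n \<Longrightarrow> \<xi> j n = (\<lambda>\<omega>. g j n (\<zeta> j n \<omega>))"
    and "\<And>j n. 1 \<le> j \<Longrightarrow> j \<le> n \<Longrightarrow> integrable M (\<xi> j n)"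
    and "\<And>j n. 1 \<le> j \<Longrightarrow> j \<le> n \<Longrightarrow> prob_space.expectation M (\<xi> j n) = 0"
    and "2 < q" and "q \<le> 3"
    and "filterlim (row_sd M \<xi>) at_top sequentially"
    and "(SUP n\<in>{1..}. MAX j\<in>{1..n}. Linf_norm M (\<xi> j n)) < \<infinity>"
    and "\<exists>m\<^sub>0. phi_mix M N \<zeta> m\<^sub>0 < 1 / 2"
  shows
    "(\<forall>B a :: real. 1 < B \<longrightarrow> 1 < a \<longrightarrow>
        (\<forall>n j. 1 \<le> j \<longrightarrow> j \<le> n \<longrightarrow> alpha_row M N \<zeta> n j \<le> B * real j powr (- a)) \<longrightarrow>
        (let \<gamma> = (q - 1) / (a * (q - 2) / (2 * q) + 2 * (q - 1))
         in kolmogorov_distance M \<xi> \<in> O[sequentially](\<lambda>n. row_sd M \<xi> n powr (- (1 - 2 * \<gamma>)))))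
     \<and>
     (\<forall>\<kappa> B :: real. 0 < \<kappa> \<longrightarrow> 1 < B \<longrightarrow>
        (\<forall>n j. 1 \<le> j \<longrightarrow> j \<le> n \<longrightarrow> alpha_row M N \<zeta> n j \<le> B * exp (- \<kappa> * real j)) \<longrightarrow>
        kolmogorov_distance M \<xi> \<in> O[sequentially](\<lambda>n. (row_sd M \<xi> n) powr (- 1) * ln (row_sd M \<xi> n) ^ 3))"
proof -
  interpret prob_space M by fact
  note \<zeta> = assms(2) and g = assms(3) and \<xi> = assms(4) and \<xi>_int = assms(5) and \<xi>_mean = assms(6)
  obtain K :: real where K: "0 < K" and K_bound: "\<And>j n. 1 \<le> j \<Longrightarrow> j \<le> n \<Longrightarrow> AE x in M. \<bar>\<xi> j n x\<bar> \<le> K"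
  proof -
    obtain k :: nat where k: "(SUP n\<in>{1..}. MAX j\<in>{1..n}. Linf_norm M (\<xi> j n)) < ereal (real k)"
      using assms(10) less_PInf_Ex_of_nat by auto
    have "AE x in M. \<bar>\<xi> j n x\<bar> \<le> real k + 1" if jn: "1 \<le> j" "j \<le> n" for j n
    proof -
      have "Linf_norm M (\<xi> j n) \<le> (MAX j\<in>{1..n}. Linf_norm M (\<xi> j n))"
        using jn by (intro Max_ge) auto
      also have "\<dots> \<le> (SUP n\<in>{1..}. MAX j\<in>{1..n}. Linf_norm M (\<xi> j n))"
        using jn by (intro SUP_upper) auto
      finally have le: "Linf_norm M (\<xi> j n) \<le> ereal (real k)" using k by (meson less_imp_le order_trans)
      have "AE x in M. ereal \<bar>\<xi> j n x\<bar> \<le> Linf_norm M (\<xi> j n)"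
        unfolding Linf_norm_def by (rule esssup_AE)
      then show ?thesis
      proof eventually_elim
        case (elim x)
        then have "ereal \<bar>\<xi> j n x\<bar> \<le> ereal (real k)" using le by (rule order_trans)
        then show ?case by simp
      qed
    qed
    then show ?thesis by (intro that[of "real k + 1"]) auto
  qed
  obtain m0 where m0: "phi_mix M N \<zeta> m0 < 1 / 2" using assms(11) by auto
  \<comment> \<open>The maximal inequalities use sums started at \<open>l + d - 1\<close>, so d must
    be at least 1; enlarging the distance only shrinks the future.\<close>
  define d where "d = max 1 m0"
  \<comment> \<open>The bound on \<xi> holds almost everywhere, whereas a row needs it at every
    point. Clipping changes \<xi> on a null set only and yields a measurable function of the same
    \<zeta>, so the mixing hypotheses still apply.\<close>
  define X where "X n j x = max (- K) (min K (\<xi> j n x))" for n j x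
  \<comment> \<open>\<open>min s n\<close>, because the entries are measurable up to index n only
    while a subalgebra is required for every s.\<close>
  define Pa where "Pa n s = row_algebra M N \<zeta> n {j. 1 \<le> j \<and> j \<le> min s n}" for n s
  define Fu where "Fu n s = row_algebra M N \<zeta> n {j. 1 \<le> j \<and> s \<le> j \<and> j \<le> n}" for n s
  have X_AE: "AE x in M. X n j x = \<xi> j n x" if "1 \<le> j" "j \<le> n" for n j
    using K_bound[OF that] by eventually_elim (simp add: X_def clip_eq)
  have X_g: "X n j = (\<lambda>x. max (- K) (min K (g j n (\<zeta> j n x))))" if "1 \<le> j" "j \<le> n" for n j
    unfolding X_def[abs_def] \<xi>[OF that] ..
  have clip_g: "(\<lambda>y. max (- K) (min K (g j n y))) \<in> borel_measurable (N j n)" if "1 \<le> j" "j \<le> n" for n j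
    using g[OF that] by measurable
  have \<xi>_M: "\<xi> j n \<in> borel_measurable M" if "1 \<le> j" "j \<le> n" for n j
    using \<xi>_int[OF that] by auto
  have X_M: "X n j \<in> borel_measurable M" if "1 \<le> j" "j \<le> n" for n j
    unfolding X_def[abs_def] using \<xi>_M[OF that] by measurable
  have row: "mixing_row M n (X n) (Pa n) (Fu n) K d (phi_mix M N \<zeta> m0)" for n
  proof (intro mixing_row.intro mixing_row_axioms.intro)
    show "prob_space M" by fact
    show sP: "subalgebra M (Pa n s)" for s
      unfolding Pa_def by (rule subalgebra_row_algebra) (auto intro: \<zeta>)
    show sF: "subalgebra M (Fu n s)" for s
      unfolding Fu_def by (rule subalgebra_row_algebra) (auto intro: \<zeta>)
    show "X n j \<in> borel_measurable (Pa n s)" if "1 \<le> j" "j \<le> s" "s \<le> n" for j s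
      using that unfolding X_g[OF that(1) order_trans[OF that(2,3)]] Pa_def
      by (intro measurable_row_algebra[where f="\<lambda>y. max (- K) (min K (g j n y))"] \<zeta> clip_g) auto
    show "X n j \<in> borel_measurable (Fu n s)" if "1 \<le> j" "s \<le> j" "j \<le> n" for j s
      using that unfolding X_g[OF that(1,3)] Fu_def
      by (intro measurable_row_algebra[where f="\<lambda>y. max (- K) (min K (g j n y))"] \<zeta> clip_g) auto
    show "\<bar>X n j x\<bar> \<le> K" for j x using K by (auto simp: X_def max_def min_def)
    show "expectation (X n j) = 0" if "1 \<le> j" "j \<le> n" for j
      using integral_cong_AE[OF X_M[OF that] \<xi>_M[OF that] X_AE[OF that]] \<xi>_mean[OF that] by simp
    show "0 < K" by fact
    show "1 \<le> d" by (simp add: d_def)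
    show "phi_mix M N \<zeta> m0 < 1 / 2" by fact
    show "prob (A \<inter> B) \<le> prob A * (prob B + phi_mix M N \<zeta> m0)"
      if sd: "s + d \<le> n" and A: "A \<in> sets (Pa n s)" and B: "B \<in> sets (Fu n (s + d))" for s A B
    proof (rule phi_mix_ge)
      show "s + m0 \<le> n" "1 \<le> n" using sd by (auto simp: d_def)
      have "{j. 1 \<le> j \<and> j \<le> min s n} = {j. 1 \<le> j \<and> j \<le> s}" using sd by auto
      then show "A \<in> row_sigma M N \<zeta> n {j. 1 \<le> j \<and> j \<le> s}" using A by (simp add: Pa_def sets_row_algebra)
      have "{j. 1 \<le> j \<and> s + d \<le> j \<and> j \<le> n} \<subseteq> {j. 1 \<le> j \<and> s + m0 \<le> j \<and> j \<le> n}" by (auto simp: d_def)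
      from row_sigma_mono[OF this, of M N \<zeta> n] show "B \<in> row_sigma M N \<zeta> n {j. 1 \<le> j \<and> s + m0 \<le> j \<and> j \<le> n}"
        using B by (auto simp: Fu_def sets_row_algebra)
      show "A \<in> events" using A sP[of s] by (auto simp: subalgebra_def)
      show "B \<in> events" using B sF[of "s + d"] by (auto simp: subalgebra_def)
    qed
  qed
  have sum_AE: "AE x in M. (\<Sum>j\<in>{1..n}. X n j x) = row_sum \<xi> n x" for n
  proof -
    have "AE x in M. \<forall>j\<in>{1..n}. X n j x = \<xi> j n x" using X_AE by (intro AE_finite_allI) auto
    then show ?thesis by eventually_elim (simp add: row_sum_def)
  qed
  have sum_M: "(\<lambda>x. \<Sum>j\<in>{1..n}. X n j x) \<in> borel_measurable M" "row_sum \<xi> n \<in> borel_measurable M" for n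
    unfolding row_sum_def[abs_def] using X_M \<xi>_M by (auto intro!: borel_measurable_sum)
  have sd: "row_sd M \<xi> n = sqrt (expectation (\<lambda>x. (\<Sum>j\<in>{1..n}. X n j x)\<^sup>2))" for n
  proof -
    have "expectation (row_sum \<xi> n) = (\<Sum>j\<in>{1..n}. expectation (\<xi> j n))"
      unfolding row_sum_def[abs_def] using \<xi>_int by (intro Bochner_Integration.integral_sum) auto
    then have "expectation (row_sum \<xi> n) = 0" using \<xi>_mean by simp
    moreover have "expectation (\<lambda>x. (\<Sum>j\<in>{1..n}. X n j x)\<^sup>2) = expectation (\<lambda>x. (row_sum \<xi> n x)\<^sup>2)"
      using sum_AE[of n] sum_M by (intro integral_cong_AE) auto
    ultimately show ?thesis by (simp add: row_sd_def)
  qed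
  interpret alpha_array M X Pa Fu K d "phi_mix M N \<zeta> m0" "row_sd M \<xi>"
    by (intro alpha_array.intro alpha_array_axioms.intro prob_space_axioms row sd assms(9))
  have kd: "kolmogorov_distance M \<xi> = kdist"
  proof
    fix n
    have "\<P>(\<omega> in M. row_sum \<xi> n \<omega> / row_sd M \<xi> n \<le> t)
        = measure M {x \<in> space M. (\<Sum>j\<in>{1..n}. X n j x) / row_sd M \<xi> n \<le> t}" for t
      by (rule prob_le_cong_AE[OF sum_M(2) sum_M(1)]) (use sum_AE[of n] in \<open>eventually_elim, simp only:\<close>)
    then show "kolmogorov_distance M \<xi> n = kdist n"
      by (simp add: kolmogorov_distance_def kdist_def)
  qed
  have mixing: "mixing_le M (Pa n s) (Fu n (s + m)) b"
    if al: "alpha_row M N \<zeta> n m \<le> b" and sm: "s + m \<le> n" for n s m b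
    unfolding mixing_le_def
  proof (intro conjI ballI)
    interpret R: mixing_row M n "X n" "Pa n" "Fu n" K d "phi_mix M N \<zeta> m0" by (rule row)
    show "subalgebra M (Pa n s)" "subalgebra M (Fu n (s + m))"
      by (rule R.subalgebra_past R.subalgebra_future)+
    fix A B assume A: "A \<in> sets (Pa n s)" and B: "B \<in> sets (Fu n (s + m))"
    have "{j. 1 \<le> j \<and> j \<le> min s n} = {j. 1 \<le> j \<and> j \<le> s}" using sm by auto
    then have "\<bar>prob (A \<inter> B) - prob A * prob B\<bar> \<le> alpha_row M N \<zeta> n m"
      using A B sm by (intro alpha_row_ge[of s]) (auto simp: Pa_def Fu_def sets_row_algebra)
    then show "\<bar>prob (A \<inter> B) - prob A * prob B\<bar> \<le> b" using al by linarith
  qed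
  show ?thesis
    unfolding kd Let_def
  proof (intro conjI allI impI)
    fix B a :: real
    assume B: "1 < B" and a: "1 < a" and al: "\<forall>n j. 1 \<le> j \<longrightarrow> j \<le> n \<longrightarrow> alpha_row M N \<zeta> n j \<le> B * real j powr (- a)"
    define \<theta> where "\<theta> = 1 - 2 * ((q - 1) / (a * (q - 2) / (2 * q) + 2 * (q - 1)))"
    have \<theta>: "\<theta> \<le> a / (a + 24)" unfolding \<theta>_def by (rule exponent_le[OF a assms(7,8)])
    have "kdist \<in> O(\<lambda>n. row_sd M \<xi> n powr (- (a / (a + 24))))"
      using B a al by (intro kdist_polynomial[of B a] mixing) auto
    also have "(\<lambda>n. row_sd M \<xi> n powr (- (a / (a + 24)))) \<in> O(\<lambda>n. row_sd M \<xi> n powr (- \<theta>))"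
    proof (rule landau_o.big.compose[OF _ assms(9)])
      show "(\<lambda>x::real. x powr (- (a / (a + 24)))) \<in> O[at_top](\<lambda>x. x powr (- \<theta>))"
      proof (rule bigoI[where c=1])
        show "eventually (\<lambda>x::real. norm (x powr (- (a / (a + 24)))) \<le> 1 * norm (x powr (- \<theta>))) at_top"
          using eventually_ge_at_top[of 1] by eventually_elim (use \<theta> in \<open>auto intro!: powr_mono\<close>)
      qed
    qed
    finally show "kdist \<in> O(\<lambda>n. row_sd M \<xi> n powr (- (1 - 2 * ((q - 1) / (a * (q - 2) / (2 * q) + 2 * (q - 1))))))"
      unfolding \<theta>_def .
  next
    fix \<kappa> B :: real
    assume "0 < \<kappa>" "1 < B" and al: "\<forall>n j. 1 \<le> j \<longrightarrow> j \<le> n \<longrightarrow> alpha_row M N \<zeta> n j \<le> B * exp (- \<kappa> * real j)"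
    then show "kdist \<in> O(\<lambda>n. row_sd M \<xi> n powr (- 1) * ln (row_sd M \<xi> n) ^ 3)"
      by (intro kdist_exponential[of B \<kappa>] mixing) auto
  qed
qed

end
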